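(* Let $\mathcal R$ be a small preadditive category such that $Mod\text{-}\mathcal R$ is locally noetherian. Let $\mathscr V\in FI_{\mathcal R}$ be a finitely generated object. Then there exists $N\geq 0$ such that $$\underset{\substack{T\subseteq S\\ |T|\leq N}}{\mathrm{colim}}\ \mathscr V(T)=\mathscr V(S)$$ for each finite set $S$, i.e., the canonical morphism from the colimit (over all subsets $T\subseteq S$ with $|T|\le N$, ordered by inclusion) to $\mathscr V(S)$ is an isomorphism.
   Context: $FI$ is the category of finite sets and injections. For a small preadditive category $\mathcal R$, a right $\mathcal R$-module is an (additive) functor $\mathcal R^{op}\to Ab$, and $Mod\text{-}\mathcal R$ is the category of these. $FI_{\mathcal R}$ is the (Grothendieck) category of functors $\mathscr V:FI\to Mod\text{-}\mathcal R$. An object $X$ of a Grothendieck category is finitely generated if $Hom(X,-)$ preserves filtered colimits of monomorphisms; noetherian if all its subobjects are finitely generated; the category is locally noetherian if it has a set of noetherian generators. *)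

theory Defs
  imports "HOL-Algebra.Group"
begin

section \<open>Categories, functors, colimits\<close>

text \<open>
  Hom-sets are indexed by their end points and need not be disjoint, so composition and the
  action of a functor on morphisms take the objects involved as arguments:
  \<open>Comp C x y z g f\<close> is the composite of \<open>f : x \<rightarrow> y\<close> and \<open>g : y \<rightarrow> z\<close>.
\<close>

record ('o, 'a) cat =
  Ob :: "'o set"
  Mor :: "'o \<Rightarrow> 'o \<Rightarrow> 'a set"
  Ident :: "'o \<Rightarrow> 'a"
  Comp :: "'o \<Rightarrow> 'o \<Rightarrow> 'o \<Rightarrow> 'a \<Rightarrow> 'a \<Rightarrow> 'a"

locale category =
  fixes C :: "('o, 'a, 'z) cat_scheme"
  assumes Ident_in: "x \<in> Ob C \<Longrightarrow> Ident C x \<in> Mor C x x"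
    and Comp_in: "\<lbrakk>x \<in> Ob C; y \<in> Ob C; z \<in> Ob C; f \<in> Mor C x y; g \<in> Mor C y z\<rbrakk>
      \<Longrightarrow> Comp C x y z g f \<in> Mor C x z"
    and Comp_Ident: "\<lbrakk>x \<in> Ob C; y \<in> Ob C; f \<in> Mor C x y\<rbrakk> \<Longrightarrow> Comp C x x y f (Ident C x) = f"
    and Ident_Comp: "\<lbrakk>x \<in> Ob C; y \<in> Ob C; f \<in> Mor C x y\<rbrakk> \<Longrightarrow> Comp C x y y (Ident C y) f = f"
    and Comp_assoc: "\<lbrakk>w \<in> Ob C; x \<in> Ob C; y \<in> Ob C; z \<in> Ob C;
        f \<in> Mor C w x; g \<in> Mor C x y; h \<in> Mor C y z\<rbrakk>
      \<Longrightarrow> Comp C w x z (Comp C x y z h g) f = Comp C w y z h (Comp C w x y g f)"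

definition mono_in :: "('o, 'a, 'z) cat_scheme \<Rightarrow> 'o \<Rightarrow> 'o \<Rightarrow> 'a \<Rightarrow> bool" where
  "mono_in C x y m \<longleftrightarrow> m \<in> Mor C x y \<and>
     (\<forall>w\<in>Ob C. \<forall>f\<in>Mor C w x. \<forall>g\<in>Mor C w x. Comp C w x y m f = Comp C w x y m g \<longrightarrow> f = g)"

definition iso_in :: "('o, 'a, 'z) cat_scheme \<Rightarrow> 'o \<Rightarrow> 'o \<Rightarrow> 'a \<Rightarrow> bool" where
  "iso_in C x y f \<longleftrightarrow> f \<in> Mor C x y \<and>
     (\<exists>g\<in>Mor C y x. Comp C x y x g f = Ident C x \<and> Comp C y x y f g = Ident C y)"

record ('o, 'a, 'p, 'b) fctr =
  Fob :: "'o \<Rightarrow> 'p"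
  Fmor :: "'o \<Rightarrow> 'o \<Rightarrow> 'a \<Rightarrow> 'b"

definition is_functor ::
  "('o, 'a, 'y) cat_scheme \<Rightarrow> ('p, 'b, 'z) cat_scheme \<Rightarrow> ('o, 'a, 'p, 'b) fctr \<Rightarrow> bool" where
  "is_functor C D F \<longleftrightarrow>
     (\<forall>x\<in>Ob C. Fob F x \<in> Ob D) \<and>
     (\<forall>x\<in>Ob C. \<forall>y\<in>Ob C. \<forall>f\<in>Mor C x y. Fmor F x y f \<in> Mor D (Fob F x) (Fob F y)) \<and>
     (\<forall>x\<in>Ob C. Fmor F x x (Ident C x) = Ident D (Fob F x)) \<and>
     (\<forall>x\<in>Ob C. \<forall>y\<in>Ob C. \<forall>z\<in>Ob C. \<forall>f\<in>Mor C x y. \<forall>g\<in>Mor C y z.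
        Fmor F x z (Comp C x y z g f) =
        Comp D (Fob F x) (Fob F y) (Fob F z) (Fmor F y z g) (Fmor F x y f))"

definition fcomp :: "('p, 'b, 'q, 'c) fctr \<Rightarrow> ('o, 'a, 'p, 'b) fctr \<Rightarrow> ('o, 'a, 'q, 'c) fctr" where
  "fcomp G F = \<lparr>Fob = (\<lambda>x. Fob G (Fob F x)),
                Fmor = (\<lambda>x y f. Fmor G (Fob F x) (Fob F y) (Fmor F x y f))\<rparr>"

text \<open>Natural transformations are families indexed by the objects of \<open>C\<close>, made extensional so that
  equality of families is equality of natural transformations.\<close>

definition functor_cat :: "('o, 'a, 'y) cat_scheme \<Rightarrow> ('p, 'b, 'z) cat_scheme \<Rightarrow>
    (('o, 'a, 'p, 'b) fctr, 'o \<Rightarrow> 'b) cat" where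
  "functor_cat C D = \<lparr>
     Ob = {F. is_functor C D F},
     Mor = (\<lambda>F G. {t \<in> (\<Pi>\<^sub>E x\<in>Ob C. Mor D (Fob F x) (Fob G x)).
        \<forall>x\<in>Ob C. \<forall>y\<in>Ob C. \<forall>f\<in>Mor C x y.
          Comp D (Fob F x) (Fob F y) (Fob G y) (t y) (Fmor F x y f) =
          Comp D (Fob F x) (Fob G x) (Fob G y) (Fmor G x y f) (t x)}),
     Ident = (\<lambda>F. \<lambda>x\<in>Ob C. Ident D (Fob F x)),
     Comp = (\<lambda>F G H t s. \<lambda>x\<in>Ob C. Comp D (Fob F x) (Fob G x) (Fob H x) (t x) (s x))\<rparr>"

definition cocone :: "('j, 'k, 'y) cat_scheme \<Rightarrow> ('o, 'a, 'z) cat_scheme \<Rightarrow>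
    ('j, 'k, 'o, 'a) fctr \<Rightarrow> 'o \<Rightarrow> ('j \<Rightarrow> 'a) \<Rightarrow> bool" where
  "cocone J C D L l \<longleftrightarrow> L \<in> Ob C \<and>
     (\<forall>j\<in>Ob J. l j \<in> Mor C (Fob D j) L) \<and>
     (\<forall>i\<in>Ob J. \<forall>j\<in>Ob J. \<forall>a\<in>Mor J i j.
        Comp C (Fob D i) (Fob D j) L (l j) (Fmor D i j a) = l i)"

definition mediates :: "('j, 'k, 'y) cat_scheme \<Rightarrow> ('o, 'a, 'z) cat_scheme \<Rightarrow>
    ('j, 'k, 'o, 'a) fctr \<Rightarrow> 'o \<Rightarrow> ('j \<Rightarrow> 'a) \<Rightarrow> 'o \<Rightarrow> ('j \<Rightarrow> 'a) \<Rightarrow> 'a \<Rightarrow> bool" where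
  "mediates J C D L l M m h \<longleftrightarrow>
     h \<in> Mor C L M \<and> (\<forall>j\<in>Ob J. Comp C (Fob D j) L M h (l j) = m j)"

definition is_colimit :: "('j, 'k, 'y) cat_scheme \<Rightarrow> ('o, 'a, 'z) cat_scheme \<Rightarrow>
    ('j, 'k, 'o, 'a) fctr \<Rightarrow> 'o \<Rightarrow> ('j \<Rightarrow> 'a) \<Rightarrow> bool" where
  "is_colimit J C D L l \<longleftrightarrow> cocone J C D L l \<and>
     (\<forall>M m. cocone J C D M m \<longrightarrow> (\<exists>!h. mediates J C D L l M m h))"

text \<open>The morphism out of a colimit \<open>(L, l)\<close> determined by a cocone \<open>(M, m)\<close>.\<close>

definition colim_map :: "('j, 'k, 'y) cat_scheme \<Rightarrow> ('o, 'a, 'z) cat_scheme \<Rightarrow>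
    ('j, 'k, 'o, 'a) fctr \<Rightarrow> 'o \<Rightarrow> ('j \<Rightarrow> 'a) \<Rightarrow> 'o \<Rightarrow> ('j \<Rightarrow> 'a) \<Rightarrow> 'a" where
  "colim_map J C D L l M m = (THE h. mediates J C D L l M m h)"

definition filtered :: "('j, 'k, 'z) cat_scheme \<Rightarrow> bool" where
  "filtered J \<longleftrightarrow> category J \<and> Ob J \<noteq> {} \<and>
     (\<forall>i\<in>Ob J. \<forall>j\<in>Ob J. \<exists>k\<in>Ob J. Mor J i k \<noteq> {} \<and> Mor J j k \<noteq> {}) \<and>
     (\<forall>i\<in>Ob J. \<forall>j\<in>Ob J. \<forall>u\<in>Mor J i j. \<forall>v\<in>Mor J i j.
        \<exists>k\<in>Ob J. \<exists>w\<in>Mor J j k. Comp J i j k w u = Comp J i j k w v)"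


section \<open>Finitely generated and noetherian objects\<close>

definition set_cat :: "('a set, 'a \<Rightarrow> 'a) cat" where
  "set_cat = \<lparr>Ob = UNIV,
     Mor = (\<lambda>A B. A \<rightarrow>\<^sub>E B),
     Ident = (\<lambda>A. \<lambda>x\<in>A. x),
     Comp = (\<lambda>A B C g f. compose A g f)\<rparr>"

definition hom_functor :: "('o, 'a, 'z) cat_scheme \<Rightarrow> 'o \<Rightarrow> ('o, 'a, 'a set, 'a \<Rightarrow> 'a) fctr" where
  "hom_functor C X = \<lparr>Fob = (\<lambda>Y. Mor C X Y),
     Fmor = (\<lambda>Y Z g. \<lambda>f\<in>Mor C X Y. Comp C X Y Z g f)\<rparr>"

text \<open>
  The type argument is the universe: a set or category is small if its elements (objects and
  morphisms) are taken from that type.  The colimit of the Hom-sets is formed in \<open>set_cat\<close> over the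
  type of morphisms of \<open>C\<close>; the universal property there is the usual one as soon as this type has
  two elements, since a map of sets inducing bijections on maps into a two-element set is bijective.
\<close>

definition finitely_generated :: "'u itself \<Rightarrow> ('o, 'a, 'z) cat_scheme \<Rightarrow> 'o \<Rightarrow> bool" where
  "finitely_generated U C X \<longleftrightarrow> X \<in> Ob C \<and>
     (\<forall>(J :: ('u, 'u) cat) D L l.
        filtered J \<and> is_functor J C D \<and>
        (\<forall>i\<in>Ob J. \<forall>j\<in>Ob J. \<forall>a\<in>Mor J i j. mono_in C (Fob D i) (Fob D j) (Fmor D i j a)) \<and>
        is_colimit J C D L l \<longrightarrow>
        is_colimit J set_cat (fcomp (hom_functor C X) D)
          (Fob (hom_functor C X) L) (\<lambda>j. Fmor (hom_functor C X) (Fob D j) L (l j)))"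

definition noetherian_object :: "'u itself \<Rightarrow> ('o, 'a, 'z) cat_scheme \<Rightarrow> 'o \<Rightarrow> bool" where
  "noetherian_object U C X \<longleftrightarrow> X \<in> Ob C \<and>
     (\<forall>Y\<in>Ob C. \<forall>m. mono_in C Y X m \<longrightarrow> finitely_generated U C Y)"

definition generating :: "('o, 'a, 'z) cat_scheme \<Rightarrow> 'o set \<Rightarrow> bool" where
  "generating C \<G> \<longleftrightarrow> \<G> \<subseteq> Ob C \<and>
     (\<forall>X\<in>Ob C. \<forall>Y\<in>Ob C. \<forall>f\<in>Mor C X Y. \<forall>g\<in>Mor C X Y.
        f \<noteq> g \<longrightarrow> (\<exists>G\<in>\<G>. \<exists>h\<in>Mor C G X. Comp C G X Y f h \<noteq> Comp C G X Y g h))"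

definition locally_noetherian :: "'u itself \<Rightarrow> ('o, 'a, 'z) cat_scheme \<Rightarrow> bool" where
  "locally_noetherian U C \<longleftrightarrow>
     (\<exists>(I :: 'u set) G. generating C (G ` I) \<and> (\<forall>i\<in>I. noetherian_object U C (G i)))"


section \<open>Preadditive categories and modules over them\<close>

text \<open>Abelian groups are \<open>comm_group\<close>s, hence written multiplicatively.\<close>

record ('o, 'a) preadd_cat = "('o, 'a) cat" +
  HomGrp :: "'o \<Rightarrow> 'o \<Rightarrow> 'a monoid"

locale preadditive = category R for R :: "('o, 'a, 'z) preadd_cat_scheme" +
  assumes HomGrp: "\<lbrakk>x \<in> Ob R; y \<in> Ob R\<rbrakk> \<Longrightarrow> comm_group (HomGrp R x y)"
    and carrier_HomGrp: "\<lbrakk>x \<in> Ob R; y \<in> Ob R\<rbrakk> \<Longrightarrow> carrier (HomGrp R x y) = Mor R x y"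
    and Comp_add_left: "\<lbrakk>x \<in> Ob R; y \<in> Ob R; z \<in> Ob R;
        f \<in> Mor R x y; g \<in> Mor R y z; g' \<in> Mor R y z\<rbrakk>
      \<Longrightarrow> Comp R x y z (g \<otimes>\<^bsub>HomGrp R y z\<^esub> g') f =
          Comp R x y z g f \<otimes>\<^bsub>HomGrp R x z\<^esub> Comp R x y z g' f"
    and Comp_add_right: "\<lbrakk>x \<in> Ob R; y \<in> Ob R; z \<in> Ob R;
        f \<in> Mor R x y; f' \<in> Mor R x y; g \<in> Mor R y z\<rbrakk>
      \<Longrightarrow> Comp R x y z g (f \<otimes>\<^bsub>HomGrp R x y\<^esub> f') =
          Comp R x y z g f \<otimes>\<^bsub>HomGrp R x z\<^esub> Comp R x y z g f'"

definition opposite :: "('o, 'a) preadd_cat \<Rightarrow> ('o, 'a) preadd_cat" where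
  "opposite R = \<lparr>Ob = Ob R,
     Mor = (\<lambda>x y. Mor R y x),
     Ident = Ident R,
     Comp = (\<lambda>x y z g f. Comp R z y x f g),
     HomGrp = (\<lambda>x y. HomGrp R y x)\<rparr>"

definition ab_hom :: "'u monoid \<Rightarrow> 'u monoid \<Rightarrow> ('u \<Rightarrow> 'u) set" where
  "ab_hom A B = hom A B \<inter> extensional (carrier A)"

definition Ab :: "('u monoid, 'u \<Rightarrow> 'u) preadd_cat" where
  "Ab = \<lparr>Ob = {A. comm_group A},
     Mor = ab_hom,
     Ident = (\<lambda>A. \<lambda>x\<in>carrier A. x),
     Comp = (\<lambda>A B C g f. compose (carrier A) g f),
     HomGrp = (\<lambda>A B. \<lparr>carrier = ab_hom A B,
        mult = (\<lambda>f g. \<lambda>x\<in>carrier A. f x \<otimes>\<^bsub>B\<^esub> g x),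
        one = (\<lambda>x\<in>carrier A. \<one>\<^bsub>B\<^esub>)\<rparr>)\<rparr>"

definition additive_functor ::
  "('o, 'a) preadd_cat \<Rightarrow> ('p, 'b) preadd_cat \<Rightarrow> ('o, 'a, 'p, 'b) fctr \<Rightarrow> bool" where
  "additive_functor C D F \<longleftrightarrow> is_functor C D F \<and>
     (\<forall>x\<in>Ob C. \<forall>y\<in>Ob C. Fmor F x y \<in> hom (HomGrp C x y) (HomGrp D (Fob F x) (Fob F y)))"

text \<open>From here on \<open>'u\<close> is the universe.  A small preadditive category has its objects and morphisms
  in \<open>'u\<close>, and the abelian groups, as well as the finite sets in \<open>FI\<close>, are carried by subsets
  of \<open>'u\<close>.\<close>

type_synonym 'u small_preadd_cat = "('u, 'u) preadd_cat"
type_synonym 'u rmod = "('u, 'u, 'u monoid, 'u \<Rightarrow> 'u) fctr"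
type_synonym 'u rmod_hom = "'u \<Rightarrow> 'u \<Rightarrow> 'u"

definition Mod_cat :: "'u small_preadd_cat \<Rightarrow> ('u rmod, 'u rmod_hom) cat" where
  "Mod_cat R = (functor_cat (opposite R) Ab)\<lparr>Ob := {M. additive_functor (opposite R) Ab M}\<rparr>"

definition FI :: "('u set, 'u \<Rightarrow> 'u) cat" where
  "FI = \<lparr>Ob = {S. finite S},
     Mor = (\<lambda>S T. {f \<in> S \<rightarrow>\<^sub>E T. inj_on f S}),
     Ident = (\<lambda>S. \<lambda>x\<in>S. x),
     Comp = (\<lambda>S T U g f. compose S g f)\<rparr>"

type_synonym 'u fi_mod = "('u set, 'u \<Rightarrow> 'u, 'u rmod, 'u rmod_hom) fctr"

definition FI_Mod :: "'u small_preadd_cat \<Rightarrow> ('u fi_mod, 'u set \<Rightarrow> 'u rmod_hom) cat" where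
  "FI_Mod R = functor_cat FI (Mod_cat R)"


section \<open>The diagram of small subsets\<close>

definition subsets_cat :: "'u set \<Rightarrow> nat \<Rightarrow> ('u set, unit) cat" where
  "subsets_cat S N = \<lparr>Ob = {T. T \<subseteq> S \<and> card T \<le> N},
     Mor = (\<lambda>T T'. if T \<subseteq> T' then {()} else {}),
     Ident = (\<lambda>_. ()),
     Comp = (\<lambda>_ _ _ _ _. ())\<rparr>"

definition incl :: "'u set \<Rightarrow> 'u \<Rightarrow> 'u" where
  "incl T = (\<lambda>x\<in>T. x)"

definition subsets_to_FI :: "('u set, unit, 'u set, 'u \<Rightarrow> 'u) fctr" where
  "subsets_to_FI = \<lparr>Fob = (\<lambda>T. T), Fmor = (\<lambda>T T' _. incl T)\<rparr>"

definition subsets_diagram :: "'u fi_mod \<Rightarrow> ('u set, unit, 'u rmod, 'u rmod_hom) fctr" where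
  "subsets_diagram V = fcomp V subsets_to_FI"

definition subsets_cocone :: "'u fi_mod \<Rightarrow> 'u set \<Rightarrow> 'u set \<Rightarrow> 'u rmod_hom" where
  "subsets_cocone V S T = Fmor V T S (incl T)"

section \<open>Well-formedness\<close>

lemma category_set_cat: "category set_cat"
  by unfold_locales
    (auto simp: set_cat_def compose_def PiE_def Pi_def extensional_def fun_eq_iff)

lemma category_FI: "category FI"
  by unfold_locales
    (auto simp: FI_def compose_def PiE_def Pi_def extensional_def fun_eq_iff inj_on_def)

lemma category_subsets_cat: "category (subsets_cat S N)"
  by unfold_locales (auto simp: subsets_cat_def split: if_splits)

lemma category_functor_cat:
  assumes "category C" "category D"
  shows "category (functor_cat C D)"
proof -
  interpret C: category C by fact
  interpret D: category D by fact
  show ?thesis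
  proof
    fix F G H s t
    assume "F \<in> Ob (functor_cat C D)" "G \<in> Ob (functor_cat C D)" "H \<in> Ob (functor_cat C D)"
    then have F: "is_functor C D F" and G: "is_functor C D G" and H: "is_functor C D H"
      by (auto simp: functor_cat_def)
    assume s: "s \<in> Mor (functor_cat C D) F G" and t: "t \<in> Mor (functor_cat C D) G H"
    let ?u = "\<lambda>x. Comp D (Fob F x) (Fob G x) (Fob H x) (t x) (s x)"
    have "Comp D (Fob F x) (Fob F y) (Fob H y) (?u y) (Fmor F x y f) =
          Comp D (Fob F x) (Fob H x) (Fob H y) (Fmor H x y f) (?u x)"
      if "x \<in> Ob C" "y \<in> Ob C" "f \<in> Mor C x y" for x y f
    proof -
      have ob: "Fob F x \<in> Ob D" "Fob F y \<in> Ob D" "Fob G x \<in> Ob D" "Fob G y \<in> Ob D"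
        "Fob H x \<in> Ob D" "Fob H y \<in> Ob D"
        using F G H that by (auto simp: is_functor_def)
      have m: "Fmor F x y f \<in> Mor D (Fob F x) (Fob F y)" "Fmor G x y f \<in> Mor D (Fob G x) (Fob G y)"
        "Fmor H x y f \<in> Mor D (Fob H x) (Fob H y)"
        using F G H that by (auto simp: is_functor_def)
      have st: "s x \<in> Mor D (Fob F x) (Fob G x)" "s y \<in> Mor D (Fob F y) (Fob G y)"
        "t x \<in> Mor D (Fob G x) (Fob H x)" "t y \<in> Mor D (Fob G y) (Fob H y)"
        using s t that by (auto simp: functor_cat_def PiE_def Pi_def)
      have nat: "Comp D (Fob F x) (Fob F y) (Fob G y) (s y) (Fmor F x y f) =
          Comp D (Fob F x) (Fob G x) (Fob G y) (Fmor G x y f) (s x)"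
        "Comp D (Fob G x) (Fob G y) (Fob H y) (t y) (Fmor G x y f) =
          Comp D (Fob G x) (Fob H x) (Fob H y) (Fmor H x y f) (t x)"
        using s t that by (auto simp: functor_cat_def)
      show ?thesis
        using ob m st nat D.Comp_assoc by metis
    qed
    moreover have "?u x \<in> Mor D (Fob F x) (Fob H x)" if "x \<in> Ob C" for x
      using F G H s t that
      by (intro D.Comp_in) (auto simp: is_functor_def functor_cat_def PiE_def Pi_def)
    ultimately show "Comp (functor_cat C D) F G H t s \<in> Mor (functor_cat C D) F H"
      by (auto simp: functor_cat_def)
  next
    fix F assume "F \<in> Ob (functor_cat C D)"
    then show "Ident (functor_cat C D) F \<in> Mor (functor_cat C D) F F"
      by (auto simp: functor_cat_def is_functor_def D.Ident_in D.Comp_Ident D.Ident_Comp)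
  next
    fix F G s
    assume "F \<in> Ob (functor_cat C D)" "G \<in> Ob (functor_cat C D)" "s \<in> Mor (functor_cat C D) F G"
    then show "Comp (functor_cat C D) F F G s (Ident (functor_cat C D) F) = s"
      "Comp (functor_cat C D) F G G (Ident (functor_cat C D) G) s = s"
      by (auto simp: functor_cat_def is_functor_def PiE_iff extensional_def fun_eq_iff
          D.Comp_Ident D.Ident_Comp)
  next
    fix F G H K s t u
    assume "F \<in> Ob (functor_cat C D)" "G \<in> Ob (functor_cat C D)" "H \<in> Ob (functor_cat C D)"
      "K \<in> Ob (functor_cat C D)" "s \<in> Mor (functor_cat C D) F G" "t \<in> Mor (functor_cat C D) G H"
      "u \<in> Mor (functor_cat C D) H K"
    then show "Comp (functor_cat C D) F G K (Comp (functor_cat C D) G H K u t) s =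
        Comp (functor_cat C D) F H K u (Comp (functor_cat C D) F G H t s)"
      by (auto simp: functor_cat_def is_functor_def PiE_iff fun_eq_iff intro!: D.Comp_assoc)
  qed
qed

lemma category_full:
  assumes "category C" "A \<subseteq> Ob C"
  shows "category (C\<lparr>Ob := A\<rparr>)"
proof -
  interpret category C by fact
  show ?thesis
    using assms(2)
    by unfold_locales (auto simp: subset_iff Ident_in Comp_in Comp_Ident Ident_Comp Comp_assoc)
qed

lemma preadditive_opposite:
  assumes "preadditive R"
  shows "preadditive (opposite R)"
proof -
  interpret preadditive R by fact
  show ?thesis
  proof (intro preadditive.intro preadditive_axioms.intro)
    show "category (opposite R)"
      by unfold_locales
        (auto simp: opposite_def Ident_in Comp_in Comp_Ident Ident_Comp Comp_assoc)
  qed (auto simp: opposite_def HomGrp carrier_HomGrp Comp_add_left Comp_add_right)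
qed

lemma category_Ab: "category Ab"
  by unfold_locales
    (auto simp: Ab_def ab_hom_def hom_def compose_def Pi_def extensional_def fun_eq_iff
       intro: monoid.m_closed[OF comm_monoid.axioms(1)[OF comm_group.axioms(1)]])

lemma comm_group_ab_hom:
  assumes "comm_group A" "comm_group B"
  shows "comm_group (HomGrp Ab A B)"
proof -
  interpret A: comm_group A by fact
  interpret B: comm_group B by fact
  show ?thesis
  proof (rule comm_groupI)
    fix f assume "f \<in> carrier (HomGrp Ab A B)"
    then show "\<exists>g\<in>carrier (HomGrp Ab A B). g \<otimes>\<^bsub>HomGrp Ab A B\<^esub> f = \<one>\<^bsub>HomGrp Ab A B\<^esub>"
      by (intro bexI[of _ "\<lambda>x\<in>carrier A. inv\<^bsub>B\<^esub> f x"])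
        (auto simp: Ab_def ab_hom_def hom_def Pi_def fun_eq_iff B.inv_mult)
  qed (auto simp: Ab_def ab_hom_def hom_def Pi_def extensional_def fun_eq_iff B.m_ac)
qed

lemma preadditive_Ab: "preadditive Ab"
proof (intro preadditive.intro preadditive_axioms.intro category_Ab)
  show "comm_group (HomGrp Ab A B)" if "A \<in> Ob Ab" "B \<in> Ob Ab" for A B :: "'a monoid"
    using that by (intro comm_group_ab_hom) (auto simp: Ab_def)
qed (auto simp: Ab_def ab_hom_def hom_def Pi_def compose_def fun_eq_iff)

lemma category_Mod_cat:
  assumes "preadditive R"
  shows "category (Mod_cat R)"
  unfolding Mod_cat_def
  using category_functor_cat[OF preadditive.axioms(1)[OF preadditive_opposite[OF assms]] category_Ab]
  by (rule category_full) (auto simp: functor_cat_def additive_functor_def)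

lemma category_FI_Mod: "preadditive R \<Longrightarrow> category (FI_Mod R)"
  unfolding FI_Mod_def by (intro category_functor_cat category_FI category_Mod_cat)

lemma subsets_to_FI: "finite S \<Longrightarrow> is_functor (subsets_cat S N) FI subsets_to_FI"
  by (auto simp: is_functor_def subsets_cat_def FI_def subsets_to_FI_def incl_def compose_def
      inj_on_def fun_eq_iff split: if_splits intro: finite_subset)

lemma subsets_cocone:
  assumes "finite S" "V \<in> Ob (FI_Mod R)"
  shows "cocone (subsets_cat S N) (Mod_cat R) (subsets_diagram V) (Fob V S) (subsets_cocone V S)"
proof -
  have V: "is_functor FI (Mod_cat R) V"
    using assms by (simp add: FI_Mod_def functor_cat_def)
  have incl: "incl T \<in> Mor FI T T'" if "T \<subseteq> T'" for T T' :: "'a set"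
    using that by (auto simp: FI_def incl_def inj_on_def)
  have comp: "Comp FI T T' S (incl T') (incl T) = incl T" if "T \<subseteq> T'" for T T' S :: "'a set"
    using that by (auto simp: FI_def incl_def compose_def fun_eq_iff)
  have fin: "T \<in> Ob FI" if "T \<subseteq> S" for T
    using that assms(1) by (auto simp: FI_def intro: finite_subset)
  show ?thesis
    unfolding cocone_def
  proof (intro conjI ballI)
    show "Fob V S \<in> Ob (Mod_cat R)"
      using V fin by (auto simp: is_functor_def)
  next
    fix T assume "T \<in> Ob (subsets_cat S N)"
    then show "subsets_cocone V S T \<in> Mor (Mod_cat R) (Fob (subsets_diagram V) T) (Fob V S)"
      using V fin[of T] fin[of S] incl[of T S]
      by (auto simp: is_functor_def subsets_cocone_def subsets_diagram_def fcomp_def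
          subsets_to_FI_def subsets_cat_def)
  next
    fix T T' a
    assume T: "T \<in> Ob (subsets_cat S N)" "T' \<in> Ob (subsets_cat S N)"
      "a \<in> Mor (subsets_cat S N) T T'"
    then have sub: "T \<subseteq> T'" "T' \<subseteq> S" "T \<subseteq> S"
      by (auto simp: subsets_cat_def split: if_splits)
    have "Fmor V T S (Comp FI T T' S (incl T') (incl T)) =
        Comp (Mod_cat R) (Fob V T) (Fob V T') (Fob V S) (Fmor V T' S (incl T')) (Fmor V T T' (incl T))"
      using V fin[OF sub(3)] fin[OF sub(2)] fin[OF subset_refl] incl[OF sub(1)] incl[OF sub(2)]
      unfolding is_functor_def by blast
    then show "Comp (Mod_cat R) (Fob (subsets_diagram V) T) (Fob (subsets_diagram V) T') (Fob V S)
        (subsets_cocone V S T') (Fmor (subsets_diagram V) T T' a) = subsets_cocone V S T"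
      using comp[OF sub(1), of S]
      by (simp add: subsets_cocone_def subsets_diagram_def fcomp_def subsets_to_FI_def)
  qed
qed

end

(*
Let d bound the degrees of finitely many generators of V. Then V(S) is a quotient of the sum Q(S) of
all V(T) with T a subset of S and |T| <= d. The kernel K of Q -> V is an FI-submodule, and V is the
colimit of its values on subsets of size at most N as soon as K is generated in degrees <= N: a
relation in K(S) with |S| <= N already holds in the term V(S) of the diagram.

That K is generated in bounded degree is a Groebner argument. Evaluate on S = {0,...,m-1} and order
the subsets of S colexicographically; an order-preserving injection S -> S' is compatible with
leading terms. If relations outside the span of those of degree <= N existed for every N, take for a
suitable sequence of N's one with minimal leading set A inside {0,...,m-1}. By Dickson's lemma, after
passing to a subsequence, each pair (m, A) embeds into the next ones, all A have the same size n, and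
the submodules of leading coefficients form an ascending chain in V({0,...,n-1}). This module is
noetherian, so a leading coefficient already occurs at an earlier stage; subtracting the
corresponding relation of low degree contradicts minimality.

V(S) is noetherian because each of its finitely many generators lies in a submodule satisfying the
ascending chain condition: the sum of all such submodules contains the image of every morphism from a
noetherian generator, hence is everything.
*)

theory Submission
  imports Defs Complex_Main "HOL-Algebra.FiniteProduct" "HOL-Algebra.Coset"
    "HOL-Library.Infinite_Set" "HOL-Library.Nat_Bijection"
begin

section \<open>Finite subsets of the natural numbers\<close>

text \<open>Groups are carried by subsets of the universe \<open>'u\<close>, and colimits in
  \<open>Ab\<close> are tested only against such groups. The sum Q(S) is therefore never formed as a
  module: its elements are families of elements of the V(T), and K(S) is a set of families.
  Generation of K in degrees up to N is replaced by the property the colimit needs: a relation is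
  \<open>good\<close> if every cocone on the subsets of size at most N kills it. Good relations are
  closed under products and under injections, and contain all relations on sets of size at most N;
  the Groebner argument uses no more than this.

  Q is built from the modules V(T) themselves and not from free modules, because an injection h maps
  the summand at T isomorphically onto the summand at h(T). Leading coefficients at sets of equal
  size can thus be compared inside one module.

  An infinite universe enters in three ways: finite sets of every size must exist in
  \<open>'u\<close>, and ascending chains as well as finite sets of generators must be indexed by
  elements of \<open>'u\<close> before finite generation applies to them.\<close>

lemma nat_seq_mono_subseq:
  fixes s :: "nat \<Rightarrow> nat"
  shows "\<exists>\<phi> :: nat \<Rightarrow> nat. strict_mono \<phi> \<and> mono (\<lambda>i. s (\<phi> i))"
proof -
  obtain f :: "nat \<Rightarrow> nat" where f: "strict_mono f" "monoseq (\<lambda>n. s (f n))"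
    using seq_monosub by blast
  show ?thesis
  proof (cases "incseq (\<lambda>n. s (f n))")
    case False
    \<comment> \<open>A decreasing sequence of naturals takes its least value at some
      \<open>k\<close> and is constant from there on.\<close>
    then have dec: "antimono (\<lambda>n. s (f n))"
      using f(2) by (auto simp: monoseq_iff)
    obtain k where k: "\<And>n. s (f k) \<le> s (f n)"
      using ex_has_least_nat[of "\<lambda>_. True" 0 "\<lambda>n. s (f n)"] by auto
    have "s (f (n + k)) = s (f k)" for n
      using antimonoD[OF dec, of k "n + k"] k[of "n + k"] by simp
    moreover have "strict_mono (\<lambda>n. f (n + k))"
      using f(1) by (auto simp: strict_mono_def)
    ultimately show ?thesis
      by (intro exI[of _ "\<lambda>n. f (n + k)"]) (simp add: mono_def del: add.commute)
  qed (use f in auto)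
qed

text \<open>Coordinates are treated one at a time: a subsequence chosen to make coordinate
  \<open>n\<close> monotone leaves the earlier ones monotone.\<close>

lemma dickson_subseq:
  fixes g :: "nat \<Rightarrow> nat \<Rightarrow> nat"
  shows "\<exists>\<phi> :: nat \<Rightarrow> nat. strict_mono \<phi> \<and> (\<forall>k<n. mono (\<lambda>i. g (\<phi> i) k))"
proof (induction n)
  case 0
  then show ?case by (intro exI[of _ id]) (auto simp: strict_mono_def)
next
  case (Suc n)
  then obtain \<phi> :: "nat \<Rightarrow> nat" where \<phi>: "strict_mono \<phi>" "\<And>k. k < n \<Longrightarrow> mono (\<lambda>i. g (\<phi> i) k)"
    by blast
  obtain \<psi> :: "nat \<Rightarrow> nat" where \<psi>: "strict_mono \<psi>" "mono (\<lambda>i. g (\<phi> (\<psi> i)) n)"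
    using nat_seq_mono_subseq[of "\<lambda>i. g (\<phi> i) n"] by blast
  have "mono (\<lambda>i. g (\<phi> (\<psi> i)) k)" if "k < n" for k
    using \<phi>(2)[OF that] strict_mono_mono[OF \<psi>(1)] by (simp add: mono_def)
  with \<phi>(1) \<psi> show ?case
    by (intro exI[of _ "\<lambda>i. \<phi> (\<psi> i)"]) (auto simp: strict_mono_def less_Suc_eq)
qed

text \<open>Read the points \<open>p k\<close> with \<open>k < n\<close> as a subset of an interval
  of length \<open>p n\<close>. Each block of points ending at \<open>p k\<close> is moved rigidly
  by \<open>off k\<close>, the displacement of its right end. Growing gaps make \<open>off\<close>
  nondecreasing, so the order is kept, and the tail before \<open>p n\<close> lands below
  \<open>q n\<close>.\<close>

lemma strict_mono_on_shift:
  fixes p q :: "nat \<Rightarrow> nat"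
  assumes p: "strict_mono_on {..n} p" and q: "strict_mono_on {..n} q"
    and 0: "p 0 \<le> q 0" and gap: "\<And>k. k < n \<Longrightarrow> p (Suc k) - p k \<le> q (Suc k) - q k"
  shows "\<exists>h. strict_mono_on {..<p n} h \<and> h ` {..<p n} \<subseteq> {..<q n} \<and> (\<forall>k<n. h (p k) = q k)"
proof -
  \<comment> \<open>\<open>K x\<close> is the index of the block that contains
    \<open>x\<close>.\<close>
  define K where "K x = (LEAST k. x \<le> p k)" for x
  define off where "off k = q k - p k" for k
  have step: "p k \<le> q k \<and> off k \<le> off (Suc k) \<and> p (Suc k) \<le> q (Suc k)" if "k < n" for k
    using that
  proof (induction k)
    case (Suc k)
    then show ?case
      using gap[of "Suc k"] strict_mono_onD[OF p, of "Suc k" "Suc (Suc k)"]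
        strict_mono_onD[OF q, of "Suc k" "Suc (Suc k)"] by (auto simp: off_def)
  qed (use gap[of 0] 0 strict_mono_onD[OF p, of 0 1] strict_mono_onD[OF q, of 0 1] in
      \<open>auto simp: off_def\<close>)
  have le: "p k \<le> q k" if "k \<le> n" for k
    using step[of k] step[of "k - 1"] 0 that by (cases k) auto
  have off: "off j \<le> off k" if "j \<le> k" "k \<le> n" for j k
    using that
  proof (induction k rule: dec_induct)
    case (step k)
    then show ?case using \<open>\<And>k. k < n \<Longrightarrow> p k \<le> q k \<and> off k \<le> off (Suc k) \<and> p (Suc k) \<le> q
        (Suc k)\<close>[of k] by simp
  qed simp
  have K_le: "K x \<le> k" if "x \<le> p k" for x k
    unfolding K_def using that by (rule Least_le)
  have K_ge: "x \<le> p (K x)" if "x \<le> p n" for x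
    unfolding K_def using that by (rule LeastI)
  have K_mono: "K x \<le> K y" if "x < y" "y \<le> p n" for x y
    using K_le[of x "K y"] K_ge[OF that(2)] that(1) by linarith
  have K_p: "K (p k) = k" if "k \<le> n" for k
  proof (rule antisym)
    have "p k \<le> p (K (p k))" "K (p k) \<le> n"
      using that K_ge K_le[of "p k" n] K_le[of "p k" k] strict_mono_on_leD[OF p, of k n] by auto
    then show "k \<le> K (p k)"
      using strict_mono_onD[OF p, of "K (p k)" k] that by (meson atMost_iff leD leI)
  qed (simp add: K_le)
  define h where "h x = x + off (K x)" for x
  have "strict_mono_on {..<p n} h"
  proof (rule strict_mono_onI)
    fix x y assume "x \<in> {..<p n}" "y \<in> {..<p n}" "x < y"
    then show "h x < h y"
      using off[OF K_mono[of x y]] K_le[of y n] by (simp add: h_def)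
  qed
  moreover have "h x < q n" if "x < p n" for x
    using that off[OF K_le[of x n]] le[of n] by (simp add: h_def off_def)
  moreover have "h (p k) = q k" if "k < n" for k
    using K_p[of k] le[of k] that by (simp add: h_def off_def)
  ultimately show ?thesis by blast
qed

text \<open>Dickson's lemma, applied to the gaps between consecutive elements of \<open>A i \<union> {m i}\<close>.\<close>

lemma subsets_good_subseq:
  fixes A :: "nat \<Rightarrow> nat set" and m :: "nat \<Rightarrow> nat"
  assumes A: "\<And>i. A i \<subseteq> {..<m i}" and card: "\<And>i. card (A i) \<le> d"
  shows "\<exists>(\<phi> :: nat \<Rightarrow> nat) n. strict_mono \<phi> \<and> (\<forall>i. card (A (\<phi> i)) = n) \<and>
    (\<forall>i j. i < j \<longrightarrow> (\<exists>h. strict_mono_on {..<m (\<phi> i)} h \<and> h ` {..<m (\<phi> i)} \<subseteq> {..<m (\<phi> j)} \<and>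
      h ` A (\<phi> i) = A (\<phi> j)))"
proof -
  have "finite ((\<lambda>i. card (A i)) ` UNIV)"
    by (rule finite_subset[of _ "{..d}"]) (use card in auto)
  then obtain i0 where inf: "infinite {i \<in> UNIV. card (A i) = card (A i0)}"
    using pigeonhole_infinite[OF infinite_UNIV_nat, of "\<lambda>i. card (A i)"] by blast
  define n where "n = card (A i0)"
  obtain \<theta> :: "nat \<Rightarrow> nat" where \<theta>: "strict_mono \<theta>" "\<And>i. card (A (\<theta> i)) = n"
    using infinite_enumerate[OF inf] by (auto simp: n_def)
  have "\<exists>p. strict_mono_on {..n} p \<and> p ` {..<n} = A i \<and> p n = m i" if "card (A i) = n" for i
  proof -
    have "finite (A i)" using A finite_subset by blast
    then obtain h where h: "bij_betw h {..<card (A i)} (A i)" "strict_mono_on {..<card (A i)} h"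
      using ex_bij_betw_strict_mono_card by blast
    \<comment> \<open>The size \<open>m i\<close> is appended as an \<open>n\<close>-th point above
      \<open>A i\<close>, so that the last gap measures the room left above the largest
      element.\<close>
    have "strict_mono_on {..n} (h(n := m i))"
      using h A[of i] that
      by (intro strict_mono_onI) (auto simp: strict_mono_on_def bij_betw_def image_def subset_iff)
    moreover have "(h(n := m i)) ` {..<n} = A i"
      using h that by (auto simp: bij_betw_def image_def)
    ultimately show ?thesis by (intro exI[of _ "h(n := m i)"]) simp
  qed
  then have "\<forall>i. \<exists>p. strict_mono_on {..n} p \<and> p ` {..<n} = A (\<theta> i) \<and> p n = m (\<theta> i)"
    using \<theta>(2) by blast
  from choice[OF this] obtain p where p: "\<And>i. strict_mono_on {..n} (p i)"
    "\<And>i. p i ` {..<n} = A (\<theta> i)" "\<And>i. p i n = m (\<theta> i)"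
    by blast
  define g where "g i k = (case k of 0 \<Rightarrow> p i 0 | Suc j \<Rightarrow> p i (Suc j) - p i j)" for i k
  obtain \<psi> :: "nat \<Rightarrow> nat" where \<psi>: "strict_mono \<psi>" "\<And>k. k < Suc n \<Longrightarrow> mono (\<lambda>i. g (\<psi> i) k)"
    using dickson_subseq[of "Suc n" g] by blast
  have "\<exists>h. strict_mono_on {..<m (\<theta> (\<psi> i))} h \<and> h ` {..<m (\<theta> (\<psi> i))} \<subseteq> {..<m (\<theta> (\<psi> j))} \<and>
      h ` A (\<theta> (\<psi> i)) = A (\<theta> (\<psi> j))" if "i < j" for i j
  proof -
    have "g (\<psi> i) k \<le> g (\<psi> j) k" if "k < Suc n" for k
      using \<psi>(2)[OF that] \<open>i < j\<close> by (simp add: mono_def)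
    from this[of 0] this[of "Suc k" for k]
    obtain h where "strict_mono_on {..<p (\<psi> i) n} h" "h ` {..<p (\<psi> i) n} \<subseteq> {..<p (\<psi> j) n}"
      "\<forall>k<n. h (p (\<psi> i) k) = p (\<psi> j) k"
      using strict_mono_on_shift[OF p(1) p(1), of "\<psi> i" "\<psi> j"] unfolding g_def by auto
    moreover from this(3) have "h ` A (\<theta> (\<psi> i)) = A (\<theta> (\<psi> j))"
      unfolding p(2)[symmetric] image_image by (intro image_cong) auto
    ultimately show ?thesis by (auto simp: p(3))
  qed
  then show ?thesis
    using \<theta> \<psi>(1) by (intro exI[of _ "\<lambda>i. \<theta> (\<psi> i)"] exI[of _ n]) (auto simp: strict_mono_def)
qed

section \<open>Increasing enumerations and the colexicographic order\<close>

lemma strict_mono_on_enumeration_unique: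
  fixes f g :: "nat \<Rightarrow> nat"
  assumes f: "strict_mono_on {..<n} f" and g: "strict_mono_on {..<n} g"
      and "f ` {..<n} = g ` {..<n}" and k: "k < n"
  shows "f k = g k"
proof -
  have s: "sorted (map h [0..<n])" "distinct (map h [0..<n])" if "strict_mono_on {..<n} h"
      for h :: "nat \<Rightarrow> nat"
    using that strict_mono_on_imp_inj_on[OF that]
    by (auto simp: sorted_iff_nth_mono distinct_map atLeast0LessThan strict_mono_on_leD)
  \<comment> \<open>Both enumerations are sorted lists without repetition, and such a list is
    determined by its set of entries. Later this forces an embedding of one leading set onto another
    to match their \<open>k\<close>-th elements.\<close>
  have "map f [0..<n] = map g [0..<n]"
    by (rule sorted_distinct_set_unique) (use s f g assms(3) in \<open>auto simp: atLeast0LessThan\<close>)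
  then show ?thesis using k by (auto dest!: map_eq_conv[THEN iffD1])
qed

text \<open>Here \<open>b\<close> is the highest binary digit in which the two codes differ, and the
  digits of \<open>A\<close> below \<open>b\<close> add up to less than
  \<open>2 ^ b\<close>.\<close>

lemma set_encode_lessI:
  assumes "finite A" "finite B" "b \<in> B" "b \<notin> A" "\<And>x. b < x \<Longrightarrow> x \<in> A \<longleftrightarrow> x \<in> B"
  shows "set_encode A < set_encode B"
proof -
  have le: "set_encode {x\<in>A. x < b} < 2 ^ b"
  proof -
    have "set_encode {x\<in>A. x < b} \<le> (\<Sum>x<b. 2 ^ x)"
      unfolding set_encode_def by (intro sum_mono2) auto
    also have "\<dots> < 2 ^ b" by (induction b) auto
    finally show ?thesis .
  qed
  have A: "A = {x\<in>A. x < b} \<union> {x\<in>A. b < x}"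
    using assms(4) by (auto simp: not_less_iff_gr_or_eq)
  have "set_encode A = set_encode {x\<in>A. x < b} + set_encode {x\<in>A. b < x}"
    unfolding set_encode_def by (subst A, subst sum.union_disjoint) (use assms(1) in auto)
  also have "\<dots> < 2 ^ b + set_encode {x\<in>A. b < x}" using le by simp
  also have "\<dots> = set_encode (insert b {x\<in>A. b < x})"
    using assms(1) by simp
  also have "\<dots> \<le> set_encode B"
    unfolding set_encode_def by (intro sum_mono2) (use assms in auto)
  finally show ?thesis .
qed

text \<open>The largest point of the symmetric difference decides the order, and a strictly
  increasing map sends it to the largest point of the symmetric difference of the images.\<close>

lemma set_encode_image_less:
  assumes h: "strict_mono_on X h" and AB: "A \<subseteq> X" "B \<subseteq> X" "finite A" "finite B"
    and less: "set_encode A < set_encode B"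
  shows "set_encode (h ` A) < set_encode (h ` B)"
proof -
  define D where "D = (A - B) \<union> (B - A)"
  have fin: "finite D" and ne: "D \<noteq> {}" using assms by (auto simp: D_def)
  define b where "b = Max D"
  have b: "b \<in> D" "\<And>x. b < x \<Longrightarrow> x \<notin> D"
    using Max_in[OF fin ne] Max_ge[OF fin] by (auto simp: b_def not_le[symmetric])
  then have eq: "\<And>x. b < x \<Longrightarrow> x \<in> A \<longleftrightarrow> x \<in> B" by (auto simp: D_def)
  have "b \<notin> A - B"
    using set_encode_lessI[of B A b] eq AB less by auto
  then have bB: "b \<in> B" "b \<notin> A" using b(1) by (auto simp: D_def)
  have inj: "inj_on h X" using h by (rule strict_mono_on_imp_inj_on)
  show ?thesis
  proof (rule set_encode_lessI[where b = "h b"])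
    show "h b \<notin> h ` A"
      using bB AB inj by (auto simp: inj_on_def)
    fix x assume x: "h b < x"
    have *: "b < y" if "h b < h y" "y \<in> A \<union> B" for y
      using that h AB bB(1) by (metis Un_iff linorder_neqE_nat order_less_asym strict_mono_on_def
          subsetD)
    show "x \<in> h ` A \<longleftrightarrow> x \<in> h ` B"
      using x * eq by (auto simp: image_iff)
  qed (use AB bB in auto)
qed

section \<open>Infinite types\<close>

lemma infinite_inj_pair:
  assumes "infinite (UNIV :: 'u set)"
  shows "\<exists>f :: 'u \<times> 'u \<Rightarrow> 'u. inj f"
  using card_of_Times_same_infinite[OF assms]
      card_of_ordLeq[of "UNIV :: ('u \<times> 'u) set" "UNIV :: 'u set"]
    ordIso_iff_ordLeq by auto

lemma infinite_surj_lists: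
  assumes "infinite (UNIV :: 'u set)"
  shows "\<exists>f :: 'u \<Rightarrow> 'u list. surj f"
proof -
  obtain pr :: "'u \<times> 'u \<Rightarrow> 'u" where pr: "inj pr" using infinite_inj_pair[OF assms] by blast
  obtain \<iota> :: "nat \<Rightarrow> 'u" where \<iota>: "inj \<iota>" using assms infinite_countable_subset by blast
  \<comment> \<open>The code \<open>c\<close> is injective only among lists of one length, as the
    end marker \<open>undefined\<close> may itself be a value of \<open>pr\<close>. Hence the length
    is recorded separately.\<close>
  define c where "c xs = foldr (\<lambda>x z. pr (x, z)) xs undefined" for xs
  have c: "xs = ys" if "length xs = length ys" "c xs = c ys" for xs ys
    using that by (induction xs ys rule: list_induct2) (auto simp: c_def dest: injD[OF pr])
  have "inj (\<lambda>xs. pr (\<iota> (length xs), c xs))"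
    by (rule injI) (auto dest!: injD[OF pr] injD[OF \<iota>] intro: c)
  from inj_imp_surj_inv[OF this] show ?thesis by blast
qed

text \<open>A triple will stand for a degree, an object and a module element, so a list of triples
  codes a finite set of generators. The surjection lets \<open>'u\<close> index all these finite
  sets.\<close>

lemma infinite_surj_gen_lists:
  assumes "infinite (UNIV :: 'u set)"
  shows "\<exists>f :: 'u \<Rightarrow> (nat \<times> 'u \<times> 'u) list. surj f"
proof -
  obtain pr :: "'u \<times> 'u \<Rightarrow> 'u" where pr: "inj pr" using infinite_inj_pair[OF assms] by blast
  obtain \<iota> :: "nat \<Rightarrow> 'u" where \<iota>: "inj \<iota>" using assms infinite_countable_subset by blast
  obtain f :: "'u \<Rightarrow> 'u list" where f: "surj f" using infinite_surj_lists[OF assms] by blast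
  have "inj (\<lambda>(n, x, y). pr (\<iota> n, pr (x, y)))"
    by (rule injI) (auto dest!: injD[OF pr] injD[OF \<iota>])
  from inj_imp_surj_inv[OF this] obtain g :: "'u \<Rightarrow> nat \<times> 'u \<times> 'u" where g: "surj g" by blast
  have "surj (map g)"
    using g by (metis lists_UNIV lists_image surj_def UNIV_I image_iff)
  from comp_surj[OF f this] show ?thesis by blast
qed

section \<open>Colimits and finitely generated objects\<close>

lemma mediates_unique:
  assumes "is_colimit J C D L l" "cocone J C D M m"
    and "mediates J C D L l M m h" "mediates J C D L l M m h'"
  shows "h = h'"
  using assms unfolding is_colimit_def by metis

lemma colim_map_mediates:
  assumes "is_colimit J C D L l" "cocone J C D M m"
  shows "mediates J C D L l M m (colim_map J C D L l M m)"
  unfolding colim_map_def using assms unfolding is_colimit_def by (metis theI')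

lemma mediates_comp:
  assumes "category C" "\<And>j. j \<in> Ob J \<Longrightarrow> Fob D j \<in> Ob C"
    and "cocone J C D L l" "L' \<in> Ob C" "L'' \<in> Ob C"
    and "mediates J C D L l L' l' h" "mediates J C D L' l' L'' l'' g"
  shows "mediates J C D L l L'' l'' (Comp C L L' L'' g h)"
proof -
  interpret category C by fact
  show ?thesis
    using assms(2-) unfolding mediates_def cocone_def by (auto simp: Comp_in Comp_assoc)
qed

text \<open>Both composites of the canonical maps mediate a colimit cocone to itself, and so do the
  identities. It therefore suffices for the theorem to show that V(S) with its own cocone is one
  colimit.\<close>

lemma colim_map_iso:
  assumes C: "category C" and D: "\<And>j. j \<in> Ob J \<Longrightarrow> Fob D j \<in> Ob C"
    and L: "is_colimit J C D L l" and M: "is_colimit J C D M m"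
  shows "iso_in C L M (colim_map J C D L l M m)"
proof -
  interpret category C by fact
  have cL: "cocone J C D L l" and cM: "cocone J C D M m"
    using L M by (auto simp: is_colimit_def)
  then have ob: "L \<in> Ob C" "M \<in> Ob C" by (auto simp: cocone_def)
  let ?h = "colim_map J C D L l M m" and ?g = "colim_map J C D M m L l"
  have h: "mediates J C D L l M m ?h" and g: "mediates J C D M m L l ?g"
    by (rule colim_map_mediates[OF L cM], rule colim_map_mediates[OF M cL])
  have id: "mediates J C D X x X x (Ident C X)" if "cocone J C D X x" for X x
    using that D unfolding mediates_def cocone_def by (auto simp: Ident_in Ident_Comp)
  have "Comp C L M L ?g ?h = Ident C L" "Comp C M L M ?h ?g = Ident C M"
    using mediates_unique[OF L cL] mediates_unique[OF M cM] id[OF cL] id[OF cM]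
      mediates_comp[OF C D cL ob(2,1) h g] mediates_comp[OF C D cM ob(1,2) g h] by blast+
  with h g show ?thesis unfolding iso_in_def mediates_def by blast
qed

text \<open>Maps out of the colimit would not see a point outside all images: the constant map and
  the map singling out this point agree on every leg. Two distinct values \<open>a\<close> and
  \<open>b\<close> tell these maps apart.\<close>

lemma colimit_set_cat_surj:
  fixes D :: "('j, 'k, 'a set, 'a \<Rightarrow> 'a) fctr"
  assumes D: "is_functor J set_cat D" and L: "is_colimit J set_cat D L l"
    and ab: "(a :: 'a) \<noteq> b" and y: "y \<in> L"
  shows "\<exists>j\<in>Ob J. \<exists>x\<in>Fob D j. l j x = y"
proof (rule ccontr)
  assume *: "\<not> ?thesis"
  define m where "m j = (\<lambda>x\<in>Fob D j. a)" for j
  have l: "l j \<in> Fob D j \<rightarrow>\<^sub>E L" if "j \<in> Ob J" for j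
    using L that by (auto simp: is_colimit_def cocone_def set_cat_def)
  have c: "cocone J set_cat D {a, b} m"
    unfolding cocone_def
  proof (intro conjI ballI)
    fix i j f assume "i \<in> Ob J" "j \<in> Ob J" "f \<in> Mor J i j"
    then have "Fmor D i j f \<in> Fob D i \<rightarrow>\<^sub>E Fob D j"
      using D by (auto simp: is_functor_def set_cat_def)
    then show "Comp set_cat (Fob D i) (Fob D j) {a, b} (m j) (Fmor D i j f) = m i"
      by (auto simp: set_cat_def m_def compose_def fun_eq_iff)
  qed (auto simp: set_cat_def m_def)
  have "mediates J set_cat D L l {a, b} m (\<lambda>x\<in>L. a)"
    using l by (fastforce simp: mediates_def set_cat_def m_def compose_def fun_eq_iff PiE_iff)
  moreover have "mediates J set_cat D L l {a, b} m (\<lambda>x\<in>L. if x = y then b else a)"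
    using l * by (fastforce simp: mediates_def set_cat_def m_def compose_def fun_eq_iff PiE_iff)
  ultimately have "(\<lambda>x\<in>L. a) = (\<lambda>x\<in>L. if x = y then b else a)"
    by (rule mediates_unique[OF L c])
  from fun_cong[OF this, of y] show False using ab y by simp
qed

text \<open>The Hom-sets from \<open>X\<close> into the diagram have colimit
  \<open>Mor C X X\<close>, so the identity of \<open>X\<close> comes from some stage. The values
  \<open>a\<close> and \<open>b\<close> live in the type of morphisms, over which
  \<open>set_cat\<close> is taken.\<close>

lemma finitely_generated_split:
  fixes C :: "('o, 'a, 'z) cat_scheme" and J :: "('u, 'u) cat"
  assumes C: "category C" and X: "finitely_generated TYPE('u) C X"
    and J: "filtered J" and D: "is_functor J C D"
    and mono: "\<And>i j a. i \<in> Ob J \<Longrightarrow> j \<in> Ob J \<Longrightarrow> a \<in> Mor J i j \<Longrightarrow>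
      mono_in C (Fob D i) (Fob D j) (Fmor D i j a)"
    and L: "is_colimit J C D X l" and ab: "(a :: 'a) \<noteq> b"
  shows "\<exists>j\<in>Ob J. \<exists>s\<in>Mor C X (Fob D j). Comp C X (Fob D j) X (l j) s = Ident C X"
proof -
  interpret category C by fact
  have XC: "X \<in> Ob C" using X by (simp add: finitely_generated_def)
  let ?H = "fcomp (hom_functor C X) D"
  have col: "is_colimit J set_cat ?H (Mor C X X)
      (\<lambda>j. \<lambda>f\<in>Mor C X (Fob D j). Comp C X (Fob D j) X (l j) f)"
    using X J D mono L unfolding finitely_generated_def by (fastforce simp: hom_functor_def)
  have "is_functor J set_cat ?H"
    using D XC unfolding is_functor_def
    by (auto simp: set_cat_def fcomp_def hom_functor_def compose_def fun_eq_iff Ident_Comp Comp_in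
        Comp_assoc)
  from colimit_set_cat_surj[OF this col ab Ident_in[OF XC]]
  show ?thesis by (force simp: fcomp_def hom_functor_def)
qed

section \<open>Pointwise colimits and monomorphisms of functors\<close>

lemma is_colimit_functor_cat:
  assumes C: "category C" and D: "category D" and F: "is_functor J (functor_cat C D) F"
    and l: "cocone J (functor_cat C D) F L l"
    and pt: "\<And>x. x \<in> Ob C \<Longrightarrow> is_colimit J D
      \<lparr>Fob = (\<lambda>j. Fob (Fob F j) x), Fmor = (\<lambda>i j a. Fmor F i j a x)\<rparr> (Fob L x) (\<lambda>j. l j x)"
  shows "is_colimit J (functor_cat C D) F L l"
proof -
  interpret D: category D by fact
  let ?E = "\<lambda>x. \<lparr>Fob = (\<lambda>j. Fob (Fob F j) x), Fmor = (\<lambda>i j a. Fmor F i j a x)\<rparr>"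
  have Fj: "is_functor C D (Fob F j)" if "j \<in> Ob J" for j
    using F that by (auto simp: is_functor_def[of J] functor_cat_def)
  have Fob: "Fob (Fob F j) x \<in> Ob D" if "j \<in> Ob J" "x \<in> Ob C" for j x
    using Fj that by (auto simp: is_functor_def)
  have LL: "is_functor C D L" using l by (auto simp: cocone_def functor_cat_def)
  have "\<exists>!h. mediates J (functor_cat C D) F L l M m h" if m: "cocone J (functor_cat C D) F M m"
      for M m
  proof -
    have MM: "is_functor C D M" using m by (auto simp: cocone_def functor_cat_def)
    have ob: "Fob L x \<in> Ob D" "Fob M x \<in> Ob D" if "x \<in> Ob C" for x
      using LL MM that by (auto simp: is_functor_def)
    have lj: "l j x \<in> Mor D (Fob (Fob F j) x) (Fob L x)"
      and mj: "m j x \<in> Mor D (Fob (Fob F j) x) (Fob M x)"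
      if "j \<in> Ob J" "x \<in> Ob C" for j x
      using l m that by (auto simp: cocone_def functor_cat_def PiE_iff)
    have lnat: "Comp D (Fob (Fob F j) x) (Fob (Fob F j) y) (Fob L y) (l j y) (Fmor (Fob F j) x y f)
        =
        Comp D (Fob (Fob F j) x) (Fob L x) (Fob L y) (Fmor L x y f) (l j x)"
      and mnat: "Comp D (Fob (Fob F j) x) (Fob (Fob F j) y) (Fob M y) (m j y) (Fmor (Fob F j) x y f)
          =
        Comp D (Fob (Fob F j) x) (Fob M x) (Fob M y) (Fmor M x y f) (m j x)"
      if "j \<in> Ob J" "x \<in> Ob C" "y \<in> Ob C" "f \<in> Mor C x y" for j x y f
      using l m that by (auto simp: cocone_def functor_cat_def)
    have mc: "Comp D (Fob (Fob F i) x) (Fob (Fob F j) x) (Fob M x) (m j x) (Fmor F i j a x) = m i x"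
      if "i \<in> Ob J" "j \<in> Ob J" "a \<in> Mor J i j" "x \<in> Ob C" for i j a x
    proof -
      have "Comp (functor_cat C D) (Fob F i) (Fob F j) M (m j) (Fmor F i j a) = m i"
        using m that by (auto simp: cocone_def)
      from fun_cong[OF this, of x] show ?thesis using that by (simp add: functor_cat_def)
    qed
    have Fmor: "Fmor F i j a x \<in> Mor D (Fob (Fob F i) x) (Fob (Fob F j) x)"
      if "i \<in> Ob J" "j \<in> Ob J" "a \<in> Mor J i j" "x \<in> Ob C" for i j a x
      using F that by (auto simp: is_functor_def[of J] functor_cat_def PiE_iff)
    have cM: "cocone J D (?E x) (Fob M x) (\<lambda>j. m j x)" if "x \<in> Ob C" for x
      using that by (auto simp: cocone_def ob mj mc)
    define h where "h = (\<lambda>x\<in>Ob C. colim_map J D (?E x) (Fob L x) (\<lambda>j. l j x) (Fob M x) (\<lambda>j. m j x))"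
    have h: "mediates J D (?E x) (Fob L x) (\<lambda>j. l j x) (Fob M x) (\<lambda>j. m j x) (h x)" if "x \<in> Ob C"
        for x
      using colim_map_mediates[OF pt cM] that by (simp add: h_def)
    then have hM: "h x \<in> Mor D (Fob L x) (Fob M x)" if "x \<in> Ob C" for x
      using that by (auto simp: mediates_def)
    have hl: "Comp D (Fob (Fob F j) x) (Fob L x) (Fob M x) (h x) (l j x) = m j x"
      if "j \<in> Ob J" "x \<in> Ob C" for j x
      using h that by (auto simp: mediates_def)
    have hnat: "Comp D (Fob L x) (Fob L y) (Fob M y) (h y) (Fmor L x y f) =
        Comp D (Fob L x) (Fob M x) (Fob M y) (Fmor M x y f) (h x)"
      if xy: "x \<in> Ob C" "y \<in> Ob C" and f: "f \<in> Mor C x y" for x y f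
    proof -
      have Lf: "Fmor L x y f \<in> Mor D (Fob L x) (Fob L y)"
        and Mf: "Fmor M x y f \<in> Mor D (Fob M x) (Fob M y)"
        and Ff: "\<And>j. j \<in> Ob J \<Longrightarrow> Fmor (Fob F j) x y f \<in> Mor D (Fob (Fob F j) x) (Fob (Fob F j) y)"
        using LL MM Fj xy f by (auto simp: is_functor_def)
      \<comment> \<open>Naturality of \<open>h\<close> is tested on the legs: \<open>?k\<close> is
        the cocone at \<open>x\<close> that arises from \<open>m\<close> by composition with
        \<open>Fmor M x y f\<close>, and both sides of the naturality square mediate it.\<close>
      let ?k = "\<lambda>j. Comp D (Fob (Fob F j) x) (Fob M x) (Fob M y) (Fmor M x y f) (m j x)"
      have "Comp D (Fob (Fob F i) x) (Fob (Fob F j) x) (Fob M y) (?k j) (Fmor F i j a x) = ?k i"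
        if "i \<in> Ob J" "j \<in> Ob J" "a \<in> Mor J i j" for i j a
        using that xy by (subst D.Comp_assoc) (auto simp: Fob ob Fmor Mf mj mc)
      then have k: "cocone J D (?E x) (Fob M y) ?k"
        using xy Mf by (auto simp: cocone_def ob intro!: D.Comp_in Fob mj)
      have "mediates J D (?E x) (Fob L x) (\<lambda>j. l j x) (Fob M y) ?k
          (Comp D (Fob L x) (Fob M x) (Fob M y) (Fmor M x y f) (h x))"
        using xy by (auto simp: mediates_def D.Comp_assoc hl Fob ob lj hM Mf intro!: D.Comp_in)
      moreover have "mediates J D (?E x) (Fob L x) (\<lambda>j. l j x) (Fob M y) ?k
          (Comp D (Fob L x) (Fob L y) (Fob M y) (h y) (Fmor L x y f))"
        unfolding mediates_def
      proof (intro conjI ballI)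
        fix j assume j: "j \<in> Ob J"
        have "Comp D (Fob (Fob F j) x) (Fob L x) (Fob M y)
            (Comp D (Fob L x) (Fob L y) (Fob M y) (h y) (Fmor L x y f)) (l j x)
          = Comp D (Fob (Fob F j) x) (Fob L y) (Fob M y) (h y)
             (Comp D (Fob (Fob F j) x) (Fob (Fob F j) y) (Fob L y) (l j y) (Fmor (Fob F j) x y f))"
          using j xy Lf f by (simp add: D.Comp_assoc Fob ob lj hM lnat)
        also have "\<dots> = Comp D (Fob (Fob F j) x) (Fob (Fob F j) y) (Fob M y) (m j y)
            (Fmor (Fob F j) x y f)"
          using j xy Ff f by (simp add: D.Comp_assoc[symmetric] Fob ob lj hM hl)
        finally show "Comp D (Fob (?E x) j) (Fob L x) (Fob M y)
            (Comp D (Fob L x) (Fob L y) (Fob M y) (h y) (Fmor L x y f)) (l j x) = ?k j"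
          using j xy f by (simp add: mnat)
      qed (use xy Lf in \<open>auto simp: ob hM intro!: D.Comp_in\<close>)
      ultimately show ?thesis
        by (rule mediates_unique[OF pt[OF xy(1)] k, symmetric])
    qed
    have "mediates J (functor_cat C D) F L l M m h"
      unfolding mediates_def
    proof (intro conjI ballI)
      show "h \<in> Mor (functor_cat C D) L M"
        using hM hnat by (auto simp: functor_cat_def PiE_iff) (simp add: h_def)
      fix j assume j: "j \<in> Ob J"
      then have "m j \<in> extensional (Ob C)"
        using m by (auto simp: cocone_def functor_cat_def PiE_iff)
      then show "Comp (functor_cat C D) (Fob F j) L M h (l j) = m j"
        using j by (auto simp: functor_cat_def hl fun_eq_iff extensional_def)
    qed
    moreover have "h' = h" if h': "mediates J (functor_cat C D) F L l M m h'" for h'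
    proof
      fix x
      show "h' x = h x"
      proof (cases "x \<in> Ob C")
        case True
        have "mediates J D (?E x) (Fob L x) (\<lambda>j. l j x) (Fob M x) (\<lambda>j. m j x) (h' x)"
          unfolding mediates_def
        proof (intro conjI ballI)
          show "h' x \<in> Mor D (Fob L x) (Fob M x)"
            using h' True by (auto simp: mediates_def functor_cat_def PiE_iff)
          fix j assume j: "j \<in> Ob J"
          then have "Comp (functor_cat C D) (Fob F j) L M h' (l j) = m j"
            using h' by (auto simp: mediates_def)
          from fun_cong[OF this, of x]
          show "Comp D (Fob (?E x) j) (Fob L x) (Fob M x) (h' x) (l j x) = m j x"
            using True by (simp add: functor_cat_def)
        qed
        then show ?thesis using mediates_unique[OF pt cM _ h] True by blast
      next
        case False
        then show ?thesis
          using h' by (auto simp: h_def mediates_def functor_cat_def PiE_iff extensional_def)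
      qed
    qed
    ultimately show ?thesis by blast
  qed
  with l show ?thesis by (simp add: is_colimit_def)
qed

text \<open>Additive functors form a full subcategory of all functors. A colimit computed pointwise
  among all functors stays a colimit there once its vertex is additive.\<close>

lemma is_colimit_full:
  assumes "is_colimit J C D L l" "L \<in> A" "A \<subseteq> Ob C"
  shows "is_colimit J (C\<lparr>Ob := A\<rparr>) D L l"
proof -
  have med: "mediates J (C\<lparr>Ob := A\<rparr>) D L l M m h = mediates J C D L l M m h" for M m h
    by (simp add: mediates_def)
  have "cocone J (C\<lparr>Ob := A\<rparr>) D M m \<longleftrightarrow> M \<in> A \<and> cocone J C D M m" for M m
    using assms(3) by (auto simp: cocone_def)
  with assms show ?thesis by (simp add: is_colimit_def med)
qed

lemma mono_in_full:
  assumes "mono_in C x y m" "A \<subseteq> Ob C"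
  shows "mono_in (C\<lparr>Ob := A\<rparr>) x y m"
  using assms by (auto simp: mono_in_def)

lemma mono_in_functor_cat:
  assumes t: "t \<in> Mor (functor_cat C D) F G"
    and mono: "\<And>x. x \<in> Ob C \<Longrightarrow> mono_in D (Fob F x) (Fob G x) (t x)"
  shows "mono_in (functor_cat C D) F G t"
  unfolding mono_in_def
proof (intro conjI ballI impI t)
  fix H f g
  assume H: "H \<in> Ob (functor_cat C D)" and fg: "f \<in> Mor (functor_cat C D) H F"
      "g \<in> Mor (functor_cat C D) H F"
    and eq: "Comp (functor_cat C D) H F G t f = Comp (functor_cat C D) H F G t g"
  have "f x = g x" if x: "x \<in> Ob C" for x
  proof -
    have "Fob H x \<in> Ob D" using H x by (auto simp: functor_cat_def is_functor_def)
    moreover have "f x \<in> Mor D (Fob H x) (Fob F x)" "g x \<in> Mor D (Fob H x) (Fob F x)"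
      using fg x by (auto simp: functor_cat_def PiE_iff)
    moreover have "Comp D (Fob H x) (Fob F x) (Fob G x) (t x) (f x)
        = Comp D (Fob H x) (Fob F x) (Fob G x) (t x) (g x)"
      using fun_cong[OF eq, of x] x by (simp add: functor_cat_def)
    ultimately show ?thesis using mono[OF x] unfolding mono_in_def by blast
  qed
  moreover have "f \<in> extensional (Ob C)" "g \<in> extensional (Ob C)"
    using fg by (auto simp: functor_cat_def PiE_iff)
  ultimately show "f = g" by (metis extensionalityI)
qed

lemma mono_in_Ab:
  assumes "f \<in> ab_hom A B" "inj_on f (carrier A)"
  shows "mono_in Ab A B f"
  unfolding mono_in_def
proof (intro conjI ballI impI)
  fix G :: "'a monoid" and g h
  assume gh: "g \<in> Mor Ab G A" "h \<in> Mor Ab G A" and eq: "Comp Ab G A B f g = Comp Ab G A B f h"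
  have "g x = h x" if "x \<in> carrier G" for x
    using fun_cong[OF eq, of x] gh that inj_onD[OF assms(2)]
    by (auto simp: Ab_def ab_hom_def compose_def hom_def)
  moreover have "g \<in> extensional (carrier G)" "h \<in> extensional (carrier G)"
    using gh by (auto simp: Ab_def ab_hom_def)
  ultimately show "g = h" by (metis extensionalityI)
qed (use assms in \<open>simp add: Ab_def\<close>)

section \<open>Directed unions as filtered colimits\<close>

definition thin_cat :: "'a set \<Rightarrow> ('a \<Rightarrow> 'a \<Rightarrow> bool) \<Rightarrow> ('a, 'a) cat" where
  "thin_cat P lq = \<lparr>Ob = P, Mor = (\<lambda>i j. if lq i j then {undefined} else {}),
     Ident = (\<lambda>_. undefined), Comp = (\<lambda>_ _ _ _ _. undefined)\<rparr>"

text \<open>Objects and arrows share one type because \<open>finitely_generated\<close> asks for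
  index categories of that shape. Every nonempty Hom-set has the single arrow
  \<open>undefined\<close>, so parallel arrows agree and directedness is the only real
  condition.\<close>

lemma filtered_thin_cat:
  assumes "P \<noteq> {}" "\<And>i. i \<in> P \<Longrightarrow> lq i i"
    and "\<And>i j k. i \<in> P \<Longrightarrow> j \<in> P \<Longrightarrow> k \<in> P \<Longrightarrow> lq i j \<Longrightarrow> lq j k \<Longrightarrow> lq i k"
    and "\<And>i j. i \<in> P \<Longrightarrow> j \<in> P \<Longrightarrow> \<exists>k\<in>P. lq i k \<and> lq j k"
  shows "filtered (thin_cat P lq)"
proof -
  have "category (thin_cat P lq)"
  proof
    fix x y z f g
    assume "x \<in> Ob (thin_cat P lq)" "y \<in> Ob (thin_cat P lq)" "z \<in> Ob (thin_cat P lq)"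
      "f \<in> Mor (thin_cat P lq) x y" "g \<in> Mor (thin_cat P lq) y z"
    then show "Comp (thin_cat P lq) x y z g f \<in> Mor (thin_cat P lq) x z"
      using assms(3)[of x y z] by (simp add: thin_cat_def split: if_splits)
  qed (simp_all add: thin_cat_def assms(2) split: if_splits)
  moreover have "\<exists>k\<in>Ob (thin_cat P lq). Mor (thin_cat P lq) i k \<noteq> {} \<and> Mor (thin_cat P lq) j k \<noteq> {}"
    if "i \<in> P" "j \<in> P" for i j
    using assms(4)[OF that] by (auto simp: thin_cat_def)
  moreover have "\<exists>k\<in>P. lq j k" if "j \<in> P" for j
    using assms(2)[OF that] that by blast
  ultimately show ?thesis
    using assms(1) by (simp add: filtered_def) (auto simp: thin_cat_def)
qed

text \<open>Two subgroups containing \<open>x\<close> lie in a third one of the family, so the value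
  of a cocone at \<open>x\<close> does not depend on the subgroup through which it is computed. The
  same device brings two factors into one subgroup, which makes the map a homomorphism.\<close>

lemma is_colimit_Ab_union:
  assumes G: "comm_group G" and H: "\<And>j. j \<in> P \<Longrightarrow> subgroup (H j) G"
    and lq: "\<And>i j. i \<in> P \<Longrightarrow> j \<in> P \<Longrightarrow> lq i j \<Longrightarrow> H i \<subseteq> H j"
    and dir: "\<And>i j. i \<in> P \<Longrightarrow> j \<in> P \<Longrightarrow> \<exists>k\<in>P. lq i k \<and> lq j k"
    and un: "carrier G \<subseteq> (\<Union>j\<in>P. H j)"
  shows "is_colimit (thin_cat P lq) Ab
    \<lparr>Fob = (\<lambda>j. G\<lparr>carrier := H j\<rparr>), Fmor = (\<lambda>i j a. \<lambda>x\<in>H i. x)\<rparr> G (\<lambda>j. \<lambda>x\<in>H j. x)"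
    (is "is_colimit ?J Ab ?D G ?l")
  unfolding is_colimit_def
proof (intro conjI allI impI)
  interpret G: comm_group G by fact
  have Hsub: "H j \<subseteq> carrier G" if "j \<in> P" for j
    using H[OF that] by (rule subgroup.subset)
  show "cocone ?J Ab ?D G ?l"
    using lq Hsub G subgroup.m_closed[OF H]
    by (auto simp: cocone_def Ab_def ab_hom_def hom_def thin_cat_def compose_def fun_eq_iff
        subset_iff split: if_splits)
  fix M m assume m: "cocone ?J Ab ?D M m"
  then have M: "comm_group M" by (simp add: cocone_def Ab_def)
  have mj: "m j \<in> hom (G\<lparr>carrier := H j\<rparr>) M" "m j \<in> extensional (H j)" if "j \<in> P" for j
    using m that by (auto simp: cocone_def Ab_def ab_hom_def thin_cat_def)
  have mle: "m j x = m i x" if "i \<in> P" "j \<in> P" "lq i j" "x \<in> H i" for i j x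
  proof -
    have "Comp Ab (G\<lparr>carrier := H i\<rparr>) (G\<lparr>carrier := H j\<rparr>) M (m j) (\<lambda>x\<in>H i. x) = m i"
      using m that by (auto simp: cocone_def thin_cat_def)
    from fun_cong[OF this, of x] show ?thesis using that by (simp add: Ab_def compose_def)
  qed
  define h where "h = (\<lambda>x\<in>carrier G. m (SOME j. j \<in> P \<and> x \<in> H j) x)"
  have h: "h x = m j x" if jx: "j \<in> P" "x \<in> H j" for j x
  proof -
    define i where "i = (SOME j. j \<in> P \<and> x \<in> H j)"
    have i: "i \<in> P" "x \<in> H i"
      using someI[of "\<lambda>j. j \<in> P \<and> x \<in> H j", OF conjI[OF that]] by (auto simp: i_def)
    obtain k where "k \<in> P" "lq i k" "lq j k" using dir[OF i(1) jx(1)] by blast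
    then have "m i x = m j x" using mle[of i k x] mle[of j k x] i that by simp
    then show ?thesis using Hsub that by (auto simp: h_def i_def)
  qed
  have hom: "h \<in> hom G M"
  proof (rule homI)
    fix x assume "x \<in> carrier G"
    then obtain j where "j \<in> P" "x \<in> H j" using un by blast
    then show "h x \<in> carrier M" using h mj(1)[of j] by (auto simp: hom_def)
  next
    fix x y assume "x \<in> carrier G" "y \<in> carrier G"
    then obtain i j where ij: "i \<in> P" "x \<in> H i" "j \<in> P" "y \<in> H j" using un by blast
    obtain k where "k \<in> P" "lq i k" "lq j k" using dir[OF ij(1,3)] by blast
    then have k: "k \<in> P" "x \<in> H k" "y \<in> H k"
      using lq[OF ij(1), of k] lq[OF ij(3), of k] ij by auto
    then have "x \<otimes>\<^bsub>G\<^esub> y \<in> H k" using H[OF k(1)] by (simp add: subgroup.m_closed)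
    then show "h (x \<otimes>\<^bsub>G\<^esub> y) = h x \<otimes>\<^bsub>M\<^esub> h y"
      using h k mj(1)[of k] by (auto simp: hom_def)
  qed
  have "mediates ?J Ab ?D G ?l M m h"
    unfolding mediates_def
  proof (intro conjI ballI)
    show "h \<in> Mor Ab G M" using hom by (simp add: Ab_def ab_hom_def h_def)
    fix j assume "j \<in> Ob ?J"
    then have "j \<in> P" by (simp add: thin_cat_def)
    then show "Comp Ab (Fob ?D j) G M h (?l j) = m j"
      using h mj(2)[of j] by (auto simp: Ab_def compose_def fun_eq_iff extensional_def)
  qed
  moreover have "h' = h" if "mediates ?J Ab ?D G ?l M m h'" for h'
  proof
    fix x
    have h': "h' \<in> extensional (carrier G)"
      "\<And>j. j \<in> P \<Longrightarrow> Comp Ab (G\<lparr>carrier := H j\<rparr>) G M h' (\<lambda>x\<in>H j. x) = m j"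
      using that by (auto simp: mediates_def Ab_def ab_hom_def thin_cat_def)
    show "h' x = h x"
    proof (cases "x \<in> carrier G")
      case True
      then obtain j where j: "j \<in> P" "x \<in> H j" using un by blast
      with fun_cong[OF h'(2)[OF j(1)], of x] show ?thesis by (simp add: Ab_def compose_def h)
    qed (use h' in \<open>auto simp: h_def extensional_def\<close>)
  qed
  ultimately show "\<exists>!h. mediates ?J Ab ?D G ?l M m h" by blast
qed

lemma is_functor_full: "is_functor J (C\<lparr>Ob := A\<rparr>) F \<Longrightarrow> A \<subseteq> Ob C \<Longrightarrow> is_functor J C F"
  by (auto simp: is_functor_def)

lemma cocone_full: "cocone J (C\<lparr>Ob := A\<rparr>) F L l \<Longrightarrow> A \<subseteq> Ob C \<Longrightarrow> cocone J C F L l"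
  by (auto simp: cocone_def)

lemma is_functor_thin_cat:
  assumes "\<And>i. i \<in> P \<Longrightarrow> Fob F i \<in> Ob C"
    and "\<And>i. i \<in> P \<Longrightarrow> Fmor F i i undefined = Ident C (Fob F i)"
    and "\<And>i j. i \<in> P \<Longrightarrow> j \<in> P \<Longrightarrow> lq i j \<Longrightarrow> Fmor F i j undefined \<in> Mor C (Fob F i) (Fob F j)"
    and "\<And>i j k. i \<in> P \<Longrightarrow> j \<in> P \<Longrightarrow> k \<in> P \<Longrightarrow> lq i j \<Longrightarrow> lq j k \<Longrightarrow>
      Comp C (Fob F i) (Fob F j) (Fob F k) (Fmor F j k undefined) (Fmor F i j undefined)
          = Fmor F i k undefined"
  shows "is_functor (thin_cat P lq) C F"
  unfolding is_functor_def
proof (intro conjI ballI)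
  fix i j k a b
  assume "i \<in> Ob (thin_cat P lq)" "j \<in> Ob (thin_cat P lq)" "k \<in> Ob (thin_cat P lq)"
    "a \<in> Mor (thin_cat P lq) i j" "b \<in> Mor (thin_cat P lq) j k"
  then show "Fmor F i k (Comp (thin_cat P lq) i j k b a) =
      Comp C (Fob F i) (Fob F j) (Fob F k) (Fmor F j k b) (Fmor F i j a)"
    using assms(4)[of i j k] by (simp add: thin_cat_def split: if_splits)
qed (simp_all add: thin_cat_def assms(1,2,3) split: if_splits)

lemma cocone_thin_cat:
  assumes "L \<in> Ob C" "\<And>i. i \<in> P \<Longrightarrow> l i \<in> Mor C (Fob F i) L"
    and "\<And>i j. i \<in> P \<Longrightarrow> j \<in> P \<Longrightarrow> lq i j \<Longrightarrow> Comp C (Fob F i) (Fob F j) L (l j) (Fmor F i j undefined)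
        = l i"
  shows "cocone (thin_cat P lq) C F L l"
  using assms by (simp add: cocone_def thin_cat_def)

lemma is_functor_fcomp:
  assumes F: "is_functor J C F" and G: "is_functor C D G"
  shows "is_functor J D (fcomp G F)"
  unfolding is_functor_def
proof (intro conjI ballI)
  note F = F[unfolded is_functor_def] and G = G[unfolded is_functor_def]
  fix x assume x: "x \<in> Ob J"
  show "Fob (fcomp G F) x \<in> Ob D" using x F G by (simp add: fcomp_def)
  show "Fmor (fcomp G F) x x (Ident J x) = Ident D (Fob (fcomp G F) x)" using x F G
      by (simp add: fcomp_def)
  fix y f assume y: "y \<in> Ob J" "f \<in> Mor J x y"
  show "Fmor (fcomp G F) x y f \<in> Mor D (Fob (fcomp G F) x) (Fob (fcomp G F) y)"
    using x y F G by (simp add: fcomp_def)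
next
  note F = F[unfolded is_functor_def] and G = G[unfolded is_functor_def]
  fix x y z f g assume "x \<in> Ob J" "y \<in> Ob J" "z \<in> Ob J" "f \<in> Mor J x y" "g \<in> Mor J y z"
  then show "Fmor (fcomp G F) x z (Comp J x y z g f) =
      Comp D (Fob (fcomp G F) x) (Fob (fcomp G F) y) (Fob (fcomp G F) z) (Fmor (fcomp G F) y z g)
          (Fmor (fcomp G F) x y f)"
    using F G by (simp add: fcomp_def)
qed

section \<open>Modules and submodules\<close>

lemma (in comm_group) comm_group_subgroup: "subgroup H G \<Longrightarrow> comm_group (G\<lparr>carrier := H\<rparr>)"
  by (rule group.group_comm_groupI[OF subgroup_imp_group]) (auto intro: m_comm subgroup.mem_carrier)

lemma hom_group_hom: "comm_group G \<Longrightarrow> comm_group H \<Longrightarrow> f \<in> hom G H \<Longrightarrow> group_hom G H f"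
  by (simp add: group_hom_def group_hom_axioms_def comm_group_def)

lemma hom_finprod:
  assumes G: "comm_group G" and H: "comm_group H" and f: "f \<in> hom G H" and g: "g \<in> A \<rightarrow> carrier G"
  shows "f (finprod G g A) = finprod H (\<lambda>x. f (g x)) A"
proof -
  interpret G: comm_group G by fact
  interpret H: comm_group H by fact
  interpret f: group_hom G H f using hom_group_hom[OF G H f] .
  show ?thesis
    using g by (induction A rule: infinite_finite_induct) (auto simp: Pi_iff)
qed

text \<open>Right modules over \<open>R\<close> are covariant additive functors on
  \<open>opposite R\<close>. Letting \<open>Q\<close> be that opposite keeps one order of
  composition in all computations.\<close>

definition Mods :: "('u, 'u) preadd_cat \<Rightarrow> ('u rmod, 'u rmod_hom) cat" where
  "Mods Q = (functor_cat Q Ab)\<lparr>Ob := {M. additive_functor Q Ab M}\<rparr>"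

lemma Mod_cat_eq_Mods: "Mod_cat R = Mods (opposite R)"
  by (simp add: Mod_cat_def Mods_def)

lemma Ob_Mods: "Ob (Mods Q) = {M. additive_functor Q Ab M}"
  by (simp add: Mods_def)

lemma Ob_Mods_subset: "{M. additive_functor Q Ab M} \<subseteq> Ob (functor_cat Q Ab)"
  by (auto simp: functor_cat_def additive_functor_def)

lemma category_Mods: "preadditive Q \<Longrightarrow> category (Mods Q)"
  unfolding Mods_def
  using category_full[OF category_functor_cat[OF preadditive.axioms(1) category_Ab] Ob_Mods_subset]
      .

lemma additive_functorD:
  assumes "preadditive Q" "additive_functor Q Ab M"
  shows "x \<in> Ob Q \<Longrightarrow> comm_group (Fob M x)"
    and "\<lbrakk>x \<in> Ob Q; y \<in> Ob Q; a \<in> Mor Q x y\<rbrakk> \<Longrightarrow> Fmor M x y a \<in> hom (Fob M x) (Fob M y)"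
    and "\<lbrakk>x \<in> Ob Q; y \<in> Ob Q; a \<in> Mor Q x y\<rbrakk> \<Longrightarrow> Fmor M x y a \<in> extensional (carrier (Fob M x))"
    and "\<lbrakk>x \<in> Ob Q; m \<in> carrier (Fob M x)\<rbrakk> \<Longrightarrow> Fmor M x x (Ident Q x) m = m"
    and "\<lbrakk>x \<in> Ob Q; y \<in> Ob Q; z \<in> Ob Q; a \<in> Mor Q x y; b \<in> Mor Q y z; m \<in> carrier (Fob M x)\<rbrakk>
      \<Longrightarrow> Fmor M x z (Comp Q x y z b a) m = Fmor M y z b (Fmor M x y a m)"
    and "\<lbrakk>x \<in> Ob Q; y \<in> Ob Q; a \<in> Mor Q x y; b \<in> Mor Q x y; m \<in> carrier (Fob M x)\<rbrakk>
      \<Longrightarrow> Fmor M x y (a \<otimes>\<^bsub>HomGrp Q x y\<^esub> b) m = Fmor M x y a m \<otimes>\<^bsub>Fob M y\<^esub> Fmor M x y b m"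
proof -
  interpret preadditive Q by fact
  have F: "is_functor Q Ab M"
    and add: "\<And>x y. x \<in> Ob Q \<Longrightarrow> y \<in> Ob Q \<Longrightarrow>
      Fmor M x y \<in> hom (HomGrp Q x y) (HomGrp Ab (Fob M x) (Fob M y))"
    using assms(2) by (auto simp: additive_functor_def)
  show "comm_group (Fob M x)" if "x \<in> Ob Q"
    using F that by (auto simp: is_functor_def Ab_def)
  show "Fmor M x y a \<in> hom (Fob M x) (Fob M y)" "Fmor M x y a \<in> extensional (carrier (Fob M x))"
    if "x \<in> Ob Q" "y \<in> Ob Q" "a \<in> Mor Q x y"
    using F that by (auto simp: is_functor_def Ab_def ab_hom_def)
  show "Fmor M x x (Ident Q x) m = m" if "x \<in> Ob Q" "m \<in> carrier (Fob M x)"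
    using F that by (auto simp: is_functor_def Ab_def)
  show "Fmor M x z (Comp Q x y z b a) m = Fmor M y z b (Fmor M x y a m)"
    if "x \<in> Ob Q" "y \<in> Ob Q" "z \<in> Ob Q" "a \<in> Mor Q x y" "b \<in> Mor Q y z" "m \<in> carrier (Fob M x)"
    using F that by (auto simp: is_functor_def Ab_def compose_def)
  show "Fmor M x y (a \<otimes>\<^bsub>HomGrp Q x y\<^esub> b) m = Fmor M x y a m \<otimes>\<^bsub>Fob M y\<^esub> Fmor M x y b m"
    if "x \<in> Ob Q" "y \<in> Ob Q" "a \<in> Mor Q x y" "b \<in> Mor Q x y" "m \<in> carrier (Fob M x)"
    using hom_mult[OF add, of x y a b] that by (simp add: carrier_HomGrp) (simp add: Ab_def)
qed

lemma additive_functorI: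
  assumes "preadditive Q"
    and "\<And>x. x \<in> Ob Q \<Longrightarrow> comm_group (Fob M x)"
    and "\<And>x y a. \<lbrakk>x \<in> Ob Q; y \<in> Ob Q; a \<in> Mor Q x y\<rbrakk> \<Longrightarrow> Fmor M x y a \<in> hom (Fob M x) (Fob M y)"
    and "\<And>x y a. \<lbrakk>x \<in> Ob Q; y \<in> Ob Q; a \<in> Mor Q x y\<rbrakk>
        \<Longrightarrow> Fmor M x y a \<in> extensional (carrier (Fob M x))"
    and "\<And>x m. \<lbrakk>x \<in> Ob Q; m \<in> carrier (Fob M x)\<rbrakk> \<Longrightarrow> Fmor M x x (Ident Q x) m = m"
    and "\<And>x y z a b m. \<lbrakk>x \<in> Ob Q; y \<in> Ob Q; z \<in> Ob Q; a \<in> Mor Q x y; b \<in> Mor Q y z; m \<in> carrier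
        (Fob M x)\<rbrakk>
      \<Longrightarrow> Fmor M x z (Comp Q x y z b a) m = Fmor M y z b (Fmor M x y a m)"
    and "\<And>x y a b m. \<lbrakk>x \<in> Ob Q; y \<in> Ob Q; a \<in> Mor Q x y; b \<in> Mor Q x y; m \<in> carrier (Fob M x)\<rbrakk>
      \<Longrightarrow> Fmor M x y (a \<otimes>\<^bsub>HomGrp Q x y\<^esub> b) m = Fmor M x y a m \<otimes>\<^bsub>Fob M y\<^esub> Fmor M x y b m"
  shows "additive_functor Q Ab M"
  unfolding additive_functor_def is_functor_def
proof (intro conjI ballI)
  interpret preadditive Q by fact
  fix x assume x: "x \<in> Ob Q"
  then show "Fob M x \<in> Ob Ab" using assms by (simp add: Ab_def)
  show "Fmor M x x (Ident Q x) = Ident Ab (Fob M x)"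
    using assms(4)[OF x x Ident_in[OF x]] assms(5)[OF x]
    by (auto simp: Ab_def fun_eq_iff extensional_def)
  fix y assume y: "y \<in> Ob Q"
  show ab: "Fmor M x y a \<in> Mor Ab (Fob M x) (Fob M y)" if "a \<in> Mor Q x y" for a
    using assms(3,4) x y that by (simp add: Ab_def ab_hom_def)
  show "Fmor M x y \<in> hom (HomGrp Q x y) (HomGrp Ab (Fob M x) (Fob M y))"
  proof (rule homI)
    fix a assume "a \<in> carrier (HomGrp Q x y)"
    then show "Fmor M x y a \<in> carrier (HomGrp Ab (Fob M x) (Fob M y))"
      using ab x y by (simp add: carrier_HomGrp) (simp add: Ab_def)
  next
    fix a b assume ab: "a \<in> carrier (HomGrp Q x y)" "b \<in> carrier (HomGrp Q x y)"
    interpret G: comm_group "HomGrp Q x y" using HomGrp x y .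
    have "a \<otimes>\<^bsub>HomGrp Q x y\<^esub> b \<in> Mor Q x y"
      using G.m_closed[OF ab] x y by (simp add: carrier_HomGrp)
    then show "Fmor M x y (a \<otimes>\<^bsub>HomGrp Q x y\<^esub> b) =
        Fmor M x y a \<otimes>\<^bsub>HomGrp Ab (Fob M x) (Fob M y)\<^esub> Fmor M x y b"
      using assms(4)[OF x y] assms(7)[OF x y] ab x y
      by (auto simp: Ab_def carrier_HomGrp fun_eq_iff extensional_def)
  qed
  fix z a b assume z: "z \<in> Ob Q" and a: "a \<in> Mor Q x y" and b: "b \<in> Mor Q y z"
  show "Fmor M x z (Comp Q x y z b a) = Comp Ab (Fob M x) (Fob M y) (Fob M z) (Fmor M y z b)
      (Fmor M x y a)"
    using assms(4)[OF x z Comp_in[OF x y z a b]] assms(6)[OF x y z a b]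
    by (auto simp: Ab_def compose_def fun_eq_iff extensional_def)
qed

lemma Mods_MorI:
  assumes "preadditive Q" "additive_functor Q Ab M" "additive_functor Q Ab N"
    and "t \<in> extensional (Ob Q)"
    and "\<And>x. x \<in> Ob Q \<Longrightarrow> t x \<in> hom (Fob M x) (Fob N x)"
    and "\<And>x. x \<in> Ob Q \<Longrightarrow> t x \<in> extensional (carrier (Fob M x))"
    and nat: "\<And>x y a m. \<lbrakk>x \<in> Ob Q; y \<in> Ob Q; a \<in> Mor Q x y; m \<in> carrier (Fob M x)\<rbrakk>
      \<Longrightarrow> t y (Fmor M x y a m) = Fmor N x y a (t x m)"
  shows "t \<in> Mor (Mods Q) M N"
proof -
  have "compose (carrier (Fob M x)) (t y) (Fmor M x y a) =
      compose (carrier (Fob M x)) (Fmor N x y a) (t x)"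
    if "x \<in> Ob Q" "y \<in> Ob Q" "a \<in> Mor Q x y" for x y a
    using that nat by (auto simp: compose_def fun_eq_iff)
  then show ?thesis
    using assms(4-6) by (simp add: Mods_def functor_cat_def PiE_iff Ab_def ab_hom_def)
qed

lemma Mods_MorD:
  assumes "t \<in> Mor (Mods Q) M N"
  shows "t \<in> extensional (Ob Q)"
    and "x \<in> Ob Q \<Longrightarrow> t x \<in> hom (Fob M x) (Fob N x)"
    and "x \<in> Ob Q \<Longrightarrow> t x \<in> extensional (carrier (Fob M x))"
    and "\<lbrakk>x \<in> Ob Q; y \<in> Ob Q; a \<in> Mor Q x y; m \<in> carrier (Fob M x)\<rbrakk>
      \<Longrightarrow> t y (Fmor M x y a m) = Fmor N x y a (t x m)"
proof -
  show "t y (Fmor M x y a m) = Fmor N x y a (t x m)"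
    if "x \<in> Ob Q" "y \<in> Ob Q" "a \<in> Mor Q x y" "m \<in> carrier (Fob M x)"
  proof -
    have "compose (carrier (Fob M x)) (t y) (Fmor M x y a) =
      compose (carrier (Fob M x)) (Fmor N x y a) (t x)"
      using assms that by (simp add: Mods_def functor_cat_def Ab_def)
    from fun_cong[OF this, of m] show ?thesis using that by (simp add: compose_def)
  qed
qed (use assms in \<open>auto simp: Mods_def functor_cat_def PiE_iff Ab_def ab_hom_def\<close>)

lemma Mods_Comp: "Comp (Mods Q) F G H t s = (\<lambda>x\<in>Ob Q. compose (carrier (Fob F x)) (t x) (s x))"
  by (simp add: Mods_def functor_cat_def Ab_def)

lemma Mods_Ident: "Ident (Mods Q) F = (\<lambda>x\<in>Ob Q. \<lambda>m\<in>carrier (Fob F x). m)"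
  by (simp add: Mods_def functor_cat_def Ab_def)

section \<open>Submodules as families of subsets\<close>

definition submod :: "('u, 'u) preadd_cat \<Rightarrow> 'u rmod \<Rightarrow> ('u \<Rightarrow> 'u set) \<Rightarrow> bool" where
  "submod Q M U \<longleftrightarrow> (\<forall>x\<in>Ob Q. subgroup (U x) (Fob M x)) \<and>
     (\<forall>x\<in>Ob Q. \<forall>y\<in>Ob Q. \<forall>a\<in>Mor Q x y. \<forall>m\<in>U x. Fmor M x y a m \<in> U y)"

text \<open>Values of a family outside \<open>Ob Q\<close> are arbitrary. Stabilisation of chains is
  therefore expressed by this comparison and not by equality of families.\<close>

definition fam_le :: "('u, 'u) preadd_cat \<Rightarrow> ('u \<Rightarrow> 'u set) \<Rightarrow> ('u \<Rightarrow> 'u set) \<Rightarrow> bool" where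
  "fam_le Q U W \<longleftrightarrow> (\<forall>x\<in>Ob Q. U x \<subseteq> W x)"

lemma fam_le_refl: "fam_le Q U U"
  by (simp add: fam_le_def)

lemma fam_le_trans: "fam_le Q U V \<Longrightarrow> fam_le Q V W \<Longrightarrow> fam_le Q U W"
  by (auto simp: fam_le_def)

definition subm :: "'u rmod \<Rightarrow> ('u \<Rightarrow> 'u set) \<Rightarrow> 'u rmod" where
  "subm M U = \<lparr>Fob = (\<lambda>x. (Fob M x)\<lparr>carrier := U x\<rparr>), Fmor
      = (\<lambda>x y a. restrict (Fmor M x y a) (U x))\<rparr>"

definition sub_incl :: "('u, 'u) preadd_cat \<Rightarrow> ('u \<Rightarrow> 'u set) \<Rightarrow> 'u rmod_hom" where
  "sub_incl Q U = (\<lambda>x\<in>Ob Q. \<lambda>m\<in>U x. m)"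

lemma submodD:
  assumes "submod Q M U" "x \<in> Ob Q"
  shows "subgroup (U x) (Fob M x)" "m \<in> U x \<Longrightarrow> m \<in> carrier (Fob M x)"
    and "\<lbrakk>y \<in> Ob Q; a \<in> Mor Q x y; m \<in> U x\<rbrakk> \<Longrightarrow> Fmor M x y a m \<in> U y"
  using assms subgroup.subset by (auto simp: submod_def)

lemma additive_functor_subm:
  assumes Q: "preadditive Q" and M: "additive_functor Q Ab M" and U: "submod Q M U"
  shows "additive_functor Q Ab (subm M U)"
proof -
  interpret preadditive Q by fact
  note D = additive_functorD[OF Q M] and UD = submodD[OF U]
  show ?thesis
  proof (rule additive_functorI[OF Q])
    fix x assume "x \<in> Ob Q"
    then show "comm_group (Fob (subm M U) x)"
      using comm_group.comm_group_subgroup[OF D(1) UD(1)] by (simp add: subm_def)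
  next
    fix x y a assume *: "x \<in> Ob Q" "y \<in> Ob Q" "a \<in> Mor Q x y"
    then show "Fmor (subm M U) x y a \<in> extensional (carrier (Fob (subm M U) x))"
      by (simp add: subm_def)
    show "Fmor (subm M U) x y a \<in> hom (Fob (subm M U) x) (Fob (subm M U) y)"
      using * UD D(2)[OF *] subgroup.m_closed[OF UD(1)] by (auto simp: subm_def hom_def)
  next
    fix x m assume "x \<in> Ob Q" "m \<in> carrier (Fob (subm M U) x)"
    then show "Fmor (subm M U) x x (Ident Q x) m = m"
      using D(4) UD(2) by (simp add: subm_def)
  next
    fix x y z a b m
    assume "x \<in> Ob Q" "y \<in> Ob Q" "z \<in> Ob Q" "a \<in> Mor Q x y" "b \<in> Mor Q y z"
        "m \<in> carrier (Fob (subm M U) x)"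
    then show "Fmor (subm M U) x z (Comp Q x y z b a) m
        = Fmor (subm M U) y z b (Fmor (subm M U) x y a m)"
      using D(5) UD(2,3) by (simp add: subm_def)
  next
    fix x y a b m assume *: "x \<in> Ob Q" "y \<in> Ob Q" "a \<in> Mor Q x y" "b \<in> Mor Q x y"
        "m \<in> carrier (Fob (subm M U) x)"
    then show "Fmor (subm M U) x y (a \<otimes>\<^bsub>HomGrp Q x y\<^esub> b) m =
        Fmor (subm M U) x y a m \<otimes>\<^bsub>Fob (subm M U) y\<^esub> Fmor (subm M U) x y b m"
      using D(6) UD(2) by (simp add: subm_def)
  qed
qed

lemma sub_incl_Mor:
  assumes Q: "preadditive Q" and M: "additive_functor Q Ab M" and U: "submod Q M U"
  shows "sub_incl Q U \<in> Mor (Mods Q) (subm M U) M"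
    and "submod Q M W \<Longrightarrow> fam_le Q U W \<Longrightarrow> sub_incl Q U \<in> Mor (Mods Q) (subm M U) (subm M W)"
proof -
  note UD = submodD[OF U]
  show "sub_incl Q U \<in> Mor (Mods Q) (subm M U) M"
    by (rule Mods_MorI[OF Q additive_functor_subm[OF Q M U] M])
      (use UD subgroup.m_closed[OF UD(1)] in \<open>auto simp: sub_incl_def subm_def hom_def\<close>)
  assume W: "submod Q M W" and le: "fam_le Q U W"
  show "sub_incl Q U \<in> Mor (Mods Q) (subm M U) (subm M W)"
    by (rule Mods_MorI[OF Q additive_functor_subm[OF Q M U] additive_functor_subm[OF Q M W]])
      (use UD le subgroup.m_closed[OF UD(1)] in \<open>auto simp: sub_incl_def subm_def hom_def
          fam_le_def\<close>)
qed

lemma mono_in_Mods: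
  assumes "t \<in> Mor (Mods Q) M N" "\<And>x. x \<in> Ob Q \<Longrightarrow> inj_on (t x) (carrier (Fob M x))"
  shows "mono_in (Mods Q) M N t"
  unfolding Mods_def
proof (intro mono_in_full Ob_Mods_subset mono_in_functor_cat mono_in_Ab)
  show "t \<in> Mor (functor_cat Q Ab) M N" using assms by (simp add: Mods_def)
qed (use assms Mods_MorD[OF assms(1)] in \<open>auto simp: ab_hom_def\<close>)

definition sub_diagram :: "('u, 'u) preadd_cat \<Rightarrow> 'u rmod \<Rightarrow> ('j \<Rightarrow> 'u \<Rightarrow> 'u set) \<Rightarrow>
    ('j, 'j, 'u rmod, 'u rmod_hom) fctr"
  where "sub_diagram Q M U = \<lparr>Fob = (\<lambda>j. subm M (U j)), Fmor = (\<lambda>i j a. sub_incl Q (U i))\<rparr>"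

lemma
  assumes Q: "preadditive Q" and M: "additive_functor Q Ab M"
    and U: "\<And>j. j \<in> P \<Longrightarrow> submod Q M (U j)"
    and le: "\<And>i j. i \<in> P \<Longrightarrow> j \<in> P \<Longrightarrow> lq i j \<Longrightarrow> fam_le Q (U i) (U j)"
  shows is_functor_sub_diagram: "is_functor (thin_cat P lq) (Mods Q) (sub_diagram Q M U)"
    and cocone_sub_diagram:
      "cocone (thin_cat P lq) (Mods Q) (sub_diagram Q M U) M (\<lambda>j. sub_incl Q (U j))"
proof -
  have comp: "Comp (Mods Q) (subm M (U i)) X Y (sub_incl Q (U j)) (sub_incl Q (U i))
      = sub_incl Q (U i)"
    if "i \<in> P" "j \<in> P" "lq i j" for i j X Y
    using le[OF that] by (auto simp: Mods_Comp sub_incl_def subm_def compose_def fam_le_def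
        fun_eq_iff)
  show "is_functor (thin_cat P lq) (Mods Q) (sub_diagram Q M U)"
    by (rule is_functor_thin_cat)
      (simp_all add: sub_diagram_def Ob_Mods additive_functor_subm[OF Q M U]
        sub_incl_Mor(2)[OF Q M U U le] comp Mods_Ident, simp add: sub_incl_def subm_def)
  show "cocone (thin_cat P lq) (Mods Q) (sub_diagram Q M U) M (\<lambda>j. sub_incl Q (U j))"
    by (rule cocone_thin_cat) (simp_all add: sub_diagram_def Ob_Mods M sub_incl_Mor(1)[OF Q M U]
        comp)
qed

lemma is_colimit_sub_diagram:
  assumes Q: "preadditive Q" and M: "additive_functor Q Ab M"
    and U: "\<And>j. j \<in> P \<Longrightarrow> submod Q M (U j)"
    and le: "\<And>i j. i \<in> P \<Longrightarrow> j \<in> P \<Longrightarrow> lq i j \<Longrightarrow> fam_le Q (U i) (U j)"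
    and dir: "\<And>i j. i \<in> P \<Longrightarrow> j \<in> P \<Longrightarrow> \<exists>k\<in>P. lq i k \<and> lq j k"
    and un: "\<And>x. x \<in> Ob Q \<Longrightarrow> carrier (Fob M x) \<subseteq> (\<Union>j\<in>P. U j x)"
  shows "is_colimit (thin_cat P lq) (Mods Q) (sub_diagram Q M U) M (\<lambda>j. sub_incl Q (U j))"
  unfolding Mods_def
proof (rule is_colimit_full)
  show "M \<in> {M. additive_functor Q Ab M}" using M by simp
  show "{M. additive_functor Q Ab M} \<subseteq> Ob (functor_cat Q Ab)" by (rule Ob_Mods_subset)
  note F = is_functor_sub_diagram[OF Q M U le] and c = cocone_sub_diagram[OF Q M U le]
  show "is_colimit (thin_cat P lq) (functor_cat Q Ab) (sub_diagram Q M U) M (\<lambda>j. sub_incl Q (U j))"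
  proof (rule is_colimit_functor_cat[OF preadditive.axioms(1)[OF Q] category_Ab])
    show "is_functor (thin_cat P lq) (functor_cat Q Ab) (sub_diagram Q M U)"
      using F unfolding Mods_def by (rule is_functor_full[OF _ Ob_Mods_subset])
    show "cocone (thin_cat P lq) (functor_cat Q Ab) (sub_diagram Q M U) M (\<lambda>j. sub_incl Q (U j))"
      using c unfolding Mods_def by (rule cocone_full[OF _ Ob_Mods_subset])
    fix x assume x: "x \<in> Ob Q"
    then have "is_colimit (thin_cat P lq) Ab
       \<lparr>Fob = (\<lambda>j. (Fob M x)\<lparr>carrier := U j x\<rparr>), Fmor
           = (\<lambda>i j a. \<lambda>m\<in>U i x. m)\<rparr> (Fob M x) (\<lambda>j. \<lambda>m\<in>U j x. m)"
      by (intro is_colimit_Ab_union additive_functorD(1)[OF Q M] submodD(1)[OF U] dir un)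
        (use le in \<open>auto simp: fam_le_def\<close>)
    then show "is_colimit (thin_cat P lq) Ab
       \<lparr>Fob = (\<lambda>j. Fob (Fob (sub_diagram Q M U) j) x),
        Fmor = (\<lambda>i j a. Fmor (sub_diagram Q M U) i j a x)\<rparr> (Fob M x) (\<lambda>j. sub_incl Q (U j) x)"
      using x by (simp add: sub_diagram_def subm_def sub_incl_def)
  qed
qed

text \<open>A directed cover by submodules presents \<open>M\<close> as a filtered colimit of
  monomorphisms. Finite generation provides a section of one inclusion, and an inclusion with a
  section is onto. The indices lie in \<open>'u\<close> because the objects of admissible index
  categories do.\<close>

lemma finitely_generated_Mods_directed:
  fixes Q :: "('u, 'u) preadd_cat" and U :: "'u \<Rightarrow> 'u \<Rightarrow> 'u set"
  assumes Q: "preadditive Q" and M: "finitely_generated TYPE('u) (Mods Q) M" and ab: "(a :: 'u) \<noteq> b"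
    and P: "P \<noteq> {}" and U: "\<And>j. j \<in> P \<Longrightarrow> submod Q M (U j)"
    and dir: "\<And>i j. i \<in> P \<Longrightarrow> j \<in> P \<Longrightarrow> \<exists>k\<in>P. fam_le Q (U i) (U k) \<and> fam_le Q (U j) (U k)"
    and un: "\<And>x. x \<in> Ob Q \<Longrightarrow> carrier (Fob M x) \<subseteq> (\<Union>j\<in>P. U j x)"
  shows "\<exists>j\<in>P. \<forall>x\<in>Ob Q. carrier (Fob M x) \<subseteq> U j x"
proof -
  let ?lq = "\<lambda>i j. fam_le Q (U i) (U j)"
  have MM: "additive_functor Q Ab M" using M by (simp add: finitely_generated_def Ob_Mods)
  have fil: "filtered (thin_cat P ?lq)"
    by (rule filtered_thin_cat[OF P fam_le_refl fam_le_trans dir])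
  have inj: "mono_in (Mods Q) (Fob (sub_diagram Q M U) i) (Fob (sub_diagram Q M U) j)
      (Fmor (sub_diagram Q M U) i j a)"
    if "i \<in> Ob (thin_cat P ?lq)" "j \<in> Ob (thin_cat P ?lq)" "a \<in> Mor (thin_cat P ?lq) i j" for i j a
    using that sub_incl_Mor(2)[OF Q MM U U, of i j]
    by (auto simp: sub_diagram_def thin_cat_def inj_on_def subm_def sub_incl_def split: if_splits
        intro!: mono_in_Mods)
  have "(\<lambda>_ _. a) \<noteq> (\<lambda>(_ :: 'u) (_ :: 'u). b)" using ab by (metis)
  moreover have "is_functor (thin_cat P ?lq) (Mods Q) (sub_diagram Q M U)"
    by (rule is_functor_sub_diagram[OF Q MM U])
  moreover have "is_colimit (thin_cat P ?lq) (Mods Q) (sub_diagram Q M U) M (\<lambda>j. sub_incl Q (U j))"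
    by (rule is_colimit_sub_diagram[OF Q MM U _ dir un])
  ultimately have "\<exists>j\<in>Ob (thin_cat P ?lq). \<exists>s\<in>Mor (Mods Q) M (Fob (sub_diagram Q M U) j).
      Comp (Mods Q) M (Fob (sub_diagram Q M U) j) M (sub_incl Q (U j)) s = Ident (Mods Q) M"
    using finitely_generated_split[OF category_Mods[OF Q] M fil _ inj] by blast
  then obtain j s where j: "j \<in> P" and s: "s \<in> Mor (Mods Q) M (subm M (U j))"
    "Comp (Mods Q) M (subm M (U j)) M (sub_incl Q (U j)) s = Ident (Mods Q) M"
    by (auto simp: thin_cat_def sub_diagram_def)
  have "carrier (Fob M x) \<subseteq> U j x" if x: "x \<in> Ob Q" for x
  proof
    fix m assume m: "m \<in> carrier (Fob M x)"
    have "s x m \<in> U j x"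
      using Mods_MorD(2)[OF s(1) x] m by (auto simp: hom_def subm_def)
    moreover have "s x m = m"
      using fun_cong[OF fun_cong[OF s(2), of x], of m] x m \<open>s x m \<in> U j x\<close>
      by (simp add: Mods_Comp Mods_Ident compose_def sub_incl_def)
    ultimately show "m \<in> U j x" by simp
  qed
  with j show ?thesis by blast
qed

section \<open>Functors with values in modules and their subfunctors\<close>

lemma functor_Mods_D:
  assumes V: "V \<in> Ob (functor_cat C (Mods Q))"
  shows "S \<in> Ob C \<Longrightarrow> additive_functor Q Ab (Fob V S)"
    and "\<lbrakk>S \<in> Ob C; T \<in> Ob C; f \<in> Mor C S T\<rbrakk> \<Longrightarrow> Fmor V S T f \<in> Mor (Mods Q) (Fob V S) (Fob V T)"
    and "\<lbrakk>S \<in> Ob C; r \<in> Ob Q; m \<in> carrier (Fob (Fob V S) r)\<rbrakk> \<Longrightarrow> Fmor V S S (Ident C S) r m = m"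
    and "\<lbrakk>S \<in> Ob C; T \<in> Ob C; W \<in> Ob C; f \<in> Mor C S T; g \<in> Mor C T W; r \<in> Ob Q; m \<in> carrier
        (Fob (Fob V S) r)\<rbrakk>
      \<Longrightarrow> Fmor V S W (Comp C S T W g f) r m = Fmor V T W g r (Fmor V S T f r m)"
proof -
  have F: "is_functor C (Mods Q) V" using V by (simp add: functor_cat_def)
  show "S \<in> Ob C \<Longrightarrow> additive_functor Q Ab (Fob V S)"
    "\<lbrakk>S \<in> Ob C; T \<in> Ob C; f \<in> Mor C S T\<rbrakk> \<Longrightarrow> Fmor V S T f \<in> Mor (Mods Q) (Fob V S) (Fob V T)"
    using F by (auto simp: is_functor_def Ob_Mods)
  show "Fmor V S S (Ident C S) r m = m" if "S \<in> Ob C" "r \<in> Ob Q" "m \<in> carrier (Fob (Fob V S) r)"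
    using F that by (simp add: is_functor_def Mods_Ident)
  show "Fmor V S W (Comp C S T W g f) r m = Fmor V T W g r (Fmor V S T f r m)"
    if "S \<in> Ob C" "T \<in> Ob C" "W \<in> Ob C" "f \<in> Mor C S T" "g \<in> Mor C T W" "r \<in> Ob Q"
        "m \<in> carrier (Fob (Fob V S) r)"
    using F that by (simp add: is_functor_def Mods_Comp compose_def)
qed

definition subfunctor ::
  "('o, 'a, 'z) cat_scheme \<Rightarrow> ('u, 'u) preadd_cat \<Rightarrow> ('o, 'a, 'u rmod, 'u rmod_hom) fctr \<Rightarrow>
      ('o \<Rightarrow> 'u \<Rightarrow> 'u set) \<Rightarrow> bool" where
  "subfunctor C Q V U \<longleftrightarrow> (\<forall>S\<in>Ob C. submod Q (Fob V S) (U S)) \<and>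
     (\<forall>S\<in>Ob C. \<forall>T\<in>Ob C. \<forall>f\<in>Mor C S T. \<forall>r\<in>Ob Q. \<forall>m\<in>U S r. Fmor V S T f r m \<in> U T r)"

definition subf :: "('u, 'u) preadd_cat \<Rightarrow> ('o, 'a, 'u rmod, 'u rmod_hom) fctr \<Rightarrow> ('o \<Rightarrow> 'u \<Rightarrow> 'u set) \<Rightarrow>
    ('o, 'a, 'u rmod, 'u rmod_hom) fctr" where
  "subf Q V U = \<lparr>Fob = (\<lambda>S. subm (Fob V S) (U S)),
     Fmor = (\<lambda>S T f. \<lambda>r\<in>Ob Q. restrict (Fmor V S T f r) (U S r))\<rparr>"

definition subf_incl :: "('o, 'a, 'z) cat_scheme \<Rightarrow> ('u, 'u) preadd_cat \<Rightarrow> ('o \<Rightarrow> 'u \<Rightarrow> 'u set) \<Rightarrow> 'o \<Rightarrow>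
    'u rmod_hom" where
  "subf_incl C Q U = (\<lambda>S\<in>Ob C. sub_incl Q (U S))"

lemma subfunctorD:
  assumes "subfunctor C Q V U" "S \<in> Ob C"
  shows "submod Q (Fob V S) (U S)"
    and "\<lbrakk>T \<in> Ob C; f \<in> Mor C S T; r \<in> Ob Q; m \<in> U S r\<rbrakk> \<Longrightarrow> Fmor V S T f r m \<in> U T r"
  using assms by (auto simp: subfunctor_def)

lemma subf_Fmor_in:
  assumes Q: "preadditive Q" and V: "V \<in> Ob (functor_cat C (Mods Q))" and U: "subfunctor C Q V U"
    and ST: "S \<in> Ob C" "T \<in> Ob C" "f \<in> Mor C S T"
  shows "Fmor (subf Q V U) S T f \<in> Mor (Mods Q) (subm (Fob V S) (U S)) (subm (Fob V T) (U T))"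
proof -
  note D = functor_Mods_D[OF V] and UD = subfunctorD[OF U] and mD
      = Mods_MorD[OF functor_Mods_D(2)[OF V ST]]
  note SD = submodD[OF UD(1)[OF ST(1)]]
  show ?thesis
  proof (rule Mods_MorI[OF Q additive_functor_subm[OF Q D(1) UD(1)]
      additive_functor_subm[OF Q D(1) UD(1)]])
    fix r assume r: "r \<in> Ob Q"
    show "Fmor (subf Q V U) S T f r \<in> hom (Fob (subm (Fob V S) (U S)) r)
        (Fob (subm (Fob V T) (U T)) r)"
      using hom_mult[OF mD(2)[OF r]] UD(2)[OF ST] SD(2)[OF r] subgroup.m_closed[OF SD(1)[OF r]] r
      by (intro homI) (auto simp: subf_def subm_def)
  next
    fix x y a m assume "x \<in> Ob Q" "y \<in> Ob Q" "a \<in> Mor Q x y"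
        "m \<in> carrier (Fob (subm (Fob V S) (U S)) x)"
    then show "Fmor (subf Q V U) S T f y (Fmor (subm (Fob V S) (U S)) x y a m) =
        Fmor (subm (Fob V T) (U T)) x y a (Fmor (subf Q V U) S T f x m)"
      using mD(4) SD UD(2)[OF ST] by (simp add: subf_def subm_def)
  qed (use ST in \<open>auto simp: subf_def subm_def\<close>)
qed

lemma subf_Ob:
  assumes Q: "preadditive Q" and C: "category C" and V: "V \<in> Ob (functor_cat C (Mods Q))"
      and U: "subfunctor C Q V U"
  shows "subf Q V U \<in> Ob (functor_cat C (Mods Q))"
proof -
  interpret category C by fact
  note D = functor_Mods_D[OF V] and UD = subfunctorD[OF U]
  have "is_functor C (Mods Q) (subf Q V U)"
    unfolding is_functor_def
  proof (intro conjI ballI)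
    fix S assume S: "S \<in> Ob C"
    then show "Fob (subf Q V U) S \<in> Ob (Mods Q)"
      using additive_functor_subm[OF Q D(1) UD(1)] by (simp add: subf_def Ob_Mods)
    show "Fmor (subf Q V U) S S (Ident C S) = Ident (Mods Q) (Fob (subf Q V U) S)"
      using D(3)[OF S] submodD(2)[OF UD(1)[OF S]]
      by (auto simp: subf_def Mods_Ident subm_def fun_eq_iff)
    fix T f assume T: "T \<in> Ob C" "f \<in> Mor C S T"
    show "Fmor (subf Q V U) S T f \<in> Mor (Mods Q) (Fob (subf Q V U) S) (Fob (subf Q V U) T)"
      using subf_Fmor_in[OF Q V U S T] by (simp add: subf_def)
  next
    fix S T W f g
    assume *: "S \<in> Ob C" "T \<in> Ob C" "W \<in> Ob C" "f \<in> Mor C S T" "g \<in> Mor C T W"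
    show "Fmor (subf Q V U) S W (Comp C S T W g f) =
      Comp (Mods Q) (Fob (subf Q V U) S) (Fob (subf Q V U) T) (Fob (subf Q V U) W)
        (Fmor (subf Q V U) T W g) (Fmor (subf Q V U) S T f)"
      using D(4)[OF *] submodD(2)[OF UD(1)[OF *(1)]] UD(2)[OF *(1,2,4)]
      by (auto simp: subf_def Mods_Comp subm_def compose_def fun_eq_iff)
  qed
  then show ?thesis by (simp add: functor_cat_def)
qed

lemma subf_incl_Mor:
  assumes Q: "preadditive Q" and V: "V \<in> Ob (functor_cat C (Mods Q))" and U: "subfunctor C Q V U"
  shows "subf_incl C Q U \<in> Mor (functor_cat C (Mods Q)) (subf Q V U) V"
    and "subfunctor C Q V W \<Longrightarrow> (\<And>S. S \<in> Ob C \<Longrightarrow> fam_le Q (U S) (W S)) \<Longrightarrow>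
      subf_incl C Q U \<in> Mor (functor_cat C (Mods Q)) (subf Q V U) (subf Q V W)"
proof -
  note D = functor_Mods_D[OF V] and UD = subfunctorD[OF U]
  show "subf_incl C Q U \<in> Mor (functor_cat C (Mods Q)) (subf Q V U) V"
    using sub_incl_Mor(1)[OF Q D(1) UD(1)] UD(2)
    by (auto simp: functor_cat_def subf_incl_def subf_def Mods_Comp fun_eq_iff compose_def
        sub_incl_def subm_def)
  assume W: "subfunctor C Q V W" and le: "\<And>S. S \<in> Ob C \<Longrightarrow> fam_le Q (U S) (W S)"
  show "subf_incl C Q U \<in> Mor (functor_cat C (Mods Q)) (subf Q V U) (subf Q V W)"
    using sub_incl_Mor(2)[OF Q D(1) UD(1) subfunctorD(1)[OF W] le] UD(2) le
    by (auto simp: functor_cat_def subf_incl_def subf_def Mods_Comp fun_eq_iff compose_def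
        sub_incl_def subm_def
        fam_le_def subset_iff)
qed

text \<open>The argument for modules one level higher: at each object of \<open>C\<close> the
  subfunctors form a directed union of submodules. It will be applied to the subfunctors generated
  by finite sets of elements.\<close>

lemma finitely_generated_functor_directed:
  fixes Q :: "('u, 'u) preadd_cat" and U :: "'u \<Rightarrow> 'o \<Rightarrow> 'u \<Rightarrow> 'u set"
  assumes Q: "preadditive Q" and C: "category C"
    and V: "finitely_generated TYPE('u) (functor_cat C (Mods Q)) V" and ab: "(a :: 'u) \<noteq> b"
    and P: "P \<noteq> {}" and U: "\<And>j. j \<in> P \<Longrightarrow> subfunctor C Q V (U j)"
    and dir: "\<And>i j. i \<in> P \<Longrightarrow> j \<in> P \<Longrightarrow>
      \<exists>k\<in>P. (\<forall>S\<in>Ob C. fam_le Q (U i S) (U k S)) \<and> (\<forall>S\<in>Ob C. fam_le Q (U j S) (U k S))"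
    and un: "\<And>S x. S \<in> Ob C \<Longrightarrow> x \<in> Ob Q \<Longrightarrow> carrier (Fob (Fob V S) x) \<subseteq> (\<Union>j\<in>P. U j S x)"
  shows "\<exists>j\<in>P. \<forall>S\<in>Ob C. \<forall>x\<in>Ob Q. carrier (Fob (Fob V S) x) \<subseteq> U j S x"
proof -
  let ?lq = "\<lambda>i j. \<forall>S\<in>Ob C. fam_le Q (U i S) (U j S)"
  let ?F = "functor_cat C (Mods Q)" and ?J = "thin_cat P ?lq"
  let ?D = "\<lparr>Fob = (\<lambda>j. subf Q V (U j)), Fmor = (\<lambda>i j a. subf_incl C Q (U i))\<rparr>"
  have VV: "V \<in> Ob ?F" using V by (simp add: finitely_generated_def)
  note D = functor_Mods_D[OF VV]
  have fil: "filtered ?J"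
  proof (rule filtered_thin_cat[OF P])
    show "?lq i k" if "?lq i j" "?lq j k" for i j k
      using that fam_le_trans by blast
  qed (use dir in \<open>simp_all add: fam_le_refl\<close>)
  have inc: "subf_incl C Q (U i) \<in> Mor ?F (subf Q V (U i)) (subf Q V (U j))"
    if "i \<in> P" "j \<in> P" "?lq i j" for i j
    using subf_incl_Mor(2)[OF Q VV U U] that by blast
  have comp: "Comp ?F (subf Q V (U i)) X Y (subf_incl C Q (U j)) (subf_incl C Q (U i))
      = subf_incl C Q (U i)"
    if "?lq i j" for i j X Y
    using that by (auto simp: functor_cat_def Mods_Comp subf_incl_def sub_incl_def subf_def subm_def
        compose_def
        fam_le_def fun_eq_iff)
  have fctr: "is_functor ?J ?F ?D"
  proof (rule is_functor_thin_cat)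
    fix i assume i: "i \<in> P"
    show "Fmor ?D i i undefined = Ident ?F (Fob ?D i)"
      by (simp add: functor_cat_def Mods_Ident subf_incl_def sub_incl_def subf_def subm_def
          fun_eq_iff)
  qed (use subf_Ob[OF Q C VV U] inc comp in auto)
  have coc: "cocone ?J ?F ?D V (\<lambda>j. subf_incl C Q (U j))"
    by (rule cocone_thin_cat) (use VV subf_incl_Mor(1)[OF Q VV U] comp in auto)
  have col: "is_colimit ?J ?F ?D V (\<lambda>j. subf_incl C Q (U j))"
  proof (rule is_colimit_functor_cat[OF C category_Mods[OF Q] fctr coc])
    fix S assume S: "S \<in> Ob C"
    have "is_colimit ?J (Mods Q) (sub_diagram Q (Fob V S) (\<lambda>j. U j S)) (Fob V S)
        (\<lambda>j. sub_incl Q (U j S))"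
    proof (rule is_colimit_sub_diagram[OF Q D(1)[OF S]])
      show "\<exists>k\<in>P. ?lq i k \<and> ?lq j k" if "i \<in> P" "j \<in> P" for i j
        using dir[OF that] .
    qed (use S un[OF S] subfunctorD(1)[OF U S] in auto)
    then show "is_colimit ?J (Mods Q) \<lparr>Fob = (\<lambda>j. Fob (Fob ?D j) S), Fmor
        = (\<lambda>i j a. Fmor ?D i j a S)\<rparr> (Fob V S)
        (\<lambda>j. subf_incl C Q (U j) S)"
      using S by (simp add: sub_diagram_def subf_def subf_incl_def)
  qed
  have inj: "mono_in ?F (Fob ?D i) (Fob ?D j) (Fmor ?D i j a)"
    if ij: "i \<in> Ob ?J" "j \<in> Ob ?J" "a \<in> Mor ?J i j" for i j a
  proof (rule mono_in_functor_cat)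
    have *: "i \<in> P" "j \<in> P" "?lq i j" using ij by (auto simp: thin_cat_def split: if_splits)
    then show "Fmor ?D i j a \<in> Mor ?F (Fob ?D i) (Fob ?D j)" using inc by simp
    fix S assume S: "S \<in> Ob C"
    have "sub_incl Q (U i S) \<in> Mor (Mods Q) (subm (Fob V S) (U i S)) (subm (Fob V S) (U j S))"
      using sub_incl_Mor(2)[OF Q D(1)[OF S] subfunctorD(1)[OF U S] subfunctorD(1)[OF U S]] * S
          by blast
    then show "mono_in (Mods Q) (Fob (Fob ?D i) S) (Fob (Fob ?D j) S) (Fmor ?D i j a S)"
      using S by (auto simp: subf_def subf_incl_def subm_def sub_incl_def inj_on_def intro!:
          mono_in_Mods)
  qed
  have "(\<lambda>_ _ _. a) \<noteq> (\<lambda>(_ :: 'o) (_ :: 'u) (_ :: 'u). b)" using ab by metis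
  from finitely_generated_split[OF category_functor_cat[OF C category_Mods[OF Q]] V fil fctr inj col
      this]
  obtain j s where j: "j \<in> P" and s: "s \<in> Mor ?F V (subf Q V (U j))"
    "Comp ?F V (subf Q V (U j)) V (subf_incl C Q (U j)) s = Ident ?F V"
    by (auto simp: thin_cat_def)
  have "carrier (Fob (Fob V S) x) \<subseteq> U j S x" if S: "S \<in> Ob C" and x: "x \<in> Ob Q" for S x
  proof
    fix m assume m: "m \<in> carrier (Fob (Fob V S) x)"
    have "s S \<in> Mor (Mods Q) (Fob V S) (subm (Fob V S) (U j S))"
      using s(1) S by (auto simp: functor_cat_def subf_def PiE_iff)
    from Mods_MorD(2)[OF this x] m have in_U: "s S x m \<in> U j S x"
      by (auto simp: hom_def subm_def)
    moreover have "s S x m = m"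
      using fun_cong[OF fun_cong[OF fun_cong[OF s(2), of S], of x], of m] S x m in_U
      by (simp add: functor_cat_def Mods_Comp Mods_Ident compose_def subf_incl_def sub_incl_def)
    ultimately show "m \<in> U j S x" by simp
  qed
  then show ?thesis by (intro bexI[OF _ j] ballI)
qed

section \<open>Quotient modules and chain conditions\<close>

text \<open>The quotient group consists of representatives instead of cosets, as it must again be carried
  by a subset of \<open>'u\<close>.\<close>

definition coset_rep :: "('a, 'b) monoid_scheme \<Rightarrow> 'a set \<Rightarrow> 'a \<Rightarrow> 'a" where
  "coset_rep G H x = (SOME y. y \<in> H #>\<^bsub>G\<^esub> x)"

definition quot_grp :: "'a monoid \<Rightarrow> 'a set \<Rightarrow> 'a monoid" where
  "quot_grp G H = \<lparr>carrier = coset_rep G H ` carrier G, mult = (\<lambda>x y. coset_rep G H (x \<otimes>\<^bsub>G\<^esub> y)),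
     one = coset_rep G H \<one>\<^bsub>G\<^esub>\<rparr>"

context
  fixes G :: "'a monoid" and H :: "'a set"
  assumes G: "comm_group G" and H: "subgroup H G"
begin

interpretation comm_group G by (fact G)

lemma coset_rep_in: "x \<in> carrier G \<Longrightarrow> coset_rep G H x \<in> H #>\<^bsub>G\<^esub> x"
  unfolding coset_rep_def by (rule someI, rule rcos_self[OF _ H])

lemma coset_rep_closed: "x \<in> carrier G \<Longrightarrow> coset_rep G H x \<in> carrier G"
  using coset_rep_in r_coset_subset_G[OF subgroup.subset[OF H]] by blast

lemma rcoset_coset_rep: "x \<in> carrier G \<Longrightarrow> H #>\<^bsub>G\<^esub> coset_rep G H x = H #>\<^bsub>G\<^esub> x"
  using repr_independence[OF coset_rep_in _ H] by simp

text \<open>The representative is chosen from the coset alone, so equal cosets have equal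
  representatives; conversely a coset is recovered from its representative.\<close>

lemma coset_rep_eq_iff:
  assumes "x \<in> carrier G" "y \<in> carrier G"
  shows "coset_rep G H x = coset_rep G H y \<longleftrightarrow> x \<otimes>\<^bsub>G\<^esub> inv\<^bsub>G\<^esub> y \<in> H"
proof -
  have "coset_rep G H x = coset_rep G H y \<longleftrightarrow> H #>\<^bsub>G\<^esub> x = H #>\<^bsub>G\<^esub> y"
    using rcoset_coset_rep assms by (metis coset_rep_def)
  also have "\<dots> \<longleftrightarrow> x \<in> H #>\<^bsub>G\<^esub> y"
    using repr_independence[of x H y] rcos_self[OF assms(1) H] assms H by auto
  also have "\<dots> \<longleftrightarrow> x \<otimes>\<^bsub>G\<^esub> inv\<^bsub>G\<^esub> y \<in> H"
    using subgroup.rcos_module[OF H is_group assms(2,1)] .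
  finally show ?thesis .
qed

lemma coset_rep_mult:
  assumes "x \<in> carrier G" "y \<in> carrier G"
  shows "coset_rep G H (coset_rep G H x \<otimes>\<^bsub>G\<^esub> y) = coset_rep G H (x \<otimes>\<^bsub>G\<^esub> y)"
    and "coset_rep G H (x \<otimes>\<^bsub>G\<^esub> coset_rep G H y) = coset_rep G H (x \<otimes>\<^bsub>G\<^esub> y)"
proof -
  interpret normal H G using subgroup_imp_normal[OF H] .
  have "H #>\<^bsub>G\<^esub> (coset_rep G H x \<otimes>\<^bsub>G\<^esub> y) = H #>\<^bsub>G\<^esub> (x \<otimes>\<^bsub>G\<^esub> y)"
    "H #>\<^bsub>G\<^esub> (x \<otimes>\<^bsub>G\<^esub> coset_rep G H y) = H #>\<^bsub>G\<^esub> (x \<otimes>\<^bsub>G\<^esub> y)"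
    using assms by (simp_all add: rcos_sum[symmetric] coset_rep_closed rcoset_coset_rep)
  then show "coset_rep G H (coset_rep G H x \<otimes>\<^bsub>G\<^esub> y) = coset_rep G H (x \<otimes>\<^bsub>G\<^esub> y)"
    "coset_rep G H (x \<otimes>\<^bsub>G\<^esub> coset_rep G H y) = coset_rep G H (x \<otimes>\<^bsub>G\<^esub> y)"
    by (simp_all add: coset_rep_def)
qed

lemma coset_rep_idem: "x \<in> carrier G \<Longrightarrow> coset_rep G H (coset_rep G H x) = coset_rep G H x"
  using rcoset_coset_rep by (metis coset_rep_def)

lemma comm_group_quot_grp: "comm_group (quot_grp G H)"
proof (rule comm_groupI)
  fix a assume "a \<in> carrier (quot_grp G H)"
  then obtain x where x: "x \<in> carrier G" "a = coset_rep G H x" by (auto simp: quot_grp_def)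
  then show "\<exists>b\<in>carrier (quot_grp G H). b \<otimes>\<^bsub>quot_grp G H\<^esub> a = \<one>\<^bsub>quot_grp G H\<^esub>"
    by (intro bexI[of _ "coset_rep G H (inv\<^bsub>G\<^esub> x)"])
      (simp_all add: quot_grp_def coset_rep_mult coset_rep_closed)
next
  fix a b assume "a \<in> carrier (quot_grp G H)" "b \<in> carrier (quot_grp G H)"
  then show "a \<otimes>\<^bsub>quot_grp G H\<^esub> b = b \<otimes>\<^bsub>quot_grp G H\<^esub> a"
    by (auto simp: quot_grp_def coset_rep_closed m_comm)
next
  fix a b c
  assume "a \<in> carrier (quot_grp G H)" "b \<in> carrier (quot_grp G H)" "c \<in> carrier (quot_grp G H)"
  then show "a \<otimes>\<^bsub>quot_grp G H\<^esub> b \<otimes>\<^bsub>quot_grp G H\<^esub> c = a \<otimes>\<^bsub>quot_grp G H\<^esub> (b \<otimes>\<^bsub>quot_grp G H\<^esub> c)"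
    by (auto simp: quot_grp_def coset_rep_mult coset_rep_closed) (simp add: m_assoc)
qed (auto simp: quot_grp_def coset_rep_mult coset_rep_closed coset_rep_idem intro!: imageI)

lemma coset_rep_hom: "restrict (coset_rep G H) (carrier G) \<in> hom G (quot_grp G H)"
  by (rule homI) (auto simp: quot_grp_def coset_rep_mult coset_rep_closed)

end

definition quot_mod :: "'u rmod \<Rightarrow> ('u \<Rightarrow> 'u set) \<Rightarrow> 'u rmod" where
  "quot_mod M Z = \<lparr>Fob = (\<lambda>x. quot_grp (Fob M x) (Z x)),
     Fmor = (\<lambda>x y a. \<lambda>m\<in>carrier (quot_grp (Fob M x) (Z x)). coset_rep (Fob M y) (Z y)
         (Fmor M x y a m))\<rparr>"

text \<open>Well-definedness of the action on the quotient: \<open>m\<close> and its representative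
  differ by an element of \<open>Z x\<close>, which the action carries into
  \<open>Z y\<close>.\<close>

lemma coset_rep_Fmor:
  assumes Q: "preadditive Q" and M: "additive_functor Q Ab M" and Z: "submod Q M Z"
    and x: "x \<in> Ob Q" and y: "y \<in> Ob Q" and a: "a \<in> Mor Q x y" and m: "m \<in> carrier (Fob M x)"
  shows "coset_rep (Fob M y) (Z y) (Fmor M x y a (coset_rep (Fob M x) (Z x) m)) =
    coset_rep (Fob M y) (Z y) (Fmor M x y a m)"
proof -
  note D = additive_functorD[OF Q M] and ZD = submodD[OF Z]
  interpret X: comm_group "Fob M x" using D(1)[OF x] .
  interpret h: group_hom "Fob M x" "Fob M y" "Fmor M x y a"
    using hom_group_hom[OF D(1)[OF x] D(1)[OF y] D(2)[OF x y a]] .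
  let ?r = "coset_rep (Fob M x) (Z x) m"
  note * = D(1)[OF x] ZD(1)[OF x]
  have r: "?r \<in> carrier (Fob M x)" using coset_rep_closed[OF * m] .
  have "?r \<otimes>\<^bsub>Fob M x\<^esub> inv\<^bsub>Fob M x\<^esub> m \<in> Z x"
    using coset_rep_eq_iff[OF * r m] coset_rep_idem[OF * m] by simp
  from ZD(3)[OF x y a this] have "Fmor M x y a ?r \<otimes>\<^bsub>Fob M y\<^esub> inv\<^bsub>Fob M y\<^esub> Fmor M x y a m \<in> Z y"
    using r m by simp
  then show ?thesis
    using coset_rep_eq_iff[OF D(1)[OF y] ZD(1)[OF y]] r m by simp
qed

lemma additive_functor_quot_mod:
  assumes Q: "preadditive Q" and M: "additive_functor Q Ab M" and Z: "submod Q M Z"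
  shows "additive_functor Q Ab (quot_mod M Z)"
proof -
  interpret preadditive Q by fact
  note D = additive_functorD[OF Q M] and ZD = submodD[OF Z]
  have cl: "Fmor M x y a m \<in> carrier (Fob M y)"
    if "x \<in> Ob Q" "y \<in> Ob Q" "a \<in> Mor Q x y" "m \<in> carrier (Fob M x)" for x y a m
    using D(2)[OF that(1-3)] that(4) by (auto simp: hom_def)
  have mult: "Fmor M x y a (m \<otimes>\<^bsub>Fob M x\<^esub> n) = Fmor M x y a m \<otimes>\<^bsub>Fob M y\<^esub> Fmor M x y a n"
    if "x \<in> Ob Q" "y \<in> Ob Q" "a \<in> Mor Q x y" "m \<in> carrier (Fob M x)" "n \<in> carrier (Fob M x)"
        for x y a m n
    using hom_mult[OF D(2)[OF that(1-3)]] that by simp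
  have closed: "m \<otimes>\<^bsub>Fob M x\<^esub> n \<in> carrier (Fob M x)"
    if "x \<in> Ob Q" "m \<in> carrier (Fob M x)" "n \<in> carrier (Fob M x)" for x m n
    using comm_groupE(1)[OF D(1)[OF that(1)]] that by simp
  note rep = coset_rep_Fmor[OF Q M Z]
    and repc = coset_rep_closed[OF D(1) ZD(1)] and repm = coset_rep_mult[OF D(1) ZD(1)]
  have Fmor_rep: "Fmor (quot_mod M Z) x y a (coset_rep (Fob M x) (Z x) n) =
      coset_rep (Fob M y) (Z y) (Fmor M x y a n)"
    if "x \<in> Ob Q" "y \<in> Ob Q" "a \<in> Mor Q x y" "n \<in> carrier (Fob M x)" for x y a n
    using that rep[OF that] by (simp add: quot_mod_def quot_grp_def)
  show ?thesis
  proof (rule additive_functorI[OF Q])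
    fix x assume "x \<in> Ob Q"
    then show "comm_group (Fob (quot_mod M Z) x)"
      using comm_group_quot_grp[OF D(1) ZD(1)] by (simp add: quot_mod_def)
  next
    fix x y a assume *: "x \<in> Ob Q" "y \<in> Ob Q" "a \<in> Mor Q x y"
    show "Fmor (quot_mod M Z) x y a \<in> hom (Fob (quot_mod M Z) x) (Fob (quot_mod M Z) y)"
    proof (rule homI)
      fix m n
      assume "m \<in> carrier (Fob (quot_mod M Z) x)" "n \<in> carrier (Fob (quot_mod M Z) x)"
      then obtain m' n' where mn: "m' \<in> carrier (Fob M x)" "n' \<in> carrier (Fob M x)"
        "m = coset_rep (Fob M x) (Z x) m'" "n = coset_rep (Fob M x) (Z x) n'"
        by (auto simp: quot_mod_def quot_grp_def)
      then have "m \<otimes>\<^bsub>Fob (quot_mod M Z) x\<^esub> n = coset_rep (Fob M x) (Z x) (m' \<otimes>\<^bsub>Fob M x\<^esub> n')"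
        using * by (simp add: quot_mod_def quot_grp_def repc repm)
      then show "Fmor (quot_mod M Z) x y a (m \<otimes>\<^bsub>Fob (quot_mod M Z) x\<^esub> n) =
          Fmor (quot_mod M Z) x y a m \<otimes>\<^bsub>Fob (quot_mod M Z) y\<^esub> Fmor (quot_mod M Z) x y a n"
        using * mn by (simp add: quot_mod_def quot_grp_def rep repc repm cl mult closed)
    qed (use * in \<open>auto simp: quot_mod_def quot_grp_def rep repc cl\<close>)
    show "Fmor (quot_mod M Z) x y a \<in> extensional (carrier (Fob (quot_mod M Z) x))"
      by (simp add: quot_mod_def)
  next
    fix x m assume "x \<in> Ob Q" "m \<in> carrier (Fob (quot_mod M Z) x)"
    then show "Fmor (quot_mod M Z) x x (Ident Q x) m = m"
      by (auto simp: quot_mod_def quot_grp_def D(4) repc coset_rep_idem[OF D(1) ZD(1)])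
  next
    fix x y z a b m
    assume *: "x \<in> Ob Q" "y \<in> Ob Q" "z \<in> Ob Q" "a \<in> Mor Q x y" "b \<in> Mor Q y z"
      "m \<in> carrier (Fob (quot_mod M Z) x)"
    then obtain n where n: "n \<in> carrier (Fob M x)" "m = coset_rep (Fob M x) (Z x) n"
      by (auto simp: quot_mod_def quot_grp_def)
    show "Fmor (quot_mod M Z) x z (Comp Q x y z b a) m =
        Fmor (quot_mod M Z) y z b (Fmor (quot_mod M Z) x y a m)"
      using * n by (simp add: Fmor_rep cl Comp_in D(5))
  next
    fix x y a b m
    assume *: "x \<in> Ob Q" "y \<in> Ob Q" "a \<in> Mor Q x y" "b \<in> Mor Q x y"
      "m \<in> carrier (Fob (quot_mod M Z) x)"
    then obtain n where n: "n \<in> carrier (Fob M x)" "m = coset_rep (Fob M x) (Z x) n"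
      by (auto simp: quot_mod_def quot_grp_def)
    have "a \<otimes>\<^bsub>HomGrp Q x y\<^esub> b \<in> Mor Q x y"
      using comm_groupE(1)[OF HomGrp[OF *(1,2)]] * by (simp add: carrier_HomGrp)
    then show "Fmor (quot_mod M Z) x y (a \<otimes>\<^bsub>HomGrp Q x y\<^esub> b) m =
        Fmor (quot_mod M Z) x y a m \<otimes>\<^bsub>Fob (quot_mod M Z) y\<^esub> Fmor (quot_mod M Z) x y b m"
      using * n by (simp add: Fmor_rep D(6)) (simp add: quot_mod_def quot_grp_def repm repc cl)
  qed
qed

lemma quot_mod_proj:
  assumes Q: "preadditive Q" and M: "additive_functor Q Ab M" and Z: "submod Q M Z"
  shows "(\<lambda>x\<in>Ob Q. restrict (coset_rep (Fob M x) (Z x)) (carrier (Fob M x))) \<in> Mor (Mods Q) M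
      (quot_mod M Z)"
proof (rule Mods_MorI[OF Q M additive_functor_quot_mod[OF Q M Z]])
  note D = additive_functorD[OF Q M] and ZD = submodD[OF Z]
  fix x y a m assume *: "x \<in> Ob Q" "y \<in> Ob Q" "a \<in> Mor Q x y" "m \<in> carrier (Fob M x)"
  then have "Fmor M x y a m \<in> carrier (Fob M y)"
    using D(2)[OF *(1-3)] by (auto simp: hom_def)
  then show "(\<lambda>x\<in>Ob Q. restrict (coset_rep (Fob M x) (Z x)) (carrier (Fob M x))) y (Fmor M x y a m)
      =
      Fmor (quot_mod M Z) x y a ((\<lambda>x\<in>Ob Q. restrict (coset_rep (Fob M x) (Z x)) (carrier (Fob M x)))
          x m)"
    using * coset_rep_Fmor[OF Q M Z *] by (simp add: quot_mod_def quot_grp_def)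
qed (use coset_rep_hom[OF additive_functorD(1)[OF Q M] submodD(1)[OF Z]] in \<open>auto simp:
    quot_mod_def\<close>)

text \<open>With \<open>N\<close> the quotient by a proper submodule, this and the projection are
  the two parallel morphisms that a generating family has to separate.\<close>

lemma zero_Mor:
  assumes Q: "preadditive Q" and M: "additive_functor Q Ab M" and N: "additive_functor Q Ab N"
  shows "(\<lambda>x\<in>Ob Q. \<lambda>m\<in>carrier (Fob M x). \<one>\<^bsub>Fob N x\<^esub>) \<in> Mor (Mods Q) M N"
proof (rule Mods_MorI[OF Q M N])
  note DM = additive_functorD[OF Q M] and DN = additive_functorD[OF Q N]
  fix x assume x: "x \<in> Ob Q"
  interpret M: comm_group "Fob M x" using DM(1)[OF x] .
  interpret N: comm_group "Fob N x" using DN(1)[OF x] .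
  show "(\<lambda>x\<in>Ob Q. \<lambda>m\<in>carrier (Fob M x). \<one>\<^bsub>Fob N x\<^esub>) x \<in> hom (Fob M x) (Fob N x)"
    using x by (auto intro!: homI)
  fix y a m assume *: "y \<in> Ob Q" "a \<in> Mor Q x y" "m \<in> carrier (Fob M x)"
  have "Fmor M x y a m \<in> carrier (Fob M y)"
    using DM(2)[OF x *(1,2)] *(3) by (auto simp: hom_def)
  moreover have "Fmor N x y a \<one>\<^bsub>Fob N x\<^esub> = \<one>\<^bsub>Fob N y\<^esub>"
    using group_hom.hom_one[OF hom_group_hom[OF DN(1)[OF x] DN(1)[OF *(1)] DN(2)[OF x *(1,2)]]] .
  ultimately show "(\<lambda>x\<in>Ob Q. \<lambda>m\<in>carrier (Fob M x). \<one>\<^bsub>Fob N x\<^esub>) y (Fmor M x y a m) =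
      Fmor N x y a ((\<lambda>x\<in>Ob Q. \<lambda>m\<in>carrier (Fob M x). \<one>\<^bsub>Fob N x\<^esub>) x m)"
    using x * by simp
qed auto

section \<open>Preimages, images, intersections and sums of submodules\<close>

lemma submodI:
  assumes Q: "preadditive Q" and M: "additive_functor Q Ab M"
    and "\<And>x m. x \<in> Ob Q \<Longrightarrow> m \<in> U x \<Longrightarrow> m \<in> carrier (Fob M x)"
    and "\<And>x. x \<in> Ob Q \<Longrightarrow> \<one>\<^bsub>Fob M x\<^esub> \<in> U x"
    and "\<And>x m n. x \<in> Ob Q \<Longrightarrow> m \<in> U x \<Longrightarrow> n \<in> U x \<Longrightarrow> m \<otimes>\<^bsub>Fob M x\<^esub> n \<in> U x"
    and "\<And>x m. x \<in> Ob Q \<Longrightarrow> m \<in> U x \<Longrightarrow> inv\<^bsub>Fob M x\<^esub> m \<in> U x"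
    and "\<And>x y a m. x \<in> Ob Q \<Longrightarrow> y \<in> Ob Q \<Longrightarrow> a \<in> Mor Q x y \<Longrightarrow> m \<in> U x \<Longrightarrow> Fmor M x y a m \<in> U y"
  shows "submod Q M U"
  unfolding submod_def using assms(3-) by (auto simp: subgroup_def)

lemma submod_carrier:
  assumes Q: "preadditive Q" and M: "additive_functor Q Ab M"
  shows "submod Q M (\<lambda>x. carrier (Fob M x))"
proof -
  note D = additive_functorD[OF Q M]
  show ?thesis
    unfolding submod_def
    using group.subgroup_self[OF comm_group.axioms(2)[OF D(1)]] hom_in_carrier[OF D(2)] by blast
qed

lemma submod_vimage:
  assumes Q: "preadditive Q" and N: "additive_functor Q Ab N" and M: "additive_functor Q Ab M"
    and t: "t \<in> Mor (Mods Q) N M" and U: "submod Q M U"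
  shows "submod Q N (\<lambda>x. {n \<in> carrier (Fob N x). t x n \<in> U x})"
proof (rule submodI[OF Q N])
  note D = additive_functorD[OF Q N] and MD = additive_functorD[OF Q M] and t = Mods_MorD[OF t]
    and U = submodD[OF U]
  fix x assume x: "x \<in> Ob Q"
  interpret N: comm_group "Fob N x" using D(1)[OF x] .
  interpret h: group_hom "Fob N x" "Fob M x" "t x"
    using hom_group_hom[OF D(1)[OF x] MD(1)[OF x] t(2)[OF x]] .
  interpret U: subgroup "U x" "Fob M x" using U(1)[OF x] .
  show "\<one>\<^bsub>Fob N x\<^esub> \<in> {n \<in> carrier (Fob N x). t x n \<in> U x}" by simp
  show "m \<otimes>\<^bsub>Fob N x\<^esub> n \<in> {n \<in> carrier (Fob N x). t x n \<in> U x}"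
    if "m \<in> {n \<in> carrier (Fob N x). t x n \<in> U x}" "n \<in> {n \<in> carrier (Fob N x). t x n \<in> U x}" for m n
    using that by simp
  show "inv\<^bsub>Fob N x\<^esub> m \<in> {n \<in> carrier (Fob N x). t x n \<in> U x}"
    if "m \<in> {n \<in> carrier (Fob N x). t x n \<in> U x}" for m
    using that by simp
  show "Fmor N x y a m \<in> {n \<in> carrier (Fob N y). t y n \<in> U y}"
    if "y \<in> Ob Q" "a \<in> Mor Q x y" "m \<in> {n \<in> carrier (Fob N x). t x n \<in> U x}" for y a m
    using that D(2)[OF x that(1,2)] t(4)[OF x that(1,2), of m] U(3)[OF x that(1,2), of "t x m"]
    by (auto simp: hom_def)
qed auto

lemma submod_image:
  assumes Q: "preadditive Q" and N: "additive_functor Q Ab N" and M: "additive_functor Q Ab M"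
    and t: "t \<in> Mor (Mods Q) N M"
  shows "submod Q M (\<lambda>x. t x ` carrier (Fob N x))"
proof -
  note D = additive_functorD[OF Q N] and MD = additive_functorD[OF Q M] and t = Mods_MorD[OF t]
  have "subgroup (t x ` carrier (Fob N x)) (Fob M x)" if "x \<in> Ob Q" for x
    using group_hom.img_is_subgroup[OF hom_group_hom[OF D(1) MD(1) t(2)]] that by blast
  moreover have "Fmor M x y a m \<in> t y ` carrier (Fob N y)"
    if xy: "x \<in> Ob Q" "y \<in> Ob Q" and a: "a \<in> Mor Q x y" and m: "m \<in> t x ` carrier (Fob N x)"
        for x y a m
  proof -
    obtain n where n: "n \<in> carrier (Fob N x)" "m = t x n" using m by blast
    then have "Fmor N x y a n \<in> carrier (Fob N y)" using D(2)[OF xy a] by (auto simp: hom_def)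
    then show ?thesis using t(4)[OF xy a n(1)] n(2) by (metis imageI)
  qed
  ultimately show ?thesis by (simp add: submod_def)
qed

lemma submod_Int:
  assumes "preadditive Q" "additive_functor Q Ab M" "submod Q M U" "submod Q M W"
  shows "submod Q M (\<lambda>x. U x \<inter> W x)"
  using group.subgroups_Inter_pair[OF comm_group.axioms(2)[OF additive_functorD(1)[OF assms(1,2)]]]
      assms(3,4)
  by (auto simp: submod_def)

text \<open>As groups are written multiplicatively, \<open><#>\<close> forms the sum of the two
  submodules; commutativity makes it a subgroup.\<close>

lemma submod_sum:
  assumes Q: "preadditive Q" and M: "additive_functor Q Ab M" and U: "submod Q M U"
      and W: "submod Q M W"
  shows "submod Q M (\<lambda>x. U x <#>\<^bsub>Fob M x\<^esub> W x)"
proof -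
  note D = additive_functorD[OF Q M] and U = submodD[OF U] and W = submodD[OF W]
  have "Fmor M x y a m \<in> U y <#>\<^bsub>Fob M y\<^esub> W y"
    if *: "x \<in> Ob Q" "y \<in> Ob Q" "a \<in> Mor Q x y" "m \<in> U x <#>\<^bsub>Fob M x\<^esub> W x" for x y a m
  proof -
    obtain u w where uw: "u \<in> U x" "w \<in> W x" "m = u \<otimes>\<^bsub>Fob M x\<^esub> w" using *(4)
        by (auto simp: set_mult_def)
    then have "Fmor M x y a m = Fmor M x y a u \<otimes>\<^bsub>Fob M y\<^esub> Fmor M x y a w"
      using hom_mult[OF D(2)[OF *(1-3)]] U(2)[OF *(1)] W(2)[OF *(1)] by simp
    then show ?thesis using U(3)[OF *(1-3) uw(1)] W(3)[OF *(1-3) uw(2)] by (auto simp: set_mult_def)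
  qed
  moreover have "subgroup (U x <#>\<^bsub>Fob M x\<^esub> W x) (Fob M x)" if "x \<in> Ob Q" for x
    using comm_group.mult_subgroups[OF D(1) U(1) W(1)] that by blast
  ultimately show ?thesis by (simp add: submod_def)
qed

lemma fam_le_sum:
  assumes Q: "preadditive Q" and M: "additive_functor Q Ab M" and U: "submod Q M U"
      and W: "submod Q M W"
  shows "fam_le Q U (\<lambda>x. U x <#>\<^bsub>Fob M x\<^esub> W x)" "fam_le Q W (\<lambda>x. U x <#>\<^bsub>Fob M x\<^esub> W x)"
proof -
  have "U x \<subseteq> U x <#>\<^bsub>Fob M x\<^esub> W x \<and> W x \<subseteq> U x <#>\<^bsub>Fob M x\<^esub> W x" if x: "x \<in> Ob Q" for x
  proof -
    interpret comm_group "Fob M x" using additive_functorD(1)[OF Q M x] .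
    have "\<one>\<^bsub>Fob M x\<^esub> \<in> U x" "\<one>\<^bsub>Fob M x\<^esub> \<in> W x"
      using submodD(1)[OF U x] submodD(1)[OF W x] by (auto simp: subgroup_def)
    moreover have "u \<otimes>\<^bsub>Fob M x\<^esub> \<one>\<^bsub>Fob M x\<^esub> = u" if "u \<in> U x" for u
      using submodD(2)[OF U x that] by simp
    moreover have "\<one>\<^bsub>Fob M x\<^esub> \<otimes>\<^bsub>Fob M x\<^esub> w = w" if "w \<in> W x" for w
      using submodD(2)[OF W x that] by simp
    ultimately show ?thesis unfolding set_mult_def by (auto 4 3 intro: sym)
  qed
  then show "fam_le Q U (\<lambda>x. U x <#>\<^bsub>Fob M x\<^esub> W x)" "fam_le Q W (\<lambda>x. U x <#>\<^bsub>Fob M x\<^esub> W x)"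
    by (simp_all add: fam_le_def)
qed


text \<open>The chain condition concerns submodules of \<open>M\<close> below \<open>U\<close> and
  does not turn \<open>U\<close> into an object of its own, so that images and sums are handled
  inside one ambient module. Chains are indexed by \<open>nat\<close>; only the passage from
  \<open>noetherian_object\<close> has to move the index into \<open>'u\<close>.\<close>

definition noeth_sub :: "('u, 'u) preadd_cat \<Rightarrow> 'u rmod \<Rightarrow> ('u \<Rightarrow> 'u set) \<Rightarrow> bool" where
  "noeth_sub Q M U \<longleftrightarrow> submod Q M U \<and>
     (\<forall>X :: nat \<Rightarrow> 'u \<Rightarrow> 'u set. (\<forall>i. submod Q M (X i)) \<longrightarrow> (\<forall>i. fam_le Q (X i) U) \<longrightarrow>
        (\<forall>i j. i \<le> j \<longrightarrow> fam_le Q (X i) (X j)) \<longrightarrow> (\<exists>n. \<forall>m\<ge>n. fam_le Q (X m) (X n)))"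

lemma noeth_subD:
  fixes X :: "nat \<Rightarrow> 'u \<Rightarrow> 'u set"
  assumes "noeth_sub Q M U" "\<And>i. submod Q M (X i)" "\<And>i. fam_le Q (X i) U"
    "\<And>i j. i \<le> j \<Longrightarrow> fam_le Q (X i) (X j)"
  shows "\<exists>n. \<forall>m\<ge>n. fam_le Q (X m) (X n)"
  using assms(1)[unfolded noeth_sub_def, THEN conjunct2, rule_format, of X] assms(2-) by blast

text \<open>The preimages of the chain stabilise in \<open>N\<close>, and each member of the chain
  is the image of its preimage because it lies below the image of \<open>t\<close>.\<close>

lemma noeth_sub_image:
  assumes Q: "preadditive Q" and N: "additive_functor Q Ab N" and M: "additive_functor Q Ab M"
    and t: "t \<in> Mor (Mods Q) N M" and no: "noeth_sub Q N (\<lambda>x. carrier (Fob N x))"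
  shows "noeth_sub Q M (\<lambda>x. t x ` carrier (Fob N x))"
  unfolding noeth_sub_def
proof (intro conjI allI impI submod_image[OF Q N M t])
  fix X :: "nat \<Rightarrow> 'a \<Rightarrow> 'a set"
  assume X: "\<forall>i. submod Q M (X i)" "\<forall>i. fam_le Q (X i) (\<lambda>x. t x ` carrier (Fob N x))"
    "\<forall>i j. i \<le> j \<longrightarrow> fam_le Q (X i) (X j)"
  define Y where "Y i x = {n \<in> carrier (Fob N x). t x n \<in> X i x}" for i x
  have "submod Q N (Y i)" for i
    using submod_vimage[OF Q N M t] X(1) by (simp add: Y_def[abs_def])
  moreover have "fam_le Q (Y i) (\<lambda>x. carrier (Fob N x))" for i by (auto simp: fam_le_def Y_def)
  moreover have "fam_le Q (Y i) (Y j)" if "i \<le> j" for i j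
    using X(3) that by (fastforce simp: fam_le_def Y_def)
  ultimately obtain n where n: "\<forall>m\<ge>n. fam_le Q (Y m) (Y n)"
    using noeth_subD[OF no, of Y] by blast
  have "fam_le Q (X m) (X n)" if "m \<ge> n" for m
    unfolding fam_le_def
  proof (intro ballI subsetI)
    fix x y assume x: "x \<in> Ob Q" and y: "y \<in> X m x"
    have "X m x \<subseteq> t x ` carrier (Fob N x)" using X(2) x by (simp add: fam_le_def)
    then obtain z where z: "z \<in> carrier (Fob N x)" "y = t x z"
      using y by blast
    then have "z \<in> Y m x" using y by (simp add: Y_def)
    then have "z \<in> Y n x" using n that x by (auto simp: fam_le_def)
    then show "y \<in> X n x" using z by (simp add: Y_def)
  qed
  then show "\<exists>n. \<forall>m\<ge>n. fam_le Q (X m) (X n)" by blast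
qed

text \<open>A submodule X of U + W is controlled by its intersection with U and by its image modulo
  U. The latter is represented inside W by the intersection of U + X with W. Both give chains that
  stabilise, and nested members with the same two traces coincide.\<close>

lemma noeth_sub_sum:
  assumes Q: "preadditive Q" and M: "additive_functor Q Ab M"
    and U: "noeth_sub Q M U" and W: "noeth_sub Q M W"
  shows "noeth_sub Q M (\<lambda>x. U x <#>\<^bsub>Fob M x\<^esub> W x)"
proof -
  have sU: "submod Q M U" and sW: "submod Q M W" using U W by (auto simp: noeth_sub_def)
  show ?thesis
    unfolding noeth_sub_def
  proof (intro conjI allI impI submod_sum[OF Q M sU sW])
    fix X :: "nat \<Rightarrow> 'a \<Rightarrow> 'a set"
    assume X: "\<forall>i. submod Q M (X i)" "\<forall>i. fam_le Q (X i) (\<lambda>x. U x <#>\<^bsub>Fob M x\<^esub> W x)"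
      "\<forall>i j. i \<le> j \<longrightarrow> fam_le Q (X i) (X j)"
    define Y where "Y i x = X i x \<inter> U x" for i x
    define Z where "Z i x = (U x <#>\<^bsub>Fob M x\<^esub> X i x) \<inter> W x" for i x
    have "submod Q M (Y i)" "submod Q M (Z i)" for i
      using submod_Int[OF Q M X(1)[rule_format] sU]
          submod_Int[OF Q M submod_sum[OF Q M sU X(1)[rule_format]] sW]
      by (simp_all add: Y_def[abs_def] Z_def[abs_def])
    moreover have "fam_le Q (Y i) U" "fam_le Q (Z i) W" for i by (auto simp: fam_le_def Y_def Z_def)
    moreover have "fam_le Q (Y i) (Y j)" "fam_le Q (Z i) (Z j)" if "i \<le> j" for i j
      using X(3) that by (fastforce simp: fam_le_def Y_def Z_def set_mult_def)+
    ultimately obtain k l where k: "\<forall>m\<ge>k. fam_le Q (Y m) (Y k)" and l: "\<forall>m\<ge>l. fam_le Q (Z m) (Z l)"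
      using noeth_subD[OF U, of Y] noeth_subD[OF W, of Z] by blast
    define n where "n = max k l"
    have "fam_le Q (X m) (X n)" if m: "m \<ge> n" for m
      unfolding fam_le_def
    proof (intro ballI subsetI)
      fix x y assume x: "x \<in> Ob Q" and y: "y \<in> X m x"
      interpret comm_group "Fob M x" using additive_functorD(1)[OF Q M x] .
      note mem = submodD(2)[OF X(1)[rule_format] x] submodD(2)[OF sU x] submodD(2)[OF sW x]
      have sub: "X l x \<subseteq> X n x" "X n x \<subseteq> X m x" "X k x \<subseteq> X n x"
        using X(3) m x by (auto simp: fam_le_def n_def)
      have "X m x \<subseteq> U x <#>\<^bsub>Fob M x\<^esub> W x" using X(2) x by (simp add: fam_le_def)
      then obtain u w where uw: "u \<in> U x" "w \<in> W x" "y = u \<otimes>\<^bsub>Fob M x\<^esub> w"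
        using y by (auto simp: set_mult_def)
      have c: "u \<in> carrier (Fob M x)" "w \<in> carrier (Fob M x)" "y \<in> carrier (Fob M x)"
        using mem uw y by auto
      have "w = inv\<^bsub>Fob M x\<^esub> u \<otimes>\<^bsub>Fob M x\<^esub> y"
        using c uw(3) by (simp add: m_assoc[symmetric])
      moreover have "inv\<^bsub>Fob M x\<^esub> u \<in> U x"
        using submodD(1)[OF sU x] uw(1) by (simp add: subgroup.m_inv_closed)
      \<comment> \<open>The component \<open>w\<close> is rewritten with a factor from stage
        \<open>l\<close>. What remains of \<open>y\<close> is then an element of \<open>U\<close>
        and of \<open>X m x\<close>, to which stability at stage \<open>k\<close> applies.\<close>
      ultimately have "w \<in> Z m x" using uw(2) y by (auto simp: Z_def set_mult_def)
      then have "w \<in> Z l x" using l m x by (auto simp: fam_le_def n_def)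
      then obtain u' y' where u': "u' \<in> U x" "y' \<in> X l x" "w = u' \<otimes>\<^bsub>Fob M x\<^esub> y'"
        by (auto simp: Z_def set_mult_def)
      have c': "u' \<in> carrier (Fob M x)" "y' \<in> carrier (Fob M x)" using mem u' by auto
      interpret Xm: subgroup "X m x" "Fob M x" using submodD(1)[OF X(1)[rule_format] x] .
      interpret Xn: subgroup "X n x" "Fob M x" using submodD(1)[OF X(1)[rule_format] x] .
      interpret U: subgroup "U x" "Fob M x" using submodD(1)[OF sU x] .
      have eq: "y = (u \<otimes>\<^bsub>Fob M x\<^esub> u') \<otimes>\<^bsub>Fob M x\<^esub> y'"
        using c c' by (simp add: uw(3) u'(3) m_assoc)
      then have "u \<otimes>\<^bsub>Fob M x\<^esub> u' = y \<otimes>\<^bsub>Fob M x\<^esub> inv\<^bsub>Fob M x\<^esub> y'"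
        using c c' by (simp add: m_assoc)
      moreover have "y \<otimes>\<^bsub>Fob M x\<^esub> inv\<^bsub>Fob M x\<^esub> y' \<in> X m x"
        using y u'(2) sub by (intro Xm.m_closed Xm.m_inv_closed) auto
      ultimately have "u \<otimes>\<^bsub>Fob M x\<^esub> u' \<in> X m x" by simp
      then have "u \<otimes>\<^bsub>Fob M x\<^esub> u' \<in> Y m x"
        using U.m_closed[OF uw(1) u'(1)] by (simp add: Y_def)
      then have "u \<otimes>\<^bsub>Fob M x\<^esub> u' \<in> Y k x" using k m x by (auto simp: fam_le_def n_def)
      then have "u \<otimes>\<^bsub>Fob M x\<^esub> u' \<in> X n x" using sub by (auto simp: Y_def)
      then show "y \<in> X n x" unfolding eq by (rule Xn.m_closed) (use u'(2) sub in auto)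
    qed
    then show "\<exists>n. \<forall>m\<ge>n. fam_le Q (X m) (X n)" by blast
  qed
qed

lemma noeth_sub_one:
  assumes Q: "preadditive Q" and M: "additive_functor Q Ab M"
  shows "noeth_sub Q M (\<lambda>x. {\<one>\<^bsub>Fob M x\<^esub>})"
proof -
  note D = additive_functorD[OF Q M]
  have one: "Fmor M x y a \<one>\<^bsub>Fob M x\<^esub> = \<one>\<^bsub>Fob M y\<^esub>" if "x \<in> Ob Q" "y \<in> Ob Q" "a \<in> Mor Q x y"
      for x y a
    using group_hom.hom_one[OF hom_group_hom[OF D(1,1,2)]] that by blast
  have sub: "submod Q M (\<lambda>x. {\<one>\<^bsub>Fob M x\<^esub>})"
    using group.triv_subgroup[OF comm_group.axioms(2)[OF D(1)]] one by (simp add: submod_def)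
  have "fam_le Q (X m) (X 0)" if "submod Q M (X 0)" "fam_le Q (X m) (\<lambda>x. {\<one>\<^bsub>Fob M x\<^esub>})"
      for X :: "nat \<Rightarrow> 'a \<Rightarrow> 'a set" and m
    using that submodD(1)[OF that(1)] by (force simp: fam_le_def subgroup_def)
  then show ?thesis unfolding noeth_sub_def using sub by blast
qed

lemma noeth_sub_finite:
  assumes Q: "preadditive Q" and M: "additive_functor Q Ab M" and "finite E"
    and "\<And>x m. (x, m) \<in> E \<Longrightarrow> \<exists>U. noeth_sub Q M U \<and> m \<in> U x" and "\<And>x m. (x, m) \<in> E \<Longrightarrow> x \<in> Ob Q"
  shows "\<exists>U. noeth_sub Q M U \<and> (\<forall>(x, m)\<in>E. m \<in> U x)"
  using assms(3-)
proof (induction E rule: finite_induct)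
  case empty
  then show ?case using noeth_sub_one[OF Q M] by blast
next
  case (insert e E)
  obtain x m where e: "e = (x, m)" by force
  obtain U where U: "noeth_sub Q M U" "\<forall>(x, m)\<in>E. m \<in> U x"
    using insert.IH insert.prems by (metis insertI2)
  obtain W where W: "noeth_sub Q M W" "m \<in> W x"
    using insert.prems(1)[of x m] e by blast
  have le: "fam_le Q U (\<lambda>x. U x <#>\<^bsub>Fob M x\<^esub> W x)" "fam_le Q W (\<lambda>x. U x <#>\<^bsub>Fob M x\<^esub> W x)"
    using fam_le_sum[OF Q M] U W by (auto simp: noeth_sub_def)
  show ?case
    using noeth_sub_sum[OF Q M U(1) W(1)] le U(2) W(2) insert.prems(2) e
    by (intro exI[of _ "\<lambda>x. U x <#>\<^bsub>Fob M x\<^esub> W x"]) (fastforce simp: fam_le_def)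
qed

text \<open>The union \<open>Y\<close> of a chain is a subobject, hence finitely generated, and the
  chain covers it directedly. So it equals one member of the chain.\<close>

lemma noetherian_object_noeth_sub:
  fixes Q :: "('u, 'u) preadd_cat"
  assumes inf: "infinite (UNIV :: 'u set)" and Q: "preadditive Q"
      and N: "noetherian_object TYPE('u) (Mods Q) N"
  shows "noeth_sub Q N (\<lambda>x. carrier (Fob N x))"
proof -
  have NN: "additive_functor Q Ab N" using N by (simp add: noetherian_object_def Ob_Mods)
  show ?thesis
    unfolding noeth_sub_def
  proof (intro conjI allI impI submod_carrier[OF Q NN])
    fix X :: "nat \<Rightarrow> 'u \<Rightarrow> 'u set"
    assume X: "\<forall>i. submod Q N (X i)" "\<forall>i. fam_le Q (X i) (\<lambda>x. carrier (Fob N x))"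
      "\<forall>i j. i \<le> j \<longrightarrow> fam_le Q (X i) (X j)"
    note XD = submodD[OF X(1)[rule_format]]
    define Y where "Y x = (\<Union>i. X i x)" for x
    have mono: "m \<in> X j x" if "m \<in> X i x" "i \<le> j" "x \<in> Ob Q" for m i j x
      using X(3) that by (auto simp: fam_le_def)
    have Y: "submod Q N Y"
    proof (rule submodI[OF Q NN])
      fix x m n assume x: "x \<in> Ob Q" and mn: "m \<in> Y x" "n \<in> Y x"
      then obtain i j where ij: "m \<in> X i x" "n \<in> X j x" by (auto simp: Y_def)
      then have "m \<in> X (max i j) x" "n \<in> X (max i j) x"
        using mono x by (meson max.cobounded1 max.cobounded2)+
      then show "m \<otimes>\<^bsub>Fob N x\<^esub> n \<in> Y x"
        using subgroup.m_closed[OF XD(1)[OF x]] by (auto simp: Y_def)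
    next
      fix x y a m assume *: "x \<in> Ob Q" "y \<in> Ob Q" "a \<in> Mor Q x y" "m \<in> Y x"
      then obtain i where "m \<in> X i x" by (auto simp: Y_def)
      then show "Fmor N x y a m \<in> Y y" using XD(3)[OF *(1-3)] by (auto simp: Y_def)
    qed (auto simp: Y_def XD(2) intro: subgroup.m_inv_closed[OF XD(1)]
        subgroup.one_closed[OF XD(1)])
    have "mono_in (Mods Q) (subm N Y) N (sub_incl Q Y)"
      by (rule mono_in_Mods[OF sub_incl_Mor(1)[OF Q NN Y]])
          (simp add: sub_incl_def subm_def inj_on_def)
    then have fg: "finitely_generated TYPE('u) (Mods Q) (subm N Y)"
      using N additive_functor_subm[OF Q NN Y] by (auto simp: noetherian_object_def Ob_Mods)
    obtain \<iota> :: "nat \<Rightarrow> 'u" where \<iota>: "inj \<iota>"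
      using inf infinite_countable_subset by blast
    have sub: "submod Q (subm N Y) (X i)" for i
    proof -
      have "subgroup (X i x) ((Fob N x)\<lparr>carrier := Y x\<rparr>)" if "x \<in> Ob Q" for x
        using group.subgroup_incl[OF comm_group.axioms(2)[OF additive_functorD(1)[OF Q NN that]]
            XD(1)[OF that] submodD(1)[OF Y that]]
        by (auto simp: Y_def)
      then show ?thesis
        using XD(3) by (auto simp: submod_def subm_def Y_def)
    qed
    \<comment> \<open>The chain is re-indexed along an injection of \<open>nat\<close> into
      \<open>'u\<close>, where the index set is required to lie.\<close>
    have "\<exists>j\<in>range \<iota>. \<forall>x\<in>Ob Q. carrier (Fob (subm N Y) x) \<subseteq> X (inv_into UNIV \<iota> j) x"
    proof (rule finitely_generated_Mods_directed[OF Q fg, of "\<iota> 0" "\<iota> 1"])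
      show "\<iota> 0 \<noteq> \<iota> 1" using \<iota> by (auto dest: injD)
      fix i j assume "i \<in> range \<iota>" "j \<in> range \<iota>"
      show "\<exists>k\<in>range \<iota>. fam_le Q (X (inv_into UNIV \<iota> i)) (X (inv_into UNIV \<iota> k)) \<and> fam_le Q
          (X (inv_into UNIV \<iota> j)) (X (inv_into UNIV \<iota> k))"
        using \<iota> X(3) by (intro bexI[of _ "\<iota> (max (inv_into UNIV \<iota> i) (inv_into UNIV \<iota> j))"]) auto
    qed (use \<iota> sub in \<open>auto, auto simp: subm_def Y_def\<close>)
    then obtain n where n: "\<forall>x\<in>Ob Q. Y x \<subseteq> X n x" by (auto simp: subm_def)
    then have "fam_le Q (X m) (X n)" for m by (force simp: fam_le_def Y_def)
    then show "\<exists>n. \<forall>m\<ge>n. fam_le Q (X m) (X n)" by blast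
  qed
qed

lemma locally_noetherian_elements:
  fixes Q :: "('u, 'u) preadd_cat"
  assumes inf: "infinite (UNIV :: 'u set)" and Q: "preadditive Q"
      and LN: "locally_noetherian TYPE('u) (Mods Q)"
    and M: "additive_functor Q Ab M" and x: "x \<in> Ob Q" and m: "m \<in> carrier (Fob M x)"
  shows "\<exists>U. noeth_sub Q M U \<and> m \<in> U x"
proof (rule ccontr)
  assume no: "\<not> ?thesis"
  \<comment> \<open>\<open>Z\<close> is the sum of all noetherian submodules, given by its elements.
    It is closed under products because two noetherian submodules have a noetherian sum.\<close>
  define Z where "Z x = {m. \<exists>U. noeth_sub Q M U \<and> m \<in> U x}" for x
  have Z: "submod Q M Z"
  proof (rule submodI[OF Q M])
    fix x m assume x: "x \<in> Ob Q" and m: "m \<in> Z x"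
    then obtain U where U: "noeth_sub Q M U" "m \<in> U x" by (auto simp: Z_def)
    then have S: "submod Q M U" by (simp add: noeth_sub_def)
    show "m \<in> carrier (Fob M x)" using submodD(2)[OF S x U(2)] .
    show "inv\<^bsub>Fob M x\<^esub> m \<in> Z x"
      using subgroup.m_inv_closed[OF submodD(1)[OF S x] U(2)] U(1) by (auto simp: Z_def)
    show "Fmor M x y a m \<in> Z y" if "y \<in> Ob Q" "a \<in> Mor Q x y" for y a
      using submodD(3)[OF S x that U(2)] U(1) by (auto simp: Z_def)
    fix n assume n: "n \<in> Z x"
    then obtain W where W: "noeth_sub Q M W" "n \<in> W x" by (auto simp: Z_def)
    then show "m \<otimes>\<^bsub>Fob M x\<^esub> n \<in> Z x"
      using noeth_sub_sum[OF Q M U(1) W(1)] U(2) by (auto simp: Z_def set_mult_def)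
  qed (use noeth_sub_one[OF Q M] in \<open>auto simp: Z_def\<close>)
  note D = additive_functorD[OF Q M] and ZD = submodD[OF Z]
  let ?p = "\<lambda>x\<in>Ob Q. restrict (coset_rep (Fob M x) (Z x)) (carrier (Fob M x))"
  let ?z = "\<lambda>x\<in>Ob Q. \<lambda>m\<in>carrier (Fob M x). \<one>\<^bsub>Fob (quot_mod M Z) x\<^esub>"
  have one: "\<one>\<^bsub>Fob (quot_mod M Z) x\<^esub> = coset_rep (Fob M x) (Z x) \<one>\<^bsub>Fob M x\<^esub>" for x
    by (simp add: quot_mod_def quot_grp_def)
  have iff: "coset_rep (Fob M x) (Z x) m = coset_rep (Fob M x) (Z x) \<one>\<^bsub>Fob M x\<^esub> \<longleftrightarrow> m \<in> Z x"
    if "x \<in> Ob Q" "m \<in> carrier (Fob M x)" for x m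
  proof -
    interpret comm_group "Fob M x" using D(1)[OF that(1)] .
    show ?thesis using coset_rep_eq_iff[OF D(1) ZD(1), of x m "\<one>\<^bsub>Fob M x\<^esub>"] that by simp
  qed
  have pz: "?p \<in> Mor (Mods Q) M (quot_mod M Z)" "?z \<in> Mor (Mods Q) M (quot_mod M Z)"
    using quot_mod_proj[OF Q M Z] zero_Mor[OF Q M additive_functor_quot_mod[OF Q M Z]] by auto
  obtain I :: "'u set" and G where G: "generating (Mods Q) (G ` I)"
      "\<And>i. i \<in> I \<Longrightarrow> noetherian_object TYPE('u) (Mods Q) (G i)"
    using LN by (auto simp: locally_noetherian_def)
  have "m \<notin> Z x" using no by (simp add: Z_def)
  \<comment> \<open>A generating family is defined through parallel pairs of morphisms. The pair
    used here is the projection modulo \<open>Z\<close> and the zero map, which differ at the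
    element assumed to lie outside \<open>Z\<close>.\<close>
  then have "?p x m \<noteq> ?z x m" using iff x m by (simp add: one)
  then have "?p \<noteq> ?z" by metis
  moreover have "M \<in> Ob (Mods Q)" "quot_mod M Z \<in> Ob (Mods Q)"
    using M additive_functor_quot_mod[OF Q M Z] by (simp_all add: Ob_Mods)
  ultimately have "\<exists>i\<in>I. \<exists>h\<in>Mor (Mods Q) (G i) M.
      Comp (Mods Q) (G i) M (quot_mod M Z) ?p h \<noteq> Comp (Mods Q) (G i) M (quot_mod M Z) ?z h"
    using G(1)[unfolded generating_def, THEN conjunct2, rule_format, OF _ _ pz] by simp
  then obtain i h where i: "i \<in> I" and h: "h \<in> Mor (Mods Q) (G i) M"
    and ne: "Comp (Mods Q) (G i) M (quot_mod M Z) ?p h \<noteq> Comp (Mods Q) (G i) M (quot_mod M Z) ?z h"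
    by (elim bexE)
  have Gi: "additive_functor Q Ab (G i)" using G(2)[OF i]
      by (simp add: noetherian_object_def Ob_Mods)
  have "noeth_sub Q M (\<lambda>x. h x ` carrier (Fob (G i) x))"
    using noeth_sub_image[OF Q Gi M h noetherian_object_noeth_sub[OF inf Q G(2)[OF i]]] .
  then have "h x n \<in> Z x" if "n \<in> carrier (Fob (G i) x)" for x n
    using that by (auto simp: Z_def)
  moreover have "h x n \<in> carrier (Fob M x)" if "x \<in> Ob Q" "n \<in> carrier (Fob (G i) x)" for x n
    using hom_in_carrier[OF Mods_MorD(2)[OF h that(1)] that(2)] .
  ultimately have "Comp (Mods Q) (G i) M (quot_mod M Z) ?p h
      = Comp (Mods Q) (G i) M (quot_mod M Z) ?z h"
    using iff by (auto simp: Mods_Comp compose_def one fun_eq_iff)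
  with ne show False by contradiction
qed

text \<open>A pair \<open>(s, m)\<close> records the object at which \<open>m\<close> is taken,
  since one element of \<open>'u\<close> may belong to the groups at several objects. The
  intersection form gives an induction principle: whatever defines a submodule and holds for the
  generators holds on the span.\<close>

definition mspan :: "('u, 'u) preadd_cat \<Rightarrow> 'u rmod \<Rightarrow> ('u \<times> 'u) set \<Rightarrow> 'u \<Rightarrow> 'u set" where
  "mspan Q M E x = \<Inter>{U x | U. submod Q M U \<and> (\<forall>(s, m)\<in>E. m \<in> U s)}"

lemma mspan_least: "submod Q M U \<Longrightarrow> (\<And>s m. (s, m) \<in> E \<Longrightarrow> m \<in> U s) \<Longrightarrow> mspan Q M E x \<subseteq> U x"
  unfolding mspan_def by blast

lemma mspan_in: "(s, m) \<in> E \<Longrightarrow> m \<in> mspan Q M E s"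
  unfolding mspan_def by blast

lemma mspan_memI: "(\<And>U. submod Q M U \<Longrightarrow> (\<And>s m. (s, m) \<in> E \<Longrightarrow> m \<in> U s) \<Longrightarrow> y \<in> U x) \<Longrightarrow> y \<in> mspan Q M E x"
  unfolding mspan_def by blast

lemma mspan_memD:
  assumes "y \<in> mspan Q M E x" "submod Q M U" "\<And>s m. (s, m) \<in> E \<Longrightarrow> m \<in> U s"
  shows "y \<in> U x"
  using subsetD[OF mspan_least[OF assms(2,3)] assms(1)] .

lemma mspan_mono: "E \<subseteq> E' \<Longrightarrow> mspan Q M E x \<subseteq> mspan Q M E' x"
  unfolding mspan_def by blast

lemma submod_mspan:
  assumes Q: "preadditive Q" and M: "additive_functor Q Ab M"
    and E: "\<And>s m. (s, m) \<in> E \<Longrightarrow> m \<in> carrier (Fob M s)"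
  shows "submod Q M (mspan Q M E)"
proof (rule submodI[OF Q M])
  fix x m assume x: "x \<in> Ob Q" and m: "m \<in> mspan Q M E x"
  show "m \<in> carrier (Fob M x)" using mspan_memD[OF m submod_carrier[OF Q M] E] .
  show "inv\<^bsub>Fob M x\<^esub> m \<in> mspan Q M E x"
    by (rule mspan_memI) (rule subgroup.m_inv_closed[OF submodD(1)[OF _ x] mspan_memD[OF m]])
  show "Fmor M x y a m \<in> mspan Q M E y" if "y \<in> Ob Q" "a \<in> Mor Q x y" for y a
    by (rule mspan_memI) (rule submodD(3)[OF _ x that mspan_memD[OF m]])
  fix n assume n: "n \<in> mspan Q M E x"
  show "m \<otimes>\<^bsub>Fob M x\<^esub> n \<in> mspan Q M E x"
    by (rule mspan_memI) (rule subgroup.m_closed[OF submodD(1)[OF _ x] mspan_memD[OF m]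
        mspan_memD[OF n]])
next
  fix x assume x: "x \<in> Ob Q"
  show "\<one>\<^bsub>Fob M x\<^esub> \<in> mspan Q M E x"
    by (rule mspan_memI) (rule subgroup.one_closed[OF submodD(1)[OF _ x]])
qed

section \<open>Relations in an FI-module\<close>

text \<open>Images of initial segments of \<open>nat\<close> under an injective \<open>e\<close>
  serve as standard finite sets inside \<open>'u\<close>. Maps between initial segments are carried
  over to them.\<close>

definition conj_map :: "(nat \<Rightarrow> 'u) \<Rightarrow> (nat \<Rightarrow> nat) \<Rightarrow> 'u \<Rightarrow> 'u" where
  "conj_map e h x = e (h (inv_into UNIV e x))"

lemma conj_map_apply: "inj e \<Longrightarrow> conj_map e h (e a) = e (h a)"
  by (simp add: conj_map_def)

lemma conj_map_image: "inj e \<Longrightarrow> conj_map e h ` e ` A = e ` h ` A"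
  by (auto simp: conj_map_apply image_image)

lemma inj_on_conj_map: "inj e \<Longrightarrow> inj_on h A \<Longrightarrow> inj_on (conj_map e h) (e ` A)"
  by (auto simp: inj_on_def conj_map_apply)

section \<open>Subsets of bounded size\<close>

definition subs :: "nat \<Rightarrow> 'u set \<Rightarrow> 'u set set" where
  "subs d S = {T. T \<subseteq> S \<and> card T \<le> d}"

lemma finite_subs: "finite S \<Longrightarrow> finite (subs d S)"
  unfolding subs_def by (rule finite_subset[of _ "Pow S"]) auto

lemma subs_image:
  assumes "T \<in> subs d S" "h ` S \<subseteq> S'" "finite S"
  shows "h ` T \<in> subs d S'"
proof -
  have "finite T" using assms by (auto simp: subs_def intro: finite_subset)
  from card_image_le[OF this, of h] show ?thesis using assms by (auto simp: subs_def)
qed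

lemma subsD: "T \<in> subs d S \<Longrightarrow> T \<subseteq> S"
  by (simp add: subs_def)

lemma finite_in_subs: "finite S \<Longrightarrow> T \<in> subs d S \<Longrightarrow> finite T"
  by (auto simp: subs_def intro: finite_subset)

section \<open>Injections acting on an FI-module\<close>

locale fi_functor =
  fixes Q :: "('u, 'u) preadd_cat" and V :: "'u fi_mod"
  assumes Q: "preadditive Q" and V: "V \<in> Ob (functor_cat FI (Mods Q))"
begin

abbreviation Gr :: "'u set \<Rightarrow> 'u \<Rightarrow> 'u monoid" where
  "Gr S r \<equiv> Fob (Fob V S) r"

abbreviation act :: "'u set \<Rightarrow> 'u \<Rightarrow> 'u \<Rightarrow> 'u \<Rightarrow> 'u \<Rightarrow> 'u" where
  "act S \<equiv> Fmor (Fob V S)"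

text \<open>Morphisms of \<open>FI\<close> are extensional functions. Restricting here allows any
  function on \<open>'u\<close> to be supplied, in particular \<open>\<lambda>x. x\<close> for every
  inclusion.\<close>

definition push :: "'u set \<Rightarrow> 'u set \<Rightarrow> ('u \<Rightarrow> 'u) \<Rightarrow> 'u \<Rightarrow> 'u \<Rightarrow> 'u" where
  "push S T f = Fmor V S T (restrict f S)"

lemma Gr_add: "finite S \<Longrightarrow> additive_functor Q Ab (Fob V S)"
  using functor_Mods_D(1)[OF V] by (simp add: FI_def)

lemma Gr_comm: "finite S \<Longrightarrow> r \<in> Ob Q \<Longrightarrow> comm_group (Gr S r)"
  using additive_functorD(1)[OF Q Gr_add] .

lemma FI_MorI: "finite T \<Longrightarrow> f ` S \<subseteq> T \<Longrightarrow> inj_on f S \<Longrightarrow> restrict f S \<in> Mor FI S T"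
  by (auto simp: FI_def inj_on_def)

lemma finite_inj_dom: "finite T \<Longrightarrow> f ` S \<subseteq> T \<Longrightarrow> inj_on f S \<Longrightarrow> finite S"
  using finite_imageD finite_subset by blast

lemma push_Mor:
  assumes "finite T" "f ` S \<subseteq> T" "inj_on f S"
  shows "push S T f \<in> Mor (Mods Q) (Fob V S) (Fob V T)"
  unfolding push_def using functor_Mods_D(2)[OF V _ _ FI_MorI[OF assms]] assms
      finite_inj_dom[OF assms]
  by (simp add: FI_def)

lemma push_hom:
  assumes "finite T" "f ` S \<subseteq> T" "inj_on f S" "r \<in> Ob Q"
  shows "push S T f r \<in> hom (Gr S r) (Gr T r)"
  using Mods_MorD(2)[OF push_Mor[OF assms(1-3)] assms(4)] .

lemma push_closed:
  assumes "finite T" "f ` S \<subseteq> T" "inj_on f S" "r \<in> Ob Q" "x \<in> carrier (Gr S r)"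
  shows "push S T f r x \<in> carrier (Gr T r)"
  using hom_in_carrier[OF push_hom[OF assms(1-4)] assms(5)] .

lemma push_group_hom:
  assumes "finite T" "f ` S \<subseteq> T" "inj_on f S" "r \<in> Ob Q"
  shows "group_hom (Gr S r) (Gr T r) (push S T f r)"
  by (rule hom_group_hom[OF Gr_comm Gr_comm push_hom]) (use assms finite_inj_dom in auto)

lemma push_cong:
  assumes "\<And>x. x \<in> S \<Longrightarrow> f x = g x"
  shows "push S T f = push S T g"
proof -
  have "restrict f S = restrict g S" using assms by (auto simp: fun_eq_iff)
  then show ?thesis by (simp add: push_def)
qed

lemma push_id:
  assumes "finite S" "r \<in> Ob Q" "x \<in> carrier (Gr S r)" "\<And>y. y \<in> S \<Longrightarrow> f y = y"
  shows "push S S f r x = x"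
proof -
  have "push S S f = push S S (\<lambda>y. y)" using assms by (intro push_cong) auto
  then show ?thesis
    using functor_Mods_D(3)[OF V, of S r x] assms by (simp add: push_def FI_def)
qed

lemma push_push:
  assumes "finite T" "f ` S \<subseteq> T" "inj_on f S" "finite W" "g ` T \<subseteq> W" "inj_on g T"
    and r: "r \<in> Ob Q" and x: "x \<in> carrier (Gr S r)"
    and gf: "\<And>y. y \<in> S \<Longrightarrow> g (f y) = h y"
  shows "push T W g r (push S T f r x) = push S W h r x"
proof -
  have "Comp FI S T W (restrict g T) (restrict f S) = restrict h S"
    using assms by (auto simp: FI_def compose_def fun_eq_iff)
  then show ?thesis
    using functor_Mods_D(4)[OF V _ _ _ FI_MorI[OF assms(1-3)] FI_MorI[OF assms(4-6)] r x]
      finite_inj_dom[OF assms(1-3)] assms(1,4)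
    by (simp add: push_def FI_def)
qed

lemma push_act:
  assumes "finite T" "f ` S \<subseteq> T" "inj_on f S" "r \<in> Ob Q" "s \<in> Ob Q" "a \<in> Mor Q r s"
      "x \<in> carrier (Gr S r)"
  shows "push S T f s (act S r s a x) = act T r s a (push S T f r x)"
  using Mods_MorD(4)[OF push_Mor[OF assms(1-3)] assms(4-7)] .

lemma act_hom: "finite S \<Longrightarrow> r \<in> Ob Q \<Longrightarrow> s \<in> Ob Q \<Longrightarrow> a \<in> Mor Q r s
    \<Longrightarrow> act S r s a \<in> hom (Gr S r) (Gr S s)"
  using additive_functorD(2)[OF Q Gr_add] .

section \<open>The sum of V(T) over small subsets and its relations\<close>

definition fam :: "nat \<Rightarrow> 'u set \<Rightarrow> 'u \<Rightarrow> ('u set \<Rightarrow> 'u) set" where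
  "fam d S r = {\<kappa>. \<forall>T\<in>subs d S. \<kappa> T \<in> carrier (Gr T r)}"

definition tot :: "nat \<Rightarrow> 'u set \<Rightarrow> 'u \<Rightarrow> ('u set \<Rightarrow> 'u) \<Rightarrow> 'u" where
  "tot d S r \<kappa> = finprod (Gr S r) (\<lambda>T. push T S (\<lambda>x. x) r (\<kappa> T)) (subs d S)"

text \<open>This is the action of an injection \<open>h\<close> on Q. The summand at a set moves to
  the summand at its image, and sets not contained in the image of \<open>h\<close> receive the
  neutral element. The comprehension is the preimage of \<open>T'\<close>.\<close>

definition pfam :: "'u set \<Rightarrow> ('u \<Rightarrow> 'u) \<Rightarrow> 'u \<Rightarrow> ('u set \<Rightarrow> 'u) \<Rightarrow> 'u set \<Rightarrow> 'u" where
  "pfam S h r \<kappa> T' = (if T' \<subseteq> h ` S then push {x\<in>S. h x \<in> T'} T' h r (\<kappa> {x\<in>S. h x \<in> T'}) else \<one>\<^bsub>Gr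
      T' r\<^esub>)"

lemma pfam_image:
  assumes "inj_on h S" "T \<subseteq> S"
  shows "pfam S h r \<kappa> (h ` T) = push T (h ` T) h r (\<kappa> T)"
proof -
  have "{x\<in>S. h x \<in> h ` T} = T" using assms by (auto simp: inj_on_def)
  then show ?thesis using assms(2) by (auto simp: pfam_def)
qed

lemma pfam_outside: "\<not> T' \<subseteq> h ` S \<Longrightarrow> pfam S h r \<kappa> T' = \<one>\<^bsub>Gr T' r\<^esub>"
  by (simp add: pfam_def)

lemma subs_in_image:
  assumes "finite S" "inj_on h S" "T' \<in> subs d S'" "T' \<subseteq> h ` S"
  shows "\<exists>T\<in>subs d S. T' = h ` T"
proof -
  obtain T where T: "T \<subseteq> S" "T' = h ` T" using assms(4) by (auto simp: subset_image_iff)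
  then have "card T = card T'" using card_image[of h T] assms(2) by (auto simp: inj_on_subset)
  then show ?thesis using T assms(3) by (auto simp: subs_def)
qed

lemma pfam_fam:
  assumes S': "finite S'" and h: "h ` S \<subseteq> S'" "inj_on h S" and r: "r \<in> Ob Q" and \<kappa>: "\<kappa> \<in> fam d S r"
  shows "pfam S h r \<kappa> \<in> fam d S' r"
  unfolding fam_def
proof (intro CollectI ballI)
  fix T' assume T': "T' \<in> subs d S'"
  then have fin: "finite T'" using finite_in_subs S' by blast
  show "pfam S h r \<kappa> T' \<in> carrier (Gr T' r)"
  proof (cases "T' \<subseteq> h ` S")
    case True
    then obtain T where T: "T \<in> subs d S" "T' = h ` T"
      using subs_in_image[OF finite_inj_dom[OF S' h] h(2) T'] by blast
    then have "T \<subseteq> S" by (simp add: subs_def)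
    then show ?thesis
      using T \<kappa> fin push_closed[of "h ` T" h T r "\<kappa> T"] h(2) r
      by (auto simp: pfam_image[OF h(2)] fam_def inj_on_subset)
  next
    case False
    then show ?thesis
      using comm_groupE(2)[OF Gr_comm[OF fin r]] by (simp add: pfam_outside)
  qed
qed

text \<open>The product is reindexed along images under \<open>h\<close>, which keep their size by
  injectivity; all other subsets contribute neutral elements. Leaving \<open>m\<close> and
  \<open>B\<close> general covers both the map from Q to V and arbitrary cocones.\<close>

lemma finprod_pfam:
  assumes B: "comm_group B" and S': "finite S'" and h: "h ` S \<subseteq> S'" "inj_on h S" and r: "r \<in> Ob Q"
    and \<kappa>: "\<kappa> \<in> fam d S r" and m: "\<And>T'. T' \<in> subs d S' \<Longrightarrow> m T' \<in> hom (Gr T' r) B"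
  shows "finprod B (\<lambda>T'. m T' (pfam S h r \<kappa> T')) (subs d S') =
    finprod B (\<lambda>T. m (h ` T) (push T (h ` T) h r (\<kappa> T))) (subs d S)"
proof -
  interpret B: comm_group B by fact
  have S: "finite S" using finite_inj_dom[OF S' h] .
  have cl: "m T' (pfam S h r \<kappa> T') \<in> carrier B" if "T' \<in> subs d S'" for T'
    using hom_in_carrier[OF m[OF that]] pfam_fam[OF S' h r \<kappa>] that by (auto simp: fam_def)
  have im: "(`) h ` subs d S \<subseteq> subs d S'" using subs_image[OF _ h(1) S] by blast
  have inj: "inj_on ((`) h) (subs d S)"
    using inj_on_image_eq_iff[OF h(2)] by (auto simp: inj_on_def subs_def)
  have "finprod B (\<lambda>T'. m T' (pfam S h r \<kappa> T')) (subs d S') =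
      finprod B (\<lambda>T'. m T' (pfam S h r \<kappa> T')) ((`) h ` subs d S)"
  proof (rule B.finprod_mono_neutral_cong_right[OF finite_subs[OF S'] im])
    fix T' assume T': "T' \<in> subs d S' - (`) h ` subs d S"
    then have "\<not> T' \<subseteq> h ` S" using subs_in_image[OF S h(2), of T' d S'] by blast
    moreover have "finite T'" using T' finite_in_subs[OF S'] by blast
    ultimately show "m T' (pfam S h r \<kappa> T') = \<one>\<^bsub>B\<^esub>"
      using group_hom.hom_one[OF hom_group_hom[OF Gr_comm[OF _ r] B m]] T'
          by (simp add: pfam_outside)
  qed (use cl in auto)
  also have "\<dots> = finprod B (\<lambda>T. m (h ` T) (pfam S h r \<kappa> (h ` T))) (subs d S)"
    by (rule B.finprod_reindex) (use cl im inj in auto)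
  also have "\<dots> = finprod B (\<lambda>T. m (h ` T) (push T (h ` T) h r (\<kappa> T))) (subs d S)"
    by (rule B.finprod_cong'[OF refl])
      (use cl im pfam_image[OF h(2), of _ r \<kappa>, symmetric] in \<open>auto simp: subs_def image_subset_iff\<close>)
  finally show ?thesis .
qed

definition ker :: "nat \<Rightarrow> 'u set \<Rightarrow> 'u \<Rightarrow> ('u set \<Rightarrow> 'u) set" where
  "ker d S r = {\<kappa> \<in> fam d S r. tot d S r \<kappa> = \<one>\<^bsub>Gr S r\<^esub>}"

text \<open>The families \<open>good N d S r\<close> are those that vanish in the colimit of the groups \<open>V(T)(r)\<close> over
  \<open>T \<subseteq> S\<close>, \<open>|T| \<le> N\<close>.\<close>

definition cocn :: "nat \<Rightarrow> 'u set \<Rightarrow> 'u \<Rightarrow> 'u monoid \<Rightarrow> ('u set \<Rightarrow> 'u \<Rightarrow> 'u) \<Rightarrow> bool" where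
  "cocn N S r B m \<longleftrightarrow> comm_group B \<and> (\<forall>T\<in>subs N S. m T \<in> hom (Gr T r) B) \<and>
     (\<forall>T\<in>subs N S. \<forall>T'\<subseteq>T. \<forall>x\<in>carrier (Gr T' r). m T (push T' T (\<lambda>x. x) r x) = m T' x)"

lemma cocnD:
  assumes "cocn N S r B m"
  shows "comm_group B" and "T \<in> subs N S \<Longrightarrow> m T \<in> hom (Gr T r) B"
    and "T \<in> subs N S \<Longrightarrow> T' \<subseteq> T \<Longrightarrow> x \<in> carrier (Gr T' r) \<Longrightarrow> m T (push T' T (\<lambda>x. x) r x) = m T' x"
  using assms by (simp_all add: cocn_def)

definition good :: "nat \<Rightarrow> nat \<Rightarrow> 'u set \<Rightarrow> 'u \<Rightarrow> ('u set \<Rightarrow> 'u) \<Rightarrow> bool" where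
  "good N d S r \<kappa> \<longleftrightarrow> (\<forall>B m. cocn N S r B m \<longrightarrow> finprod B (\<lambda>T. m T (\<kappa> T)) (subs d S) = \<one>\<^bsub>B\<^esub>)"

lemma subs_mono: "d \<le> N \<Longrightarrow> T \<in> subs d S \<Longrightarrow> T \<in> subs N S"
  by (simp add: subs_def)

lemma subs_subset: "finite S \<Longrightarrow> T \<in> subs N S \<Longrightarrow> T' \<subseteq> T \<Longrightarrow> T' \<in> subs N S"
  using card_mono[OF finite_in_subs, of S T N T'] by (auto simp: subs_def)

text \<open>Images under \<open>h\<close> have at most as many elements, so a cocone on the small
  subsets of \<open>S'\<close> restricts along \<open>h\<close> to one on those of \<open>S\<close>.
  This makes goodness stable under pushing forward.\<close>

lemma cocn_pull:
  assumes c: "cocn N S' r B m" and S': "finite S'" and h: "h ` S \<subseteq> S'" "inj_on h S"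
      and r: "r \<in> Ob Q"
  shows "cocn N S r B (\<lambda>T x. m (h ` T) (push T (h ` T) h r x))"
proof -
  have S: "finite S" using finite_inj_dom[OF S' h] .
  have fin: "finite T" "inj_on h T" "h ` T \<in> subs N S'" if "T \<in> subs N S" for T
  proof -
    show "finite T" "h ` T \<in> subs N S'" using finite_in_subs[OF S that] subs_image[OF that h(1) S] .
    have "T \<subseteq> S" using that by (simp add: subs_def)
    then show "inj_on h T" by (rule inj_on_subset[OF h(2)])
  qed
  have hom: "(\<lambda>x. m (h ` T) (push T (h ` T) h r x)) \<in> hom (Gr T r) B" if "T \<in> subs N S" for T
    using hom_compose[OF push_hom[of "h ` T" h T r] , of "m (h ` T)" B] fin[OF that] c r
    by (auto simp: cocn_def o_def)
  have "m (h ` T) (push T (h ` T) h r (push T' T (\<lambda>x. x) r x))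
      = m (h ` T') (push T' (h ` T') h r x)"
    if T: "T \<in> subs N S" and T': "T' \<subseteq> T" and x: "x \<in> carrier (Gr T' r)" for T T' x
  proof -
    have f: "finite T" "inj_on h T" "finite T'" "inj_on h T'"
      using fin[OF T] fin[OF subs_subset[OF S T T']] by auto
    have "push T (h ` T) h r (push T' T (\<lambda>x. x) r x) = push T' (h ` T) h r x"
      using f T' r x by (intro push_push) auto
    also have "\<dots> = push (h ` T') (h ` T) (\<lambda>x. x) r (push T' (h ` T') h r x)"
      using f T' r x by (intro push_push[symmetric]) auto
    finally have eq: "push T (h ` T) h r (push T' T (\<lambda>x. x) r x) = \<dots>" .
    have "push T' (h ` T') h r x \<in> carrier (Gr (h ` T') r)"
      using f r x by (intro push_closed) auto
    then show ?thesis unfolding eq using cocnD(3)[OF c fin(3)[OF T]] T' by blast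
  qed
  then show ?thesis using cocnD(1)[OF c] hom unfolding cocn_def by (intro conjI ballI allI impI)
qed

lemma good_push:
  assumes g: "good N d S r \<kappa>" and dN: "d \<le> N" and S': "finite S'" and h: "h ` S \<subseteq> S'" "inj_on h S"
    and r: "r \<in> Ob Q" and \<kappa>: "\<kappa> \<in> fam d S r"
  shows "good N d S' r (pfam S h r \<kappa>)"
  unfolding good_def
proof (intro allI impI)
  fix B :: "'u monoid" and m assume c: "cocn N S' r B m"
  have B: "comm_group B" and m: "m T \<in> hom (Gr T r) B" if "T \<in> subs d S'" for T
    using c that subs_mono[OF dN] by (auto simp: cocn_def)
  have B: "comm_group B" using c by (simp add: cocn_def)
  show "finprod B (\<lambda>T. m T (pfam S h r \<kappa> T)) (subs d S') = \<one>\<^bsub>B\<^esub>"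
    using finprod_pfam[OF B S' h r \<kappa>, of m] m
        g[unfolded good_def, rule_format, OF cocn_pull[OF c S' h r]]
    by simp
qed

text \<open>A cocone on \<open>S\<close> is transported to \<open>S'\<close> along the inverse of
  the bijection \<open>h\<close>, and pushing there and back changes nothing. A bad relation on any
  finite set can thereby be moved to a standard one.\<close>

lemma good_reflect:
  assumes g: "good N d S' r (pfam S h r \<kappa>)" and dN: "d \<le> N" and S': "finite S'"
      and h: "h ` S = S'" "inj_on h S"
    and r: "r \<in> Ob Q" and \<kappa>: "\<kappa> \<in> fam d S r"
  shows "good N d S r \<kappa>"
  unfolding good_def
proof (intro allI impI)
  fix B :: "'u monoid" and m assume c: "cocn N S r B m"
  have hS: "h ` S \<subseteq> S'" using h by simp
  have S: "finite S" using finite_inj_dom[OF S' hS h(2)] .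
  define k where "k = the_inv_into S h"
  have k: "k ` S' \<subseteq> S" "inj_on k S'" "\<And>x. x \<in> S \<Longrightarrow> k (h x) = x"
    using h the_inv_into_into[OF h(2)] inj_on_the_inv_into[OF h(2)] the_inv_into_f_f[OF h(2)]
        by (auto simp: k_def)
  let ?m = "\<lambda>T x. m (k ` T) (push T (k ` T) k r x)"
  have c': "cocn N S' r B ?m" by (rule cocn_pull[OF c S k(1,2) r])
  have B: "comm_group B" using c by (simp add: cocn_def)
  interpret B: comm_group B by fact
  have m: "m T \<in> hom (Gr T r) B" if "T \<in> subs d S" for T
    using c that subs_mono[OF dN] by (auto simp: cocn_def)
  have m': "?m T \<in> hom (Gr T r) B" if "T \<in> subs d S'" for T
    using c' that subs_mono[OF dN] by (auto simp: cocn_def)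
  have mk: "m T (\<kappa> T) \<in> carrier B" if "T \<in> subs d S" for T
    using hom_in_carrier[OF m[OF that]] \<kappa> that by (simp add: fam_def)
  have "finprod B (\<lambda>T. m T (\<kappa> T)) (subs d S)
      = finprod B (\<lambda>T. ?m (h ` T) (push T (h ` T) h r (\<kappa> T))) (subs d S)"
  proof (rule B.finprod_cong'[OF refl])
    show eq: "m T (\<kappa> T) = ?m (h ` T) (push T (h ` T) h r (\<kappa> T))" if T: "T \<in> subs d S" for T
    proof -
      note TS = subsD[OF T] finite_in_subs[OF S T]
      have kh: "k ` h ` T = T" unfolding image_image using k(3) TS(1)
          by (intro image_cong[of T T _ "\<lambda>x. x", simplified]) auto
      have \<kappa>T: "\<kappa> T \<in> carrier (Gr T r)" using \<kappa> T by (simp add: fam_def)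
      have "push (h ` T) T k r (push T (h ` T) h r (\<kappa> T)) = push T T (\<lambda>x. x) r (\<kappa> T)"
      proof (rule push_push)
        have "h ` T \<subseteq> S'" using TS(1) h(1) by blast
        then show "inj_on k (h ` T)" by (rule inj_on_subset[OF k(2)])
        show "inj_on h T" by (rule inj_on_subset[OF h(2) TS(1)])
      qed (use TS kh k(3) r \<kappa>T in auto)
      also have "\<dots> = \<kappa> T" using push_id[OF TS(2) r \<kappa>T] by simp
      finally show ?thesis using kh by simp
    qed
    show "(\<lambda>T. ?m (h ` T) (push T (h ` T) h r (\<kappa> T))) \<in> subs d S \<rightarrow> carrier B"
      using mk eq by auto
  qed
  also have "\<dots> = finprod B (\<lambda>T'. ?m T' (pfam S h r \<kappa> T')) (subs d S')"
    using finprod_pfam[OF B S' hS h(2) r \<kappa>, of ?m] m' by simp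
  also have "\<dots> = \<one>\<^bsub>B\<^esub>" using g c' unfolding good_def by blast
  finally show "finprod B (\<lambda>T. m T (\<kappa> T)) (subs d S) = \<one>\<^bsub>B\<^esub>" .
qed

lemma push_incl_hom: "finite S \<Longrightarrow> T \<in> subs d S \<Longrightarrow> r \<in> Ob Q
    \<Longrightarrow> push T S (\<lambda>x. x) r \<in> hom (Gr T r) (Gr S r)"
  by (rule push_hom) (auto simp: subs_def)

lemma incl_closed:
  assumes "finite S" "T \<in> subs d S" "r \<in> Ob Q" "\<kappa> \<in> fam d S r"
  shows "push T S (\<lambda>x. x) r (\<kappa> T) \<in> carrier (Gr S r)"
  using hom_in_carrier[OF push_incl_hom[OF assms(1-3)]] assms(2,4) by (simp add: fam_def)

text \<open>Naturality of the map from Q to V, which holds on each summand by functoriality of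
  \<open>V\<close>. Consequently injections preserve its kernel.\<close>

lemma tot_pfam:
  assumes S': "finite S'" and h: "h ` S \<subseteq> S'" "inj_on h S" and r: "r \<in> Ob Q" and \<kappa>: "\<kappa> \<in> fam d S r"
  shows "tot d S' r (pfam S h r \<kappa>) = push S S' h r (tot d S r \<kappa>)"
proof -
  have S: "finite S" using finite_inj_dom[OF S' h] .
  interpret S': comm_group "Gr S' r" using Gr_comm[OF S' r] .
  have \<kappa>T: "\<kappa> T \<in> carrier (Gr T r)" if "T \<in> subs d S" for T using \<kappa> that by (simp add: fam_def)
  have "tot d S' r (pfam S h r \<kappa>) = finprod (Gr S' r)
      (\<lambda>T. push (h ` T) S' (\<lambda>x. x) r (push T (h ` T) h r (\<kappa> T))) (subs d S)"
    unfolding tot_def by (rule finprod_pfam[OF Gr_comm[OF S' r] S' h r \<kappa> push_incl_hom[OF S' _ r]])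
  also have "\<dots> = finprod (Gr S' r) (\<lambda>T. push S S' h r (push T S (\<lambda>x. x) r (\<kappa> T))) (subs d S)"
  proof (rule S'.finprod_cong'[OF refl])
    fix T assume T: "T \<in> subs d S"
    note TS = subsD[OF T] finite_in_subs[OF S T]
    have hT: "inj_on h T" "h ` T \<subseteq> S'" using TS h by (auto simp: inj_on_subset)
    have "push (h ` T) S' (\<lambda>x. x) r (push T (h ` T) h r (\<kappa> T)) = push T S' h r (\<kappa> T)"
      by (rule push_push) (use TS hT S' r \<kappa>T[OF T] in auto)
    also have "\<dots> = push S S' h r (push T S (\<lambda>x. x) r (\<kappa> T))"
      by (rule push_push[symmetric]) (use TS hT h S S' r \<kappa>T[OF T] in auto)
    finally show "push (h ` T) S' (\<lambda>x. x) r (push T (h ` T) h r (\<kappa> T))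
        = push S S' h r (push T S (\<lambda>x. x) r (\<kappa> T))" .
  next
    show "(\<lambda>T. push S S' h r (push T S (\<lambda>x. x) r (\<kappa> T))) \<in> subs d S \<rightarrow> carrier (Gr S' r)"
      using push_closed[OF S' h r incl_closed[OF S _ r \<kappa>]] by simp
  qed
  also have "\<dots> = push S S' h r (tot d S r \<kappa>)"
    unfolding tot_def
    by (rule hom_finprod[symmetric, OF Gr_comm[OF S r] Gr_comm[OF S' r] push_hom[OF S' h r]])
      (simp add: incl_closed[OF S _ r \<kappa>])
  finally show ?thesis .
qed

lemma ker_pfam:
  assumes S': "finite S'" and h: "h ` S \<subseteq> S'" "inj_on h S" and r: "r \<in> Ob Q" and \<kappa>: "\<kappa> \<in> ker d S r"
  shows "pfam S h r \<kappa> \<in> ker d S' r"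
  using \<kappa> pfam_fam[OF S' h r] tot_pfam[OF S' h r] group_hom.hom_one[OF push_group_hom[OF S' h r]]
  by (auto simp: ker_def)

text \<open>A set with at most \<open>N\<close> elements is the largest member of its own diagram,
  so every cocone factors through the component \<open>m S\<close>.\<close>

lemma finprod_cocn_eq:
  assumes c: "cocn N S r B m" and S: "finite S" and r: "r \<in> Ob Q" and dN: "d \<le> N"
      and SN: "card S \<le> N"
    and \<kappa>: "\<kappa> \<in> fam d S r"
  shows "finprod B (\<lambda>T. m T (\<kappa> T)) (subs d S) = m S (tot d S r \<kappa>)"
proof -
  have B: "comm_group B" using c by (simp add: cocn_def)
  interpret B: comm_group B by fact
  have SS: "S \<in> subs N S" using SN by (simp add: subs_def)
  then have mS: "m S \<in> hom (Gr S r) B" using c by (simp add: cocn_def)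
  have \<kappa>T: "\<kappa> T \<in> carrier (Gr T r)" if "T \<in> subs d S" for T using \<kappa> that by (simp add: fam_def)
  have "finprod B (\<lambda>T. m T (\<kappa> T)) (subs d S)
      = finprod B (\<lambda>T. m S (push T S (\<lambda>x. x) r (\<kappa> T))) (subs d S)"
  proof (rule B.finprod_cong'[OF refl])
    fix T assume T: "T \<in> subs d S"
    then have "T \<subseteq> S" by (simp add: subs_def)
    then show "m T (\<kappa> T) = m S (push T S (\<lambda>x. x) r (\<kappa> T))"
      using cocnD(3)[OF c SS _ \<kappa>T[OF T]] by simp
  next
    show "(\<lambda>T. m S (push T S (\<lambda>x. x) r (\<kappa> T))) \<in> subs d S \<rightarrow> carrier B"
      using hom_in_carrier[OF mS incl_closed[OF S _ r \<kappa>]] by simp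
  qed
  also have "\<dots> = m S (tot d S r \<kappa>)"
    unfolding tot_def
    by (rule hom_finprod[symmetric, OF Gr_comm[OF S r] B mS]) (simp add: incl_closed[OF S _ r \<kappa>])
  finally show ?thesis .
qed

lemma small_good:
  assumes S: "finite S" and r: "r \<in> Ob Q" and dN: "d \<le> N" and SN: "card S \<le> N"
      and \<kappa>: "\<kappa> \<in> ker d S r"
  shows "good N d S r \<kappa>"
  unfolding good_def
proof (intro allI impI)
  fix B :: "'u monoid" and m assume c: "cocn N S r B m"
  have "S \<in> subs N S" using SN by (simp add: subs_def)
  then have "m S \<in> hom (Gr S r) B" "comm_group B" using cocnD(1,2)[OF c] by auto
  then show "finprod B (\<lambda>T. m T (\<kappa> T)) (subs d S) = \<one>\<^bsub>B\<^esub>"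
    using finprod_cocn_eq[OF c S r dN SN] \<kappa> group_hom.hom_one[OF hom_group_hom[OF Gr_comm[OF S r]]]
    by (auto simp: ker_def)
qed

section \<open>Componentwise operations on families and relations\<close>

lemma famD: "\<kappa> \<in> fam d S r \<Longrightarrow> T \<in> subs d S \<Longrightarrow> \<kappa> T \<in> carrier (Gr T r)"
  by (simp add: fam_def)

lemma fam_mult:
  assumes S: "finite S" and r: "r \<in> Ob Q" and k: "\<kappa> \<in> fam d S r" "\<kappa>' \<in> fam d S r"
  shows "(\<lambda>T. \<kappa> T \<otimes>\<^bsub>Gr T r\<^esub> \<kappa>' T) \<in> fam d S r"
    and "tot d S r (\<lambda>T. \<kappa> T \<otimes>\<^bsub>Gr T r\<^esub> \<kappa>' T) = tot d S r \<kappa> \<otimes>\<^bsub>Gr S r\<^esub> tot d S r \<kappa>'"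
proof -
  show "(\<lambda>T. \<kappa> T \<otimes>\<^bsub>Gr T r\<^esub> \<kappa>' T) \<in> fam d S r"
    unfolding fam_def
    using comm_groupE(1)[OF Gr_comm[OF finite_in_subs[OF S] r] famD[OF k(1)] famD[OF k(2)]] by simp
  interpret comm_group "Gr S r" using Gr_comm[OF S r] .
  have "tot d S r (\<lambda>T. \<kappa> T \<otimes>\<^bsub>Gr T r\<^esub> \<kappa>' T) =
      finprod (Gr S r) (\<lambda>T. push T S (\<lambda>x. x) r (\<kappa> T) \<otimes>\<^bsub>Gr S r\<^esub> push T S (\<lambda>x. x) r (\<kappa>' T))
          (subs d S)"
    unfolding tot_def
  proof (rule finprod_cong'[OF refl])
    show "(\<lambda>T. push T S (\<lambda>x. x) r (\<kappa> T) \<otimes>\<^bsub>Gr S r\<^esub> push T S (\<lambda>x. x) r (\<kappa>' T)) \<in> subs d S \<rightarrow> carrier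
        (Gr S r)"
      using incl_closed[OF S _ r k(1)] incl_closed[OF S _ r k(2)] by simp
    fix T assume T: "T \<in> subs d S"
    show "push T S (\<lambda>x. x) r (\<kappa> T \<otimes>\<^bsub>Gr T r\<^esub> \<kappa>' T) =
        push T S (\<lambda>x. x) r (\<kappa> T) \<otimes>\<^bsub>Gr S r\<^esub> push T S (\<lambda>x. x) r (\<kappa>' T)"
      using hom_mult[OF push_incl_hom[OF S T r]] famD[OF k(1) T] famD[OF k(2) T] by simp
  qed
  also have "\<dots> = tot d S r \<kappa> \<otimes>\<^bsub>Gr S r\<^esub> tot d S r \<kappa>'"
    unfolding tot_def
    by (rule finprod_multf) (simp_all add: incl_closed[OF S _ r k(1)] incl_closed[OF S _ r k(2)])
  finally show "tot d S r (\<lambda>T. \<kappa> T \<otimes>\<^bsub>Gr T r\<^esub> \<kappa>' T) = tot d S r \<kappa> \<otimes>\<^bsub>Gr S r\<^esub> tot d S r \<kappa>'" .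
qed

lemma fam_one:
  assumes S: "finite S" and r: "r \<in> Ob Q" and k: "\<And>T. T \<in> subs d S \<Longrightarrow> \<kappa> T = \<one>\<^bsub>Gr T r\<^esub>"
  shows "\<kappa> \<in> fam d S r" and "tot d S r \<kappa> = \<one>\<^bsub>Gr S r\<^esub>" and "d \<le> N \<Longrightarrow> good N d S r \<kappa>"
proof -
  show "\<kappa> \<in> fam d S r"
    using comm_groupE(2)[OF Gr_comm[OF finite_in_subs[OF S] r]] k by (simp add: fam_def)
  have "push T S (\<lambda>x. x) r (\<kappa> T) = \<one>\<^bsub>Gr S r\<^esub>" if "T \<in> subs d S" for T
    using group_hom.hom_one[OF hom_group_hom[OF Gr_comm[OF finite_in_subs[OF S that] r]
        Gr_comm[OF S r]
        push_incl_hom[OF S that r]]] k[OF that] by simp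
  then show "tot d S r \<kappa> = \<one>\<^bsub>Gr S r\<^esub>"
    unfolding tot_def
    by (rule comm_monoid.finprod_one_eqI[OF comm_group.axioms(1)[OF Gr_comm[OF S r]]])
  assume dN: "d \<le> N"
  show "good N d S r \<kappa>"
    unfolding good_def
  proof (intro allI impI)
    fix B :: "'u monoid" and m assume c: "cocn N S r B m"
    note D = cocnD[OF c]
    have "m T (\<kappa> T) = \<one>\<^bsub>B\<^esub>" if T: "T \<in> subs d S" for T
      using group_hom.hom_one[OF hom_group_hom[OF Gr_comm[OF finite_in_subs[OF S T] r] D(1)
        D(2)[OF subs_mono[OF dN T]]]] k[OF T] by simp
    then show "finprod B (\<lambda>T. m T (\<kappa> T)) (subs d S) = \<one>\<^bsub>B\<^esub>"
      by (rule comm_monoid.finprod_one_eqI[OF comm_group.axioms(1)[OF D(1)]])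
  qed
qed

lemma finprod_cocn_mult:
  assumes c: "cocn N S r B m" and dN: "d \<le> N" and k: "\<kappa> \<in> fam d S r" "\<kappa>' \<in> fam d S r"
  shows "finprod B (\<lambda>T. m T (\<kappa> T \<otimes>\<^bsub>Gr T r\<^esub> \<kappa>' T)) (subs d S) =
    finprod B (\<lambda>T. m T (\<kappa> T)) (subs d S) \<otimes>\<^bsub>B\<^esub> finprod B (\<lambda>T. m T (\<kappa>' T)) (subs d S)"
proof -
  interpret B: comm_group B using cocnD(1)[OF c] .
  have m: "m T \<in> hom (Gr T r) B" if "T \<in> subs d S" for T
    using cocnD(2)[OF c subs_mono[OF dN that]] .
  have cl: "m T (\<kappa> T) \<in> carrier B" "m T (\<kappa>' T) \<in> carrier B" if "T \<in> subs d S" for T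
    using hom_in_carrier[OF m[OF that]] famD[OF k(1) that] famD[OF k(2) that] by auto
  have "finprod B (\<lambda>T. m T (\<kappa> T \<otimes>\<^bsub>Gr T r\<^esub> \<kappa>' T)) (subs d S) =
      finprod B (\<lambda>T. m T (\<kappa> T) \<otimes>\<^bsub>B\<^esub> m T (\<kappa>' T)) (subs d S)"
    by (rule B.finprod_cong'[OF refl]) (simp_all add: cl hom_mult[OF m] famD[OF k(1)] famD[OF k(2)])
  also have "\<dots> = finprod B (\<lambda>T. m T (\<kappa> T)) (subs d S) \<otimes>\<^bsub>B\<^esub> finprod B (\<lambda>T. m T (\<kappa>' T)) (subs d S)"
    by (rule B.finprod_multf) (simp_all add: cl)
  finally show ?thesis .
qed

lemma finprod_cocn_closed:
  assumes c: "cocn N S r B m" and dN: "d \<le> N" and k: "\<kappa> \<in> fam d S r"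
  shows "finprod B (\<lambda>T. m T (\<kappa> T)) (subs d S) \<in> carrier B"
proof -
  interpret B: comm_group B using cocnD(1)[OF c] .
  show ?thesis
    by (rule B.finprod_closed) (simp add:
        hom_in_carrier[OF cocnD(2)[OF c subs_mono[OF dN]] famD[OF k]])
qed

lemma good_mult:
  assumes dN: "d \<le> N" and k: "\<kappa> \<in> fam d S r" "\<kappa>' \<in> fam d S r"
    and g: "good N d S r \<kappa>" "good N d S r \<kappa>'"
  shows "good N d S r (\<lambda>T. \<kappa> T \<otimes>\<^bsub>Gr T r\<^esub> \<kappa>' T)"
  unfolding good_def
proof (intro allI impI)
  fix B :: "'u monoid" and m assume c: "cocn N S r B m"
  interpret B: comm_group B using cocnD(1)[OF c] .
  show "finprod B (\<lambda>T. m T (\<kappa> T \<otimes>\<^bsub>Gr T r\<^esub> \<kappa>' T)) (subs d S) = \<one>\<^bsub>B\<^esub>"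
    using finprod_cocn_mult[OF c dN k] g c by (simp add: good_def)
qed

text \<open>Families are functions on all sets, with arbitrary values outside
  \<open>subs d S\<close>; only their values on that set can be compared.\<close>

lemma good_cong:
  assumes dN: "d \<le> N" and k: "\<kappa> \<in> fam d S r"
    and eq: "\<And>T. T \<in> subs d S \<Longrightarrow> \<kappa>' T = \<kappa> T" and g: "good N d S r \<kappa>"
  shows "good N d S r \<kappa>'"
  unfolding good_def
proof (intro allI impI)
  fix B :: "'u monoid" and m assume c: "cocn N S r B m"
  interpret B: comm_group B using cocnD(1)[OF c] .
  have "finprod B (\<lambda>T. m T (\<kappa>' T)) (subs d S) = finprod B (\<lambda>T. m T (\<kappa> T)) (subs d S)"
    by (rule B.finprod_cong'[OF refl])
      (simp_all add: eq hom_in_carrier[OF cocnD(2)[OF c subs_mono[OF dN]] famD[OF k]])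
  then show "finprod B (\<lambda>T. m T (\<kappa>' T)) (subs d S) = \<one>\<^bsub>B\<^esub>" using g c by (simp add: good_def)
qed

lemma fam_inv:
  assumes S: "finite S" and r: "r \<in> Ob Q" and k: "\<kappa> \<in> fam d S r"
  shows "(\<lambda>T. inv\<^bsub>Gr T r\<^esub> \<kappa> T) \<in> fam d S r"
    and "tot d S r (\<lambda>T. inv\<^bsub>Gr T r\<^esub> \<kappa> T) = inv\<^bsub>Gr S r\<^esub> tot d S r \<kappa>"
proof -
  have gT: "group (Gr T r)" if "T \<in> subs d S" for T
    using Gr_comm[OF finite_in_subs[OF S that] r] by (rule comm_group.axioms(2))
  show i: "(\<lambda>T. inv\<^bsub>Gr T r\<^esub> \<kappa> T) \<in> fam d S r"
    unfolding fam_def using group.inv_closed[OF gT famD[OF k]] by simp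
  interpret comm_group "Gr S r" using Gr_comm[OF S r] .
  have cl: "tot d S r \<mu> \<in> carrier (Gr S r)" if "\<mu> \<in> fam d S r" for \<mu>
    unfolding tot_def by (rule finprod_closed) (simp add: incl_closed[OF S _ r that])
  have "tot d S r (\<lambda>T. inv\<^bsub>Gr T r\<^esub> \<kappa> T) \<otimes>\<^bsub>Gr S r\<^esub> tot d S r \<kappa> = \<one>\<^bsub>Gr S r\<^esub>"
    unfolding fam_mult(2)[OF S r i k, symmetric]
    by (rule fam_one(2)[OF S r]) (rule group.l_inv[OF gT famD[OF k]])
  then show "tot d S r (\<lambda>T. inv\<^bsub>Gr T r\<^esub> \<kappa> T) = inv\<^bsub>Gr S r\<^esub> tot d S r \<kappa>"
    using inv_equality cl[OF i] cl[OF k] by simp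
qed

lemma tot_closed:
  assumes S: "finite S" and r: "r \<in> Ob Q" and k: "\<kappa> \<in> fam d S r"
  shows "tot d S r \<kappa> \<in> carrier (Gr S r)"
proof -
  interpret comm_group "Gr S r" using Gr_comm[OF S r] .
  show ?thesis
    unfolding tot_def by (rule finprod_closed) (simp add: incl_closed[OF S _ r k])
qed

lemma fam_act:
  assumes S: "finite S" and r: "r \<in> Ob Q" and s: "s \<in> Ob Q" and a: "a \<in> Mor Q r s"
      and k: "\<kappa> \<in> fam d S r"
  shows "(\<lambda>T. act T r s a (\<kappa> T)) \<in> fam d S s"
    and "tot d S s (\<lambda>T. act T r s a (\<kappa> T)) = act S r s a (tot d S r \<kappa>)"
proof -
  have cl: "act T r s a (\<kappa> T) \<in> carrier (Gr T s)" if "T \<in> subs d S" for T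
    using hom_in_carrier[OF act_hom[OF finite_in_subs[OF S that] r s a] famD[OF k that]] .
  then show f: "(\<lambda>T. act T r s a (\<kappa> T)) \<in> fam d S s" by (simp add: fam_def)
  interpret comm_group "Gr S s" using Gr_comm[OF S s] .
  have "tot d S s (\<lambda>T. act T r s a (\<kappa> T)) =
      finprod (Gr S s) (\<lambda>T. act S r s a (push T S (\<lambda>x. x) r (\<kappa> T))) (subs d S)"
    unfolding tot_def
  proof (rule finprod_cong'[OF refl])
    show "(\<lambda>T. act S r s a (push T S (\<lambda>x. x) r (\<kappa> T))) \<in> subs d S \<rightarrow> carrier (Gr S s)"
      using hom_in_carrier[OF act_hom[OF S r s a] incl_closed[OF S _ r k]] by simp
    fix T assume T: "T \<in> subs d S"
    show "push T S (\<lambda>x. x) s (act T r s a (\<kappa> T)) = act S r s a (push T S (\<lambda>x. x) r (\<kappa> T))"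
      by (rule push_act[OF S _ _ r s a famD[OF k T]]) (use subsD[OF T] in auto)
  qed
  also have "\<dots> = act S r s a (tot d S r \<kappa>)"
    unfolding tot_def
    by (rule hom_finprod[symmetric, OF Gr_comm[OF S r] Gr_comm[OF S s] act_hom[OF S r s a]])
      (simp add: incl_closed[OF S _ r k])
  finally show "tot d S s (\<lambda>T. act T r s a (\<kappa> T)) = act S r s a (tot d S r \<kappa>)" .
qed

lemma
  assumes S: "finite S" and r: "r \<in> Ob Q" and k: "\<kappa> \<in> ker d S r"
  shows ker_mult: "\<kappa>' \<in> ker d S r \<Longrightarrow> (\<lambda>T. \<kappa> T \<otimes>\<^bsub>Gr T r\<^esub> \<kappa>' T) \<in> ker d S r"
    and ker_inv: "(\<lambda>T. inv\<^bsub>Gr T r\<^esub> \<kappa> T) \<in> ker d S r"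
    and ker_act: "s \<in> Ob Q \<Longrightarrow> a \<in> Mor Q r s \<Longrightarrow> (\<lambda>T. act T r s a (\<kappa> T)) \<in> ker d S s"
proof -
  interpret comm_group "Gr S r" using Gr_comm[OF S r] .
  have k': "\<kappa> \<in> fam d S r" "tot d S r \<kappa> = \<one>\<^bsub>Gr S r\<^esub>" using k by (auto simp: ker_def)
  show "\<kappa>' \<in> ker d S r \<Longrightarrow> (\<lambda>T. \<kappa> T \<otimes>\<^bsub>Gr T r\<^esub> \<kappa>' T) \<in> ker d S r"
    using fam_mult[OF S r k'(1), of \<kappa>'] k'(2) by (simp add: ker_def)
  show "(\<lambda>T. inv\<^bsub>Gr T r\<^esub> \<kappa> T) \<in> ker d S r"
    using fam_inv[OF S r k'(1)] k'(2) by (simp add: ker_def)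
  show "(\<lambda>T. act T r s a (\<kappa> T)) \<in> ker d S s" if "s \<in> Ob Q" "a \<in> Mor Q r s"
    using fam_act[OF S r that k'(1)] k'(2)
      group_hom.hom_one[OF hom_group_hom[OF Gr_comm[OF S r] Gr_comm[OF S that(1)]
          act_hom[OF S r that]]]
    by (simp add: ker_def)
qed

text \<open>\<open>T\<close> is the leading set and \<open>W\<close> contains the sets above it. Leading coefficients at different
  sets \<open>T\<close> are compared in the fixed module \<open>V(S0)\<close> along bijections \<open>f : S0 \<rightarrow> T\<close>.\<close>

definition lead :: "nat \<Rightarrow> 'u set \<Rightarrow> 'u set \<Rightarrow> 'u set set \<Rightarrow> 'u set \<Rightarrow> ('u \<Rightarrow> 'u) \<Rightarrow> 'u \<Rightarrow> 'u set" where
  "lead d S T W S0 f s = {x \<in> carrier (Gr S0 s). \<exists>\<kappa>\<in>ker d S s. (\<forall>B\<in>W. \<kappa> B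
      = \<one>\<^bsub>Gr B s\<^esub>) \<and> push S0 T f s x = \<kappa> T}"

text \<open>Lying in the kernel, vanishing on \<open>W\<close> and having a prescribed coefficient
  at \<open>T\<close> are all compatible with products, inverses and the module action, so the
  witnessing relations are combined componentwise.\<close>

lemma submod_lead:
  assumes S: "finite S" and T: "T \<in> subs d S" and f: "f ` S0 \<subseteq> T" "inj_on f S0"
      and W: "W \<subseteq> subs d S"
  shows "submod Q (Fob V S0) (lead d S T W S0 f)"
proof -
  note finT = finite_in_subs[OF S T]
  note S0 = finite_inj_dom[OF finT f]
  have finB: "finite B" if "B \<in> W" for B using finite_in_subs[OF S] W that by blast
  show ?thesis
  proof (rule submodI[OF Q Gr_add[OF S0]])
    fix s x assume s: "s \<in> Ob Q" and x: "x \<in> lead d S T W S0 f s"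
    show xc: "x \<in> carrier (Gr S0 s)" using x by (simp add: lead_def)
    obtain \<kappa> where \<kappa>: "\<kappa> \<in> ker d S s" "\<forall>B\<in>W. \<kappa> B = \<one>\<^bsub>Gr B s\<^esub>" "push S0 T f s x = \<kappa> T"
      using x by (auto simp: lead_def)
    interpret G0: comm_group "Gr S0 s" using Gr_comm[OF S0 s] .
    interpret p: group_hom "Gr S0 s" "Gr T s" "push S0 T f s" using push_group_hom[OF finT f s] .
    have gB: "group (Gr B s)" if "B \<in> W" for B
      using Gr_comm[OF finB[OF that] s] by (rule comm_group.axioms(2))
    show "inv\<^bsub>Gr S0 s\<^esub> x \<in> lead d S T W S0 f s"
      unfolding lead_def
    proof (intro CollectI conjI bexI[of _ "\<lambda>T. inv\<^bsub>Gr T s\<^esub> \<kappa> T"] ballI)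
      show "inv\<^bsub>Gr B s\<^esub> \<kappa> B = \<one>\<^bsub>Gr B s\<^esub>" if "B \<in> W" for B
        using \<kappa>(2) that group.is_monoid[OF gB[OF that]] by (simp add: monoid.inv_one)
    qed (use xc \<kappa>(3) ker_inv[OF S s \<kappa>(1)] in simp_all)
    show "Fmor (Fob V S0) s r a x \<in> lead d S T W S0 f r" if r: "r \<in> Ob Q" and a: "a \<in> Mor Q s r"
        for r a
      unfolding lead_def
    proof (intro CollectI conjI bexI[of _ "\<lambda>T. act T s r a (\<kappa> T)"] ballI)
      show "act B s r a (\<kappa> B) = \<one>\<^bsub>Gr B r\<^esub>" if "B \<in> W" for B
        using \<kappa>(2) that group_hom.hom_one[OF
            hom_group_hom[OF Gr_comm[OF finB[OF that] s] Gr_comm[OF finB[OF that] r]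
            act_hom[OF finB[OF that] s r a]]] by simp
      show "Fmor (Fob V S0) s r a x \<in> carrier (Gr S0 r)"
        using hom_in_carrier[OF act_hom[OF S0 s r a] xc] .
      show "push S0 T f r (Fmor (Fob V S0) s r a x) = act T s r a (\<kappa> T)"
        using push_act[OF finT f s r a xc] \<kappa>(3) by simp
    qed (rule ker_act[OF S s \<kappa>(1) r a])
    fix y assume y: "y \<in> lead d S T W S0 f s"
    then obtain \<mu> where \<mu>: "\<mu> \<in> ker d S s" "\<forall>B\<in>W. \<mu> B = \<one>\<^bsub>Gr B s\<^esub>" "push S0 T f s y = \<mu> T"
      by (auto simp: lead_def)
    have yc: "y \<in> carrier (Gr S0 s)" using y by (simp add: lead_def)
    show "x \<otimes>\<^bsub>Gr S0 s\<^esub> y \<in> lead d S T W S0 f s"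
      unfolding lead_def
    proof (intro CollectI conjI bexI[of _ "\<lambda>T. \<kappa> T \<otimes>\<^bsub>Gr T s\<^esub> \<mu> T"] ballI)
      show "\<kappa> B \<otimes>\<^bsub>Gr B s\<^esub> \<mu> B = \<one>\<^bsub>Gr B s\<^esub>" if "B \<in> W" for B
        using \<kappa>(2) \<mu>(2) that monoid.l_one[OF group.is_monoid[OF gB[OF that]]]
            monoid.one_closed[OF group.is_monoid[OF gB[OF that]]]
        by simp
    qed (use xc yc \<kappa>(3) \<mu>(3) ker_mult[OF S s \<kappa>(1) \<mu>(1)] in simp_all)
  next
    fix s assume s: "s \<in> Ob Q"
    have "(\<lambda>T. \<one>\<^bsub>Gr T s\<^esub>) \<in> ker d S s" using fam_one(1,2)[OF S s, of d "\<lambda>T. \<one>\<^bsub>Gr T s\<^esub>"]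
        by (simp add: ker_def)
    then show "\<one>\<^bsub>Gr S0 s\<^esub> \<in> lead d S T W S0 f s"
      unfolding lead_def
      using group_hom.hom_one[OF push_group_hom[OF finT f s]] comm_groupE(2)[OF Gr_comm[OF S0 s]]
      by (intro CollectI conjI bexI[of _ "\<lambda>T. \<one>\<^bsub>Gr T s\<^esub>"]) auto
  qed
qed

lemma pfam_vanish:
  assumes S': "finite S'" and h: "h ` S \<subseteq> S'" "inj_on h S" and s: "s \<in> Ob Q"
    and W: "W \<subseteq> subs d S" and \<kappa>: "\<forall>B\<in>W. \<kappa> B = \<one>\<^bsub>Gr B s\<^esub>" and B': "\<not> B' \<subseteq> h ` S \<or> (\<exists>B\<in>W. B' = h ` B)"
  shows "pfam S h s \<kappa> B' = \<one>\<^bsub>Gr B' s\<^esub>"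
proof (cases "B' \<subseteq> h ` S")
  case True
  then obtain B where B: "B \<in> W" "B' = h ` B" using B' by blast
  then have BS: "B \<subseteq> S" using W by (auto simp: subs_def)
  have "finite (h ` B)" using BS h(1) S' by (meson finite_subset image_mono order_trans)
  then have "push B (h ` B) h s \<one>\<^bsub>Gr B s\<^esub> = \<one>\<^bsub>Gr (h ` B) s\<^esub>"
    using group_hom.hom_one[OF push_group_hom[OF _ _ _ s, of "h ` B" h B]] inj_on_subset[OF h(2) BS]
        by simp
  then show ?thesis using B \<kappa> pfam_image[OF h(2) BS] by simp
qed (rule pfam_outside)

lemma pfam_lead:
  assumes S': "finite S'" and h: "h ` S \<subseteq> S'" "inj_on h S" and s: "s \<in> Ob Q"
    and T: "T \<subseteq> S" and f: "f ` S0 \<subseteq> T" "inj_on f S0" and f': "\<And>y. y \<in> S0 \<Longrightarrow> h (f y) = f' y"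
    and x: "x \<in> carrier (Gr S0 s)" and eq: "push S0 T f s x = \<kappa> T"
  shows "pfam S h s \<kappa> (h ` T) = push S0 (h ` T) f' s x"
proof -
  have T': "finite (h ` T)" using T h(1) S' by (meson finite_subset image_mono order_trans)
  then have fT: "finite T" using inj_on_subset[OF h(2) T] finite_imageD by blast
  have "push T (h ` T) h s (push S0 T f s x) = push S0 (h ` T) f' s x"
    by (rule push_push[OF fT f T' _ inj_on_subset[OF h(2) T] s x f']) auto
  then show ?thesis using eq pfam_image[OF h(2) T] by simp
qed

text \<open>Pushing a witness forward along \<open>h\<close> keeps its coefficient. The condition on
  \<open>W'\<close> is what preservation of the order will provide: a set above the new leading set
  either leaves the image of \<open>h\<close>, where the pushed relation is trivial, or comes from a
  set above the old one.\<close>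

lemma lead_mono:
  assumes S': "finite S'" and h: "h ` S \<subseteq> S'" "inj_on h S" and s: "s \<in> Ob Q"
    and T: "T \<subseteq> S" and f: "f ` S0 \<subseteq> T" "inj_on f S0" and f': "\<And>y. y \<in> S0 \<Longrightarrow> h (f y) = f' y"
    and W: "W \<subseteq> subs d S" and W': "\<And>B'. B' \<in> W' \<Longrightarrow> \<not> B' \<subseteq> h ` S \<or> (\<exists>B\<in>W. B' = h ` B)"
  shows "lead d S T W S0 f s \<subseteq> lead d S' (h ` T) W' S0 f' s"
proof
  fix x assume "x \<in> lead d S T W S0 f s"
  then obtain \<kappa> where x: "x \<in> carrier (Gr S0 s)"
      and \<kappa>: "\<kappa> \<in> ker d S s" "\<forall>B\<in>W. \<kappa> B = \<one>\<^bsub>Gr B s\<^esub>" "push S0 T f s x = \<kappa> T"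
    by (auto simp: lead_def)
  show "x \<in> lead d S' (h ` T) W' S0 f' s"
    unfolding lead_def
  proof (intro CollectI conjI x bexI[of _ "pfam S h s \<kappa>"] ballI)
    show "pfam S h s \<kappa> \<in> ker d S' s" by (rule ker_pfam[OF S' h s \<kappa>(1)])
    show "pfam S h s \<kappa> B' = \<one>\<^bsub>Gr B' s\<^esub>" if "B' \<in> W'" for B'
      by (rule pfam_vanish[OF S' h s W \<kappa>(2) W'[OF that]])
    show "push S0 (h ` T) f' s x = pfam S h s \<kappa> (h ` T)"
      using pfam_lead[OF S' h s T f f' x, of \<kappa>] \<kappa>(3) by simp
  qed
qed

text \<open>Comparing finite sets of natural numbers by \<open>set_encode\<close> is the colexicographic order.\<close>

definition minimal_bad :: "(nat \<Rightarrow> 'u) \<Rightarrow> nat \<Rightarrow> nat \<Rightarrow> nat \<Rightarrow> 'u \<Rightarrow> ('u set \<Rightarrow> 'u) \<Rightarrow> nat set \<Rightarrow> bool" where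
  "minimal_bad e d N m r \<kappa> A \<longleftrightarrow> r \<in> Ob Q \<and> \<kappa> \<in> ker d (e ` {..<m}) r \<and> \<not> good N d (e ` {..<m}) r \<kappa> \<and>
     A \<subseteq> {..<m} \<and> card A \<le> d \<and>
     (\<forall>B\<subseteq>{..<m}. card B \<le> d \<longrightarrow> set_encode A < set_encode B \<longrightarrow> \<kappa> (e ` B) = \<one>\<^bsub>Gr (e ` B) r\<^esub>) \<and>
     (\<forall>m' r' \<kappa>'. r' \<in> Ob Q \<longrightarrow> \<kappa>' \<in> ker d (e ` {..<m'}) r' \<longrightarrow>
        (\<forall>B\<subseteq>{..<m'}. card B \<le> d \<longrightarrow> set_encode A \<le> set_encode B \<longrightarrow> \<kappa>' (e ` B) = \<one>\<^bsub>Gr (e ` B) r'\<^esub>) \<longrightarrow>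
        good N d (e ` {..<m'}) r' \<kappa>')"

lemma subs_enum_iff:
  fixes e :: "nat \<Rightarrow> 'u"
  assumes e: "inj e"
  shows "e ` B \<in> subs d (e ` {..<m}) \<longleftrightarrow> B \<subseteq> {..<m} \<and> card B \<le> d"
  using card_image[OF inj_on_subset[OF e subset_UNIV], of B]
      inj_image_subset_iff[OF e, of B "{..<m}"]
  by (simp add: subs_def)

lemma subs_enumE:
  fixes e :: "nat \<Rightarrow> 'u"
  assumes e: "inj e" and T: "T \<in> subs d (e ` {..<m})"
  obtains B where "B \<subseteq> {..<m}" "card B \<le> d" "T = e ` B"
proof -
  obtain B where "T = e ` B" using T by (auto simp: subs_def subset_image_iff)
  then show thesis using T that[of B] subs_enum_iff[OF e, of B d m] by simp
qed

text \<open>\<open>bad c\<close> says that some bad relation vanishes at all sets with code at least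
  \<open>c\<close>. The least such bound, over all relations on all standard sets at once, is
  positive, and its predecessor is the code of the leading set.\<close>

lemma minimal_bad_ex:
  fixes e :: "nat \<Rightarrow> 'u"
  assumes e: "inj e" and dN: "d \<le> N" and S: "finite S" and r: "r \<in> Ob Q" and \<kappa>: "\<kappa> \<in> ker d S r"
    and ng: "\<not> good N d S r \<kappa>"
  shows "\<exists>m r \<kappa> A. minimal_bad e d N m r \<kappa> A"
proof -
  define bad where "bad c \<longleftrightarrow> (\<exists>m r \<kappa>. r \<in> Ob Q \<and> \<kappa> \<in> ker d (e ` {..<m}) r \<and> \<not> good N d (e ` {..<m}) r
      \<kappa> \<and>
     (\<forall>B\<subseteq>{..<m}. card B \<le> d \<longrightarrow> c \<le> set_encode B \<longrightarrow> \<kappa> (e ` B) = \<one>\<^bsub>Gr (e ` B) r\<^esub>))" for c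
  define m where "m = card S"
  obtain b where b: "bij_betw b S {0..<m}" using ex_bij_betw_finite_nat[OF S] m_def by blast
  define h where "h x = e (b x)" for x
  have h: "h ` S = e ` {..<m}" "inj_on h S"
    using b e by (auto simp: h_def bij_betw_def inj_on_def image_image[symmetric] atLeast0LessThan
        dest: injD)
  have hS: "h ` S \<subseteq> e ` {..<m}" using h(1) by simp
  have fin: "finite (e ` {..<m})" for m by simp
  have \<kappa>f: "\<kappa> \<in> fam d S r" using \<kappa> by (simp add: ker_def)
  have "\<not> good N d (e ` {..<m}) r (pfam S h r \<kappa>)"
    using good_reflect[OF _ dN fin h r \<kappa>f] ng by blast
  moreover have "pfam S h r \<kappa> \<in> ker d (e ` {..<m}) r" by (rule ker_pfam[OF fin hS h(2) r \<kappa>])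
  moreover have "set_encode B < Suc (set_encode {..<m})" if "B \<subseteq> {..<m}" for B
    unfolding set_encode_def less_Suc_eq_le by (rule sum_mono2) (use that in auto)
  \<comment> \<open>No subset of \<open>{..<m}\<close> has a code this large, so the vanishing
    condition is void.\<close>
  ultimately have "bad (Suc (set_encode {..<m}))"
    unfolding bad_def using r by (metis leD)
  then have bad: "bad (LEAST c. bad c)" by (rule LeastI)
  then obtain m r \<kappa> where *: "r \<in> Ob Q" "\<kappa> \<in> ker d (e ` {..<m}) r" "\<not> good N d (e ` {..<m}) r \<kappa>"
    and van: "\<And>B. B \<subseteq> {..<m} \<Longrightarrow> card B \<le> d \<Longrightarrow> (LEAST c. bad c) \<le> set_encode B \<Longrightarrow> \<kappa> (e ` B)
        = \<one>\<^bsub>Gr (e ` B) r\<^esub>"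
    unfolding bad_def by blast
  have "(LEAST c. bad c) \<noteq> 0"
  proof
    assume 0: "(LEAST c. bad c) = 0"
    have "\<kappa> T = \<one>\<^bsub>Gr T r\<^esub>" if "T \<in> subs d (e ` {..<m})" for T
    proof -
      obtain B where B: "B \<subseteq> {..<m}" "card B \<le> d" "T = e ` B"
        using subs_enumE[OF e \<open>T \<in> subs d (e ` {..<m})\<close>] .
      then show ?thesis using van[OF B(1,2)] 0 by simp
    qed
    then have "good N d (e ` {..<m}) r \<kappa>"
      using fam_one(3)[OF fin *(1) _ dN] by blast
    then show False using *(3) by contradiction
  qed
  then obtain c where c: "(LEAST c. bad c) = Suc c" using not0_implies_Suc by blast
  define A where "A = set_decode c"
  have A: "set_encode A = c" "finite A" by (auto simp: A_def)
  have nbad: "\<not> bad c" using not_less_Least[of c bad] c by simp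
  \<comment> \<open>Otherwise no admissible set would have code \<open>c\<close>, and the vanishing
    condition would extend down to \<open>c\<close>, against the choice of the least bound.\<close>
  have "A \<subseteq> {..<m} \<and> card A \<le> d"
  proof (rule ccontr)
    assume no: "\<not> ?thesis"
    have "\<kappa> (e ` B) = \<one>\<^bsub>Gr (e ` B) r\<^esub>" if B: "B \<subseteq> {..<m}" "card B \<le> d" "c \<le> set_encode B" for B
    proof -
      have "B \<noteq> A" using B no by auto
      then have "set_encode B \<noteq> c"
        using set_encode_eq[of B A] A finite_subset[OF B(1) finite_lessThan] by simp
      then show ?thesis using van[OF B(1,2)] c B(3) by simp
    qed
    then have "bad c" unfolding bad_def using * by blast
    then show False using nbad by contradiction
  qed
  moreover have "\<kappa> (e ` B) = \<one>\<^bsub>Gr (e ` B) r\<^esub>"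
      if "B \<subseteq> {..<m}" "card B \<le> d" "set_encode A < set_encode B" for B
    using van[OF that(1,2)] that(3) A c by simp
  moreover have "good N d (e ` {..<m'}) r' \<kappa>'"
    if "r' \<in> Ob Q" "\<kappa>' \<in> ker d (e ` {..<m'}) r'"
      "\<forall>B\<subseteq>{..<m'}. card B \<le> d \<longrightarrow> set_encode A \<le> set_encode B \<longrightarrow> \<kappa>' (e ` B) = \<one>\<^bsub>Gr (e ` B) r'\<^esub>"
          for m' r' \<kappa>'
    using nbad that unfolding bad_def A(1) by blast
  ultimately show ?thesis using * unfolding minimal_bad_def by blast
qed

text \<open>No value of \<open>N\<close> is computed: a bad relation is assumed for every bound, and
  the counterexamples for different bounds are played off against each other.\<close>

lemma kernel_good:
  fixes e :: "nat \<Rightarrow> 'u"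
  assumes e: "inj e" and no: "\<And>n. noeth_sub Q (Fob V (e ` {..<n}))
      (\<lambda>r. carrier (Gr (e ` {..<n}) r))"
  shows "\<exists>N\<ge>d. \<forall>S r \<kappa>. finite S \<longrightarrow> r \<in> Ob Q \<longrightarrow> \<kappa> \<in> ker d S r \<longrightarrow> good N d S r \<kappa>"
proof (rule ccontr)
  assume contra: "\<not> ?thesis"
  let ?E = "\<lambda>m. e ` {..<m}"
  have fin: "finite (?E m)" for m by simp
  \<comment> \<open>The maximum with \<open>d\<close> ensures that all summands of Q are members of
    the diagram.\<close>
  have "\<exists>m r \<kappa> A. minimal_bad e d (max d N) m r \<kappa> A" for N
  proof -
    have "\<not> (\<forall>S r \<kappa>. finite S \<longrightarrow> r \<in> Ob Q \<longrightarrow> \<kappa> \<in> ker d S r \<longrightarrow> good (max d N) d S r \<kappa>)"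
      using contra max.cobounded1[of d N] by blast
    then obtain S r \<kappa> where "finite S" "r \<in> Ob Q" "\<kappa> \<in> ker d S r" "\<not> good (max d N) d S r \<kappa>"
        by blast
    from minimal_bad_ex[OF e max.cobounded1 this] show ?thesis .
  qed
  then obtain mm rr kk AA where mb0: "\<And>N. minimal_bad e d (max d N) (mm N) (rr N) (kk N) (AA N)"
      by metis
  \<comment> \<open>Each bound is at least the size of the standard set that carries the preceding
    counterexample. Hence every relation on that set is good for all later bounds.\<close>
  define Ns where "Ns = rec_nat d (\<lambda>_ N. max N (mm N))"
  have Ns: "Ns 0 = d" "Ns (Suc i) = max (Ns i) (mm (Ns i))" for i by (simp_all add: Ns_def)
  have Ns_mono: "Ns i \<le> Ns j" if "i \<le> j" for i j
    by (rule lift_Suc_mono_le[OF _ that]) (simp add: Ns)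
  have dN: "d \<le> Ns i" for i using Ns_mono[of 0 i] Ns(1) by simp
  define M rs ks As where "M i = mm (Ns i)" and "rs i = rr (Ns i)" and "ks i = kk (Ns i)"
      and "As i = AA (Ns i)" for i
  have "minimal_bad e d (Ns i) (M i) (rs i) (ks i) (As i)" for i
    using mb0[of "Ns i"] dN[of i] by (simp add: M_def rs_def ks_def As_def max_absorb2)
  note mb = this[unfolded minimal_bad_def]
  have M_le: "M i \<le> Ns j" if "i < j" for i j
    using Ns_mono[of "Suc i" j] that Ns(2)[of i] by (simp add: M_def)
  have rs: "rs i \<in> Ob Q" and ks: "ks i \<in> ker d (?E (M i)) (rs i)"
      and ng: "\<not> good (Ns i) d (?E (M i)) (rs i) (ks i)"
    and As: "As i \<subseteq> {..<M i}" "card (As i) \<le> d" for i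
    using mb[of i] by simp_all
  have van: "ks i (e ` B) = \<one>\<^bsub>Gr (e ` B) (rs i)\<^esub>"
    if "B \<subseteq> {..<M i}" "card B \<le> d" "set_encode (As i) < set_encode B" for i B
    using mb[of i] that by simp
  have minim: "good (Ns i) d (?E m') r' \<kappa>'"
    if "r' \<in> Ob Q" "\<kappa>' \<in> ker d (?E m') r'"
      "\<And>B. B \<subseteq> {..<m'} \<Longrightarrow> card B \<le> d \<Longrightarrow> set_encode (As i) \<le> set_encode B \<Longrightarrow> \<kappa>' (e ` B)
          = \<one>\<^bsub>Gr (e ` B) r'\<^esub>" for i m' r' \<kappa>'
    using mb[of i] that by simp
  obtain \<phi> :: "nat \<Rightarrow> nat" and n where \<phi>n: "strict_mono \<phi> \<and> (\<forall>i. card (As (\<phi> i)) = n) \<and>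
    (\<forall>i j. i < j \<longrightarrow> (\<exists>h. strict_mono_on {..<M (\<phi> i)} h \<and> h ` {..<M (\<phi> i)} \<subseteq> {..<M (\<phi> j)} \<and>
      h ` As (\<phi> i) = As (\<phi> j)))"
    using subsets_good_subseq[of As M d, OF As] by (elim exE)
  then have \<phi>: "strict_mono \<phi>" and cardn: "card (As (\<phi> i)) = n" for i by simp_all
  have hex: "\<exists>h. strict_mono_on {..<M (\<phi> i)} h \<and> h ` {..<M (\<phi> i)} \<subseteq> {..<M (\<phi> j)} \<and>
      h ` As (\<phi> i) = As (\<phi> j)" if "i < j" for i j
    using \<phi>n that by simp
  have finA: "finite (As i)" for i using finite_subset[OF As(1)] by simp
  have "\<exists>p. strict_mono_on {..<n} p \<and> p ` {..<n} = As (\<phi> i)" for i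
    using ex_bij_betw_strict_mono_card[OF finA[of "\<phi> i"]] cardn by (metis bij_betw_def)
  then obtain p where p: "\<And>i. strict_mono_on {..<n} (p i)" "\<And>i. p i ` {..<n} = As (\<phi> i)" by metis
  \<comment> \<open>\<open>f i\<close> is the increasing bijection from the standard set with
    \<open>n\<close> points onto the leading set at stage \<open>i\<close>.\<close>
  define f where "f i = conj_map e (p i)" for i
  have fE: "f i ` ?E n = e ` As (\<phi> i)" and f_inj: "inj_on (f i) (?E n)" for i
    unfolding f_def conj_map_image[OF e] p(2)
    by (rule refl) (rule inj_on_conj_map[OF e strict_mono_on_imp_inj_on[OF p(1)]])
  have fE': "f i ` ?E n \<subseteq> e ` As (\<phi> i)" for i using fE by simp
  \<comment> \<open>\<open>W i\<close> consists of the admissible sets strictly above the leading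
    set.\<close>
  define W where "W i = {e ` B | B. B \<subseteq> {..<M (\<phi> i)} \<and> card B \<le> d \<and> set_encode (As (\<phi> i)) <
      set_encode B}" for i
  have W: "W i \<subseteq> subs d (?E (M (\<phi> i)))" for i
    unfolding W_def using subs_enum_iff[OF e] by blast
  have Ai: "e ` As (\<phi> i) \<in> subs d (?E (M (\<phi> i)))" for i
    using As subs_enum_iff[OF e] by blast
  define X where "X i = lead d (?E (M (\<phi> i))) (e ` As (\<phi> i)) (W i) (?E n) (f i)" for i
  have emb: "\<exists>H. H ` ?E (M (\<phi> i)) \<subseteq> ?E (M (\<phi> j)) \<and> inj_on H (?E (M (\<phi> i))) \<and> H ` (e ` As (\<phi> i))
      = e ` As (\<phi> j) \<and>
      (\<forall>y\<in>?E n. H (f i y) = f j y) \<and>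
      (\<forall>B'\<in>W j. \<not> B' \<subseteq> H ` ?E (M (\<phi> i)) \<or> (\<exists>B\<in>W i. B' = H ` B))" if ij: "i < j" for i j
  proof -
    obtain h where h: "strict_mono_on {..<M (\<phi> i)} h" "h ` {..<M (\<phi> i)} \<subseteq> {..<M (\<phi> j)}"
        "h ` As (\<phi> i) = As (\<phi> j)"
      using hex[OF ij] by blast
    have h_inj: "inj_on h {..<M (\<phi> i)}" using h(1) by (rule strict_mono_on_imp_inj_on)
    have pA: "p i k \<in> As (\<phi> i)" "p i k < M (\<phi> i)" if "k < n" for k
      using p(2)[of i] As(1)[of "\<phi> i"] that by auto
    have "strict_mono_on {..<n} (\<lambda>k. h (p i k))"
      by (rule strict_mono_onI) (use strict_mono_onD[OF h(1)] strict_mono_onD[OF p(1)[of i]] pA in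
          auto)
    moreover have "(\<lambda>k. h (p i k)) ` {..<n} = p j ` {..<n}"
      using h(3) unfolding p(2)[symmetric] image_image .
    \<comment> \<open>The embedding matches the two increasing enumerations, so it carries
      \<open>f i\<close> to \<open>f j\<close>. A leading coefficient therefore stays the same
      element of the common module when its relation is pushed forward.\<close>
    ultimately have hp: "h (p i k) = p j k" if "k < n" for k
      using strict_mono_on_enumeration_unique[OF _ p(1)] that by blast
    show ?thesis
    proof (intro exI[of _ "conj_map e h"] conjI ballI)
      show "conj_map e h ` ?E (M (\<phi> i)) \<subseteq> ?E (M (\<phi> j))"
        unfolding conj_map_image[OF e] using h(2) by blast
      show "inj_on (conj_map e h) (?E (M (\<phi> i)))" by (rule inj_on_conj_map[OF e h_inj])
      show "conj_map e h ` e ` As (\<phi> i) = e ` As (\<phi> j)"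
        unfolding conj_map_image[OF e] h(3) ..
      show "conj_map e h (f i y) = f j y" if "y \<in> ?E n" for y
        using that hp by (auto simp: f_def conj_map_apply[OF e])
      fix B' assume "B' \<in> W j"
      then obtain C where C: "B' = e ` C" "C \<subseteq> {..<M (\<phi> j)}" "card C \<le> d"
          "set_encode (As (\<phi> j)) < set_encode C"
        by (auto simp: W_def)
      show "\<not> B' \<subseteq> conj_map e h ` ?E (M (\<phi> i)) \<or> (\<exists>B\<in>W i. B' = conj_map e h ` B)"
      proof (cases "C \<subseteq> h ` {..<M (\<phi> i)}")
        case True
        then obtain B where B: "B \<subseteq> {..<M (\<phi> i)}" "C = h ` B" by (auto simp: subset_image_iff)
        have finB: "finite B" using finite_subset[OF B(1)] by simp
        have "card B = card C" using card_image[OF inj_on_subset[OF h_inj B(1)]] B(2) by simp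
        \<comment> \<open>If \<open>B\<close> were not above the leading set of stage
          \<open>i\<close>, its image \<open>C\<close> would not be above that of stage
          \<open>j\<close>, as \<open>h\<close> preserves the order and maps one leading set to the
          other.\<close>
        moreover have "set_encode (As (\<phi> i)) < set_encode B"
        proof (rule ccontr)
          assume "\<not> ?thesis"
          then consider "set_encode B = set_encode (As (\<phi> i))" |
              "set_encode B < set_encode (As (\<phi> i))" by linarith
          then show False
          proof cases
            case 1
            then have "B = As (\<phi> i)" using set_encode_eq[OF finB finA] by simp
            then show False using C(4) B(2) h(3) by simp
          next
            case 2
            from set_encode_image_less[OF h(1) B(1) As(1) finB finA this]
            show False using C(4) B(2) h(3) by simp
          qed
        qed
        ultimately have "e ` B \<in> W i" using B(1) C(3) unfolding W_def by auto
        moreover have "B' = conj_map e h ` e ` B" unfolding conj_map_image[OF e] C(1) B(2) ..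
        ultimately show ?thesis by blast
      next
        case False
        then show ?thesis
          unfolding conj_map_image[OF e] C(1) using inj_image_subset_iff[OF e] by simp
      qed
    qed
  qed
  have Amem: "e ` As (\<phi> i) \<subseteq> ?E (M (\<phi> i))" for i using As(1) by blast
  have X_sub: "X i s \<subseteq> X j s" if s: "s \<in> Ob Q" and ij: "i < j" for i j s
  proof -
    obtain H where H: "H ` ?E (M (\<phi> i)) \<subseteq> ?E (M (\<phi> j))" "inj_on H (?E (M (\<phi> i)))"
        "H ` (e ` As (\<phi> i)) = e ` As (\<phi> j)"
      "\<forall>y\<in>?E n. H (f i y) = f j y" "\<forall>B'\<in>W j. \<not> B' \<subseteq> H ` ?E (M (\<phi> i)) \<or> (\<exists>B\<in>W i. B' = H ` B)"
      using emb[OF ij] by (elim exE conjE)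
    show ?thesis
      unfolding X_def H(3)[symmetric]
      by (rule lead_mono[OF fin H(1,2) s Amem fE' f_inj H(4)[rule_format] W H(5)[rule_format]])
  qed
  have "\<exists>n0. \<forall>m\<ge>n0. fam_le Q (X m) (X n0)"
  proof (rule noeth_subD[OF no[of n]])
    show "submod Q (Fob V (?E n)) (X i)" for i
      unfolding X_def by (rule submod_lead[OF fin Ai fE' f_inj W])
    show "fam_le Q (X i) (\<lambda>r. carrier (Gr (?E n) r))" for i
      by (auto simp: fam_le_def X_def lead_def)
    show "fam_le Q (X i) (X j)" if "i \<le> j" for i j
      using X_sub[of _ i j] that by (cases "i = j") (auto simp: fam_le_def)
  qed
  \<comment> \<open>Two consecutive stages suffice: once the chain is stable, each leading
    coefficient already occurs one stage earlier.\<close>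
  then obtain i where "fam_le Q (X (Suc i)) (X i)" by (meson Suc_n_not_le_n nat_le_linear)
  then have Xi: "X (Suc i) s \<subseteq> X i s" if "s \<in> Ob Q" for s using that by (simp add: fam_le_def)
  define j where "j = Suc i"
  define r where "r = rs (\<phi> j)"
  have r: "r \<in> Ob Q" using rs by (simp add: r_def)
  let ?T = "e ` As (\<phi> j)" and ?S = "?E (M (\<phi> j))"
  define \<kappa> where "\<kappa> = ks (\<phi> j)"
  have \<kappa>: "\<kappa> \<in> ker d ?S r" "\<not> good (Ns (\<phi> j)) d ?S r \<kappa>" using ks ng by (auto simp: \<kappa>_def r_def)
  have \<kappa>f: "\<kappa> \<in> fam d ?S r" using \<kappa>(1) by (simp add: ker_def)
  have \<kappa>T: "\<kappa> ?T \<in> carrier (Gr ?T r)" by (rule famD[OF \<kappa>f Ai])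
  have \<kappa>van: "\<kappa> B = \<one>\<^bsub>Gr B r\<^esub>" if "B \<in> W j" for B
    using that van[of _ "\<phi> j"] by (auto simp: W_def \<kappa>_def r_def)
  have finT: "finite ?T" using finA by simp
  define g where "g = the_inv_into (?E n) (f j)"
  \<comment> \<open>The leading coefficient of \<kappa>, transported to the standard set by the
    inverse of \<open>f j\<close>.\<close>
  define x where "x = push ?T (?E n) g r (\<kappa> ?T)"
  have g: "g ` ?T \<subseteq> ?E n" "inj_on g ?T"
    unfolding g_def fE[of j, symmetric] using inj_on_the_inv_into[OF f_inj]
        the_inv_into_into[OF f_inj _ subset_refl] by blast+
  have fg: "f j (g y) = y" if "y \<in> ?T" for y
    using f_the_inv_into_f[OF f_inj[of j], of y] that fE[of j] by (simp add: g_def)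
  have x: "x \<in> carrier (Gr (?E n) r)" unfolding x_def by (rule push_closed[OF fin g r \<kappa>T])
  have "push (?E n) ?T (f j) r x = push ?T ?T (\<lambda>y. y) r (\<kappa> ?T)"
    unfolding x_def by (rule push_push[OF fin g finT fE' f_inj r \<kappa>T fg])
  also have "\<dots> = \<kappa> ?T" by (rule push_id[OF finT r \<kappa>T]) simp
  finally have xT: "push (?E n) ?T (f j) r x = \<kappa> ?T" .
  have "x \<in> X j r"
    unfolding X_def lead_def using x xT \<kappa>(1) \<kappa>van by blast
  then have "x \<in> X i r" using Xi[OF r] by (auto simp: j_def)
  \<comment> \<open>A relation on the standard set of stage \<open>i\<close> realises the same
    coefficient \<open>x\<close>.\<close>
  then obtain \<mu> where \<mu>: "\<mu> \<in> ker d (?E (M (\<phi> i))) r" "\<forall>B\<in>W i. \<mu> B = \<one>\<^bsub>Gr B r\<^esub>"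
    "push (?E n) (e ` As (\<phi> i)) (f i) r x = \<mu> (e ` As (\<phi> i))"
    unfolding X_def lead_def by blast
  have ij: "i < j" by (simp add: j_def)
  obtain H where H: "H ` ?E (M (\<phi> i)) \<subseteq> ?S" "inj_on H (?E (M (\<phi> i)))" "H ` (e ` As (\<phi> i)) = ?T"
    "\<forall>y\<in>?E n. H (f i y) = f j y" "\<forall>B'\<in>W j. \<not> B' \<subseteq> H ` ?E (M (\<phi> i)) \<or> (\<exists>B\<in>W i. B' = H ` B)"
    using emb[OF ij] by (elim exE conjE)
  define \<mu>' where "\<mu>' = pfam (?E (M (\<phi> i))) H r \<mu>"
  have \<mu>'k: "\<mu>' \<in> ker d ?S r" unfolding \<mu>'_def by (rule ker_pfam[OF fin H(1,2) r \<mu>(1)])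
  have \<mu>'f: "\<mu>' \<in> fam d ?S r" using \<mu>'k by (simp add: ker_def)
  have \<mu>'T: "\<mu>' ?T = \<kappa> ?T"
    using pfam_lead[where \<kappa> = \<mu> and T = "e ` As (\<phi> i)" and f = "f i" and f' = "f j",
        OF fin H(1,2) r Amem fE' f_inj H(4)[rule_format] x \<mu>(3)] xT H(3)
    by (simp add: \<mu>'_def)
  have \<mu>'W: "\<mu>' B = \<one>\<^bsub>Gr B r\<^esub>" if "B \<in> W j" for B
    unfolding \<mu>'_def by (rule pfam_vanish[OF fin H(1,2) r W \<mu>(2) H(5)[rule_format, OF that]])
  \<comment> \<open>The growth of \<open>Ns\<close> enters here: \<mu> lives on a set of size at
    most \<open>Ns (\<phi> j)\<close>, which alone makes it good for the bound of stage
    \<open>j\<close>; so its push-forward is good as well.\<close>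
  have "card (?E (M (\<phi> i))) \<le> Ns (\<phi> j)"
    using M_le[of "\<phi> i" "\<phi> j"] \<phi> ij card_image_le[of "{..<M (\<phi> i)}" e]
        by (simp add: strict_mono_less)
  then have "good (Ns (\<phi> j)) d (?E (M (\<phi> i))) r \<mu>"
    by (rule small_good[OF fin r dN _ \<mu>(1)])
  then have \<mu>'g: "good (Ns (\<phi> j)) d ?S r \<mu>'"
    unfolding \<mu>'_def using \<mu>(1) by (intro good_push[OF _ dN fin H(1,2) r]) (simp_all add: ker_def)
  \<comment> \<open>The leading components of \<kappa> and \<mu>' cancel and both families vanish
    above. So \<delta> lives strictly below the leading set and is good by minimality, which makes
    \<kappa> good.\<close>
  define \<delta> where "\<delta> = (\<lambda>T. \<kappa> T \<otimes>\<^bsub>Gr T r\<^esub> inv\<^bsub>Gr T r\<^esub> \<mu>' T)"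
  have \<delta>: "\<delta> \<in> ker d ?S r"
    unfolding \<delta>_def by (rule ker_mult[OF fin r \<kappa>(1) ker_inv[OF fin r \<mu>'k]])
  have grp: "group (Gr T r)" if "T \<in> subs d ?S" for T
    using Gr_comm[OF finite_in_subs[OF fin that] r] by (rule comm_group.axioms(2))
  have "good (Ns (\<phi> j)) d ?S r \<delta>"
  proof (rule minim[OF r \<delta>])
    fix B assume B: "B \<subseteq> {..<M (\<phi> j)}" "card B \<le> d" "set_encode (As (\<phi> j)) \<le> set_encode B"
    show "\<delta> (e ` B) = \<one>\<^bsub>Gr (e ` B) r\<^esub>"
    proof (cases "B = As (\<phi> j)")
      case True
      then show ?thesis using \<mu>'T group.r_inv[OF grp[OF Ai] \<kappa>T] by (simp add: \<delta>_def)
    next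
      case False
      then have "set_encode (As (\<phi> j)) \<noteq> set_encode B"
        using set_encode_eq[OF finA finite_subset[OF B(1) finite_lessThan]] by simp
      then have eB: "e ` B \<in> W j" unfolding W_def using B by auto
      then have "e ` B \<in> subs d ?S" using W by blast
      from group.is_monoid[OF grp[OF this]] show ?thesis
        using \<kappa>van[OF eB] \<mu>'W[OF eB] by (simp add: \<delta>_def monoid.inv_one monoid.l_one
            monoid.one_closed)
    qed
  qed
  then have "good (Ns (\<phi> j)) d ?S r (\<lambda>T. \<delta> T \<otimes>\<^bsub>Gr T r\<^esub> \<mu>' T)"
    using \<delta> by (intro good_mult[OF dN _ \<mu>'f _ \<mu>'g]) (simp_all add: ker_def)
  moreover have "(\<lambda>T. \<delta> T \<otimes>\<^bsub>Gr T r\<^esub> \<mu>' T) \<in> fam d ?S r"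
    using \<delta> \<mu>'f by (intro fam_mult(1)[OF fin r]) (simp_all add: ker_def)
  moreover have "\<kappa> T = \<delta> T \<otimes>\<^bsub>Gr T r\<^esub> \<mu>' T" if T: "T \<in> subs d ?S" for T
  proof -
    interpret group "Gr T r" using grp[OF T] .
    show ?thesis using famD[OF \<kappa>f T] famD[OF \<mu>'f T] by (simp add: \<delta>_def m_assoc)
  qed
  ultimately have "good (Ns (\<phi> j)) d ?S r \<kappa>"
    using good_cong[OF dN] by blast
  then show False using \<kappa>(2) by contradiction
qed

section \<open>Generators of an FI-module and the colimit\<close>

text \<open>A triple \<open>(n, s, x)\<close> stands for an element \<open>x\<close> of degree
  \<open>n\<close> at the object \<open>s\<close>, and \<open>S\<close> receives its images under
  all injections. The membership conditions are part of the comprehension, so \<open>F\<close> may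
  be any finite set of triples; ill-formed ones contribute nothing.\<close>

definition gens :: "(nat \<Rightarrow> 'u) \<Rightarrow> (nat \<times> 'u \<times> 'u) set \<Rightarrow> 'u set \<Rightarrow> ('u \<times> 'u) set" where
  "gens e F S = {(s, push (e ` {..<n}) S f s x) | n s x f. (n, s, x) \<in> F \<and> s \<in> Ob Q \<and>
     x \<in> carrier (Gr (e ` {..<n}) s) \<and> f \<in> (e ` {..<n}) \<rightarrow>\<^sub>E S \<and> inj_on f (e ` {..<n})}"

lemma gensI:
  "(n, s, x) \<in> F \<Longrightarrow> s \<in> Ob Q \<Longrightarrow> x \<in> carrier (Gr (e ` {..<n}) s) \<Longrightarrow> f \<in> (e ` {..<n}) \<rightarrow>\<^sub>E S \<Longrightarrow>
    inj_on f (e ` {..<n}) \<Longrightarrow> m = push (e ` {..<n}) S f s x \<Longrightarrow> (s, m) \<in> gens e F S"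
  unfolding gens_def by blast

lemma finite_gens:
  assumes "finite F" "finite S"
  shows "finite (gens e F S)"
proof (rule finite_subset)
  show "gens e F S \<subseteq> (\<Union>(n, s, x)\<in>F. (\<lambda>f. (s, push (e ` {..<n}) S f s x)) ` ((e ` {..<n}) \<rightarrow>\<^sub>E S))"
    unfolding gens_def by blast
  show "finite (\<Union>(n, s, x)\<in>F. (\<lambda>f. (s, push (e ` {..<n}) S f s x)) ` ((e ` {..<n}) \<rightarrow>\<^sub>E S))"
    using assms by (auto intro!: finite_PiE)
qed

lemma gens_closed:
  assumes "finite S" "(s, m) \<in> gens e F S"
  shows "s \<in> Ob Q" "m \<in> carrier (Gr S s)"
  using assms push_closed[OF assms(1)] by (auto simp: gens_def PiE_iff image_subset_iff)

lemma gens_mono: "F \<subseteq> F' \<Longrightarrow> gens e F S \<subseteq> gens e F' S"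
  unfolding gens_def by blast

text \<open>If \<open>U\<close> is a submodule at \<open>T\<close> that contains the generators
  there, its preimage under the push is a submodule at \<open>S\<close> that contains those at
  \<open>S\<close>, because injections compose. So it contains their span.\<close>

lemma subfunctor_mspan_gens: "subfunctor FI Q V (\<lambda>S. mspan Q (Fob V S) (gens e F S))"
  unfolding subfunctor_def
proof (intro conjI ballI)
  fix S :: "'u set" assume "S \<in> Ob FI"
  then have S: "finite S" by (simp add: FI_def)
  then show "submod Q (Fob V S) (mspan Q (Fob V S) (gens e F S))"
    using gens_closed(2) by (intro submod_mspan[OF Q Gr_add])
  fix T :: "'u set" and g r m assume T: "T \<in> Ob FI" and g: "g \<in> Mor FI S T" and r: "r \<in> Ob Q"
    and m: "m \<in> mspan Q (Fob V S) (gens e F S) r"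
  have finT: "finite T" and g': "g ` S \<subseteq> T" "inj_on g S" "restrict g S = g"
    using T g by (auto simp: FI_def PiE_def extensional_restrict)
  have gp: "Fmor V S T g = push S T g" using g'(3) by (simp add: push_def)
  have gM: "push S T g \<in> Mor (Mods Q) (Fob V S) (Fob V T)" by (rule push_Mor[OF finT g'(1,2)])
  show "Fmor V S T g r m \<in> mspan Q (Fob V T) (gens e F T) r"
    unfolding gp
  proof (rule mspan_memI)
    fix U assume U: "submod Q (Fob V T) U" and E: "\<And>s m. (s, m) \<in> gens e F T \<Longrightarrow> m \<in> U s"
    have "m \<in> {n \<in> carrier (Gr S r). push S T g r n \<in> U r}"
    proof (rule mspan_memD[OF m submod_vimage[OF Q Gr_add[OF S] Gr_add[OF finT] gM U]])
      fix s k assume k: "(s, k) \<in> gens e F S"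
      then obtain n x f where f: "(n, s, x) \<in> F" "s \<in> Ob Q" "x \<in> carrier (Gr (e ` {..<n}) s)"
        "f \<in> (e ` {..<n}) \<rightarrow>\<^sub>E S" "inj_on f (e ` {..<n})" "k = push (e ` {..<n}) S f s x"
        by (auto simp: gens_def)
      let ?h = "restrict (\<lambda>y. g (f y)) (e ` {..<n})"
      have fS: "f ` e ` {..<n} \<subseteq> S" using f(4) by auto
      have "push S T g s k = push (e ` {..<n}) T ?h s x"
        unfolding f(6) by (rule push_push[OF S fS f(5) finT g'(1,2) f(2,3)]) simp
      moreover have "?h \<in> (e ` {..<n}) \<rightarrow>\<^sub>E T" using fS g'(1) by auto
      moreover have "inj_on ?h (e ` {..<n})" using comp_inj_on[OF f(5) inj_on_subset[OF g'(2) fS]]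
        by (auto simp: inj_on_def)
      ultimately have "(s, push S T g s k) \<in> gens e F T" by (intro gensI[OF f(1-3)])
      then show "k \<in> {n \<in> carrier (Gr S s). push S T g s n \<in> U s}"
        using E gens_closed(2)[OF S k] by simp
    qed
    then show "push S T g r m \<in> U r" by simp
  qed
qed

text \<open>The finite sets of generators are indexed by \<open>'u\<close> itself through a surjection, since the filtered
  categories in \<open>finitely_generated\<close> have their objects in \<open>'u\<close>.\<close>

lemma finite_generation:
  fixes e :: "nat \<Rightarrow> 'u"
  assumes inf: "infinite (UNIV :: 'u set)"
      and fg: "finitely_generated TYPE('u) (functor_cat FI (Mods Q)) V"
    and e: "inj e"
  shows "\<exists>F. finite F \<and> (\<forall>S r. finite S \<longrightarrow> r \<in> Ob Q
      \<longrightarrow> carrier (Gr S r) \<subseteq> mspan Q (Fob V S) (gens e F S) r)"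
proof -
  obtain dec :: "'u \<Rightarrow> (nat \<times> 'u \<times> 'u) list" where dec: "surj dec"
      using infinite_surj_gen_lists[OF inf] by blast
  let ?U = "\<lambda>z S. mspan Q (Fob V S) (gens e (set (dec z)) S)"
  have "\<exists>j\<in>UNIV. \<forall>S\<in>Ob FI. \<forall>x\<in>Ob Q. carrier (Gr S x) \<subseteq> ?U j S x"
  proof (rule finitely_generated_functor_directed[OF Q category_FI fg, of "e 0" "e 1"])
    show "e 0 \<noteq> e 1" using e by (auto dest: injD)
    show "subfunctor FI Q V (?U j)" for j by (rule subfunctor_mspan_gens)
    fix i j :: 'u
    \<comment> \<open>Concatenating lists unites the two finite sets of generators, which gives
      directedness.\<close>
    obtain k where k: "dec k = dec i @ dec j" using surjD[OF dec] by metis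
    have "fam_le Q (?U i S) (?U k S)" "fam_le Q (?U j S) (?U k S)" for S
      unfolding fam_le_def k by (intro ballI mspan_mono gens_mono, simp)+
    then show "\<exists>k\<in>UNIV. (\<forall>S\<in>Ob FI. fam_le Q (?U i S) (?U k S)) \<and>
        (\<forall>S\<in>Ob FI. fam_le Q (?U j S) (?U k S))"
      by blast
  next
    fix S :: "'u set" and r assume "S \<in> Ob FI" and r: "r \<in> Ob Q"
    then have S: "finite S" by (simp add: FI_def)
    show "carrier (Gr S r) \<subseteq> (\<Union>j\<in>UNIV. ?U j S r)"
    proof
      fix x assume x: "x \<in> carrier (Gr S r)"
      obtain b where b: "bij_betw b S {0..<card S}" using ex_bij_betw_finite_nat[OF S] by blast
      let ?E = "e ` {..<card S}"
      have bij: "bij_betw (e \<circ> b) S ?E"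
        using bij_betw_trans[OF b] inj_on_imp_bij_betw[OF inj_on_subset[OF e subset_UNIV]]
        by (metis atLeast0LessThan)
      define g where "g = restrict (the_inv_into S (e \<circ> b)) ?E"
      have eb: "(e \<circ> b) ` S \<subseteq> ?E" "inj_on (e \<circ> b) S" using bij by (auto simp: bij_betw_def)
      have gb: "bij_betw (the_inv_into S (e \<circ> b)) ?E S" by (rule bij_betw_the_inv_into[OF bij])
      have g: "g ` ?E \<subseteq> S" "inj_on g ?E" "g \<in> ?E \<rightarrow>\<^sub>E S"
        using gb by (auto simp: g_def bij_betw_def inj_on_def)
      have gi: "g ((e \<circ> b) y) = y" if "y \<in> S" for y
        using the_inv_into_f_f[OF eb(2) that] eb(1) that by (auto simp: g_def image_subset_iff)
      \<comment> \<open>Every element over \<open>S\<close> is the image of an element over the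
        standard set with \<open>card S\<close> points, so a single triple already generates
        it.\<close>
      define y where "y = push S ?E (e \<circ> b) r x"
      have finE: "finite ?E" by simp
      have y: "y \<in> carrier (Gr ?E r)" unfolding y_def by (rule push_closed[OF finE eb r x])
      have "push ?E S g r y = push S S (\<lambda>z. z) r x"
        unfolding y_def by (rule push_push[OF finE eb S g(1,2) r x gi])
      also have "\<dots> = x" by (rule push_id[OF S r x]) simp
      finally have px: "push ?E S g r y = x" .
      obtain z where z: "dec z = [(card S, r, y)]" using surjD[OF dec] by metis
      have "(r, x) \<in> gens e (set (dec z)) S"
        by (rule gensI[OF _ r y g(3,2) px[symmetric]]) (simp add: z)
      then have "x \<in> ?U z S r" by (rule mspan_in)
      then show "x \<in> (\<Union>j\<in>UNIV. ?U j S r)" by blast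
    qed
  qed auto
  then obtain j where "\<forall>S\<in>Ob FI. \<forall>x\<in>Ob Q. carrier (Gr S x) \<subseteq> ?U j S x" by blast
  then show ?thesis by (intro exI[of _ "set (dec j)"]) (simp add: FI_def)
qed

text \<open>Over a finite set \<open>S\<close> the finite set \<open>F\<close> yields only finitely
  many elements, one for each generator and injection. A sum of noetherian submodules containing
  them is everything.\<close>

lemma noeth_sub_carrier:
  assumes S: "finite S" and F: "finite F"
    and gen: "\<And>r. r \<in> Ob Q \<Longrightarrow> carrier (Gr S r) \<subseteq> mspan Q (Fob V S) (gens e F S) r"
    and inf: "infinite (UNIV :: 'u set)" and LN: "locally_noetherian TYPE('u) (Mods Q)"
  shows "noeth_sub Q (Fob V S) (\<lambda>r. carrier (Gr S r))"
proof -
  have "\<exists>U. noeth_sub Q (Fob V S) U \<and> (\<forall>(s, m)\<in>gens e F S. m \<in> U s)"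
  proof (rule noeth_sub_finite[OF Q Gr_add[OF S] finite_gens[OF F S]])
    fix s m assume sm: "(s, m) \<in> gens e F S"
    note c = gens_closed[OF S sm]
    show "s \<in> Ob Q" by (rule c)
    show "\<exists>U. noeth_sub Q (Fob V S) U \<and> m \<in> U s"
      by (rule locally_noetherian_elements[OF inf Q LN Gr_add[OF S] c])
  qed
  then obtain U where U: "noeth_sub Q (Fob V S) U" "\<And>s m. (s, m) \<in> gens e F S \<Longrightarrow> m \<in> U s" by blast
  have sU: "submod Q (Fob V S) U" using U(1) by (simp add: noeth_sub_def)
  have le: "fam_le Q (\<lambda>r. carrier (Gr S r)) U"
    unfolding fam_le_def using gen mspan_least[OF sU U(2)] by (meson order_trans)
  show ?thesis
    unfolding noeth_sub_def
  proof (intro conjI allI impI submod_carrier[OF Q Gr_add[OF S]])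
    fix X :: "nat \<Rightarrow> 'u \<Rightarrow> 'u set"
    assume X: "\<forall>i. submod Q (Fob V S) (X i)" "\<forall>i. fam_le Q (X i) (\<lambda>r. carrier (Gr S r))"
      "\<forall>i j. i \<le> j \<longrightarrow> fam_le Q (X i) (X j)"
    show "\<exists>n. \<forall>m\<ge>n. fam_le Q (X m) (X n)"
      by (rule noeth_subD[OF U(1)]) (use X fam_le_trans[OF _ le] in auto)
  qed
qed

text \<open>The image of \<open>tot\<close> is a submodule, so it is enough to reach the generators.
  The push along \<open>f\<close> factors through the image of \<open>f\<close>, a subset of
  \<open>S\<close> with at most \<open>n \<le> d\<close> elements.\<close>

lemma tot_surj:
  fixes e :: "nat \<Rightarrow> 'u"
  assumes S: "finite S" and r: "r \<in> Ob Q" and d: "\<And>n s x. (n, s, x) \<in> F \<Longrightarrow> n \<le> d"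
    and gen: "carrier (Gr S r) \<subseteq> mspan Q (Fob V S) (gens e F S) r" and x: "x \<in> carrier (Gr S r)"
  shows "\<exists>\<kappa>\<in>fam d S r. tot d S r \<kappa> = x"
proof -
  let ?U = "\<lambda>s. tot d S s ` fam d S s"
  have U: "submod Q (Fob V S) ?U"
  proof (rule submodI[OF Q Gr_add[OF S]])
    fix s m assume s: "s \<in> Ob Q" and m: "m \<in> ?U s"
    then obtain \<kappa> where \<kappa>: "\<kappa> \<in> fam d S s" "m = tot d S s \<kappa>" by blast
    show "m \<in> carrier (Gr S s)" using tot_closed[OF S s \<kappa>(1)] \<kappa>(2) by simp
    show "inv\<^bsub>Gr S s\<^esub> m \<in> ?U s"
      by (rule image_eqI[OF _ fam_inv(1)[OF S s \<kappa>(1)]]) (simp add: \<kappa>(2) fam_inv(2)[OF S s \<kappa>(1)])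
    show "act S s t a m \<in> ?U t" if "t \<in> Ob Q" "a \<in> Mor Q s t" for t a
      by (rule image_eqI[OF _ fam_act(1)[OF S s that \<kappa>(1)]])
          (simp add: \<kappa>(2) fam_act(2)[OF S s that \<kappa>(1)])
    fix n assume "n \<in> ?U s"
    then obtain \<mu> where \<mu>: "\<mu> \<in> fam d S s" "n = tot d S s \<mu>" by blast
    show "m \<otimes>\<^bsub>Gr S s\<^esub> n \<in> ?U s"
      by (rule image_eqI[OF _ fam_mult(1)[OF S s \<kappa>(1) \<mu>(1)]])
        (simp add: \<kappa>(2) \<mu>(2) fam_mult(2)[OF S s \<kappa>(1) \<mu>(1)])
  next
    fix s assume s: "s \<in> Ob Q"
    show "\<one>\<^bsub>Gr S s\<^esub> \<in> ?U s"
      using fam_one(1,2)[OF S s refl] by (intro image_eqI[where x = "\<lambda>T. \<one>\<^bsub>Gr T s\<^esub>"]) simp_all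
  qed
  have "x \<in> ?U r"
  proof (rule mspan_memD[OF subsetD[OF gen x] U])
    fix s m assume "(s, m) \<in> gens e F S"
    then obtain n y f where f: "(n, s, y) \<in> F" "s \<in> Ob Q" "y \<in> carrier (Gr (e ` {..<n}) s)"
      "f \<in> (e ` {..<n}) \<rightarrow>\<^sub>E S" "inj_on f (e ` {..<n})" "m = push (e ` {..<n}) S f s y"
      by (auto simp: gens_def)
    let ?E = "e ` {..<n}" and ?T = "f ` e ` {..<n}"
    have TS: "?T \<subseteq> S" using f(4) by auto
    have finT: "finite ?T" by simp
    have "card ?T \<le> n" using card_image_le[of "{..<n}" "\<lambda>k. f (e k)"] by (simp add: image_image)
    then have T: "?T \<in> subs d S" using TS d[OF f(1)] by (simp add: subs_def)
    define z where "z = push ?E ?T f s y"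
    have z: "z \<in> carrier (Gr ?T s)" unfolding z_def
        by (rule push_closed[OF finT subset_refl f(5,2,3)])
    have zm: "push ?T S (\<lambda>x. x) s z = m"
      unfolding z_def f(6) by (rule push_push[OF finT subset_refl f(5) S _ _ f(2,3)])
          (use TS in auto)
    define \<kappa> where "\<kappa> T = (if T = ?T then z else \<one>\<^bsub>Gr T s\<^esub>)" for T
    have \<kappa>: "\<kappa> \<in> fam d S s"
      using z comm_groupE(2)[OF Gr_comm[OF finite_in_subs[OF S] f(2)]] by (auto simp: fam_def \<kappa>_def)
    have \<kappa>_ne: "\<kappa> T = \<one>\<^bsub>Gr T s\<^esub>" if "T \<noteq> ?T" for T using that by (simp add: \<kappa>_def)
    interpret comm_group "Gr S s" using Gr_comm[OF S f(2)] .
    have one: "push T S (\<lambda>x. x) s \<one>\<^bsub>Gr T s\<^esub> = \<one>\<^bsub>Gr S s\<^esub>" if "T \<in> subs d S" for T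
      using group_hom.hom_one[OF hom_group_hom[OF Gr_comm[OF finite_in_subs[OF S that] f(2)]
          Gr_comm[OF S f(2)]
          push_incl_hom[OF S that f(2)]]] .
    have "tot d S s \<kappa> = finprod (Gr S s) (\<lambda>T. if T
        = ?T then push T S (\<lambda>x. x) s (\<kappa> T) else \<one>\<^bsub>Gr S s\<^esub>) (subs d S)"
      unfolding tot_def by (rule finprod_cong'[OF refl])
        (simp_all add: one \<kappa>_ne incl_closed[OF S _ f(2) \<kappa>])
    also have "\<dots> = push ?T S (\<lambda>x. x) s (\<kappa> ?T)"
      by (rule finprod_singleton_swap[OF T finite_subs[OF S]])
          (simp add: incl_closed[OF S _ f(2) \<kappa>])
    finally show "m \<in> ?U s" using \<kappa> zm by (auto simp: \<kappa>_def)
  qed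
  then show ?thesis by blast
qed

section \<open>V(S) as the colimit, at one object of the module category\<close>

lemma finprod_cocn_tot:
  assumes S: "finite S" and r: "r \<in> Ob Q" and dN: "d \<le> N" and c: "cocn N S r B m"
    and good: "\<And>\<kappa>. \<kappa> \<in> ker d S r \<Longrightarrow> good N d S r \<kappa>"
    and k: "\<kappa> \<in> fam d S r" "\<kappa>' \<in> fam d S r" and eq: "tot d S r \<kappa> = tot d S r \<kappa>'"
  shows "finprod B (\<lambda>T. m T (\<kappa> T)) (subs d S) = finprod B (\<lambda>T. m T (\<kappa>' T)) (subs d S)"
proof -
  interpret B: comm_group B using cocnD(1)[OF c] .
  interpret S: comm_group "Gr S r" using Gr_comm[OF S r] .
  let ?\<delta> = "\<lambda>T. \<kappa> T \<otimes>\<^bsub>Gr T r\<^esub> inv\<^bsub>Gr T r\<^esub> \<kappa>' T"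
  note i = fam_inv[OF S r k(2)]
  note \<delta> = fam_mult[OF S r k(1) i(1)]
  \<comment> \<open>Two families with the same total differ by a relation, which every cocone kills.
    The value of a cocone on a family thus depends only on the total.\<close>
  have "?\<delta> \<in> ker d S r"
    using \<delta> i(2) eq tot_closed[OF S r k(2)] by (simp add: ker_def)
  then have 1: "finprod B (\<lambda>T. m T (?\<delta> T)) (subs d S) = \<one>\<^bsub>B\<^esub>"
    using good c unfolding good_def by blast
  have eq: "?\<delta> T \<otimes>\<^bsub>Gr T r\<^esub> \<kappa>' T = \<kappa> T" if T: "T \<in> subs d S" for T
  proof -
    interpret T: comm_group "Gr T r" using Gr_comm[OF finite_in_subs[OF S T] r] .
    show ?thesis using famD[OF k(1) T] famD[OF k(2) T] by (simp add: T.m_assoc)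
  qed
  have "finprod B (\<lambda>T. m T (\<kappa> T)) (subs d S) = finprod B (\<lambda>T. m T (?\<delta> T \<otimes>\<^bsub>Gr T r\<^esub> \<kappa>' T)) (subs d S)"
    by (rule B.finprod_cong'[OF refl])
      (simp_all add: eq hom_in_carrier[OF cocnD(2)[OF c subs_mono[OF dN]] famD[OF k(1)]])
  also have "\<dots> = finprod B (\<lambda>T. m T (?\<delta> T)) (subs d S) \<otimes>\<^bsub>B\<^esub> finprod B (\<lambda>T. m T (\<kappa>' T)) (subs d S)"
    by (rule finprod_cocn_mult[OF c dN \<delta>(1) k(2)])
  also have "\<dots> = finprod B (\<lambda>T. m T (\<kappa>' T)) (subs d S)"
    using 1 finprod_cocn_closed[OF c dN k(2)] by simp
  finally show ?thesis .
qed

lemma subsets_diagram_Fob: "Fob (subsets_diagram V) T = Fob V T"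
  by (simp add: subsets_diagram_def fcomp_def subsets_to_FI_def)

lemma subsets_diagram_Fmor: "Fmor (subsets_diagram V) T T' a = push T T' (\<lambda>x. x)"
  by (simp add: subsets_diagram_def fcomp_def subsets_to_FI_def push_def incl_def restrict_def)

lemma subsets_cocone_push: "subsets_cocone V S T = push T S (\<lambda>x. x)"
  by (simp add: subsets_cocone_def push_def incl_def restrict_def)

lemma push_ext:
  assumes "finite T" "f ` S \<subseteq> T" "inj_on f S" "r \<in> Ob Q"
  shows "push S T f r \<in> extensional (carrier (Gr S r))"
  using Mods_MorD(3)[OF push_Mor[OF assms(1-3)] assms(4)] .

text \<open>The mediating map writes an element of V(S) as the total of a family and evaluates the
  cocone on that family; goodness makes the choice immaterial. Uniqueness holds because the images
  of V(T) with T of size at most \<open>d \<le> N\<close> generate V(S).\<close>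

lemma is_colimit_subsets_pointwise:
  assumes S: "finite S" and r: "r \<in> Ob Q" and dN: "d \<le> N"
    and good: "\<And>\<kappa>. \<kappa> \<in> ker d S r \<Longrightarrow> good N d S r \<kappa>"
    and surj: "\<And>T x. T \<subseteq> S \<Longrightarrow> x \<in> carrier (Gr T r) \<Longrightarrow> \<exists>\<kappa>\<in>fam d T r. tot d T r \<kappa> = x"
  shows "is_colimit (subsets_cat S N) Ab
    \<lparr>Fob = (\<lambda>T. Gr T r), Fmor = (\<lambda>T T' a. push T T' (\<lambda>x. x) r)\<rparr> (Gr S r) (\<lambda>T. push T S (\<lambda>x. x) r)"
    (is "is_colimit ?J Ab ?D ?L ?l")
  unfolding is_colimit_def
proof (intro conjI allI impI)
  have ObJ: "Ob ?J = subs N S" by (simp add: subsets_cat_def subs_def)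
  have MorJ: "a \<in> Mor ?J T T' \<longleftrightarrow> T \<subseteq> T'" for a T T' by (simp add: subsets_cat_def)
  interpret S: comm_group "Gr S r" using Gr_comm[OF S r] .
  have Ab: "Ob Ab = {A :: 'u monoid. comm_group A}" "Mor Ab A B = ab_hom A B"
    "Comp Ab A B B' g f = compose (carrier A) g f" for A B B' :: "'u monoid" and g f
    by (simp_all add: Ab_def)
  show "cocone ?J Ab ?D ?L ?l"
    unfolding cocone_def ObJ MorJ Ab
  proof (intro conjI ballI)
    show "?L \<in> {A. comm_group A}" using Gr_comm[OF S r] by simp
    fix T assume T: "T \<in> subs N S"
    show "?l T \<in> ab_hom (Fob ?D T) ?L"
      using push_incl_hom[OF S T r] push_ext[OF S _ _ r, of "\<lambda>x. x" T] subsD[OF T]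
          by (simp add: ab_hom_def)
    fix T' assume T': "T' \<in> subs N S"
    fix a :: unit assume "a \<in> Mor ?J T T'"
    then have sub: "T \<subseteq> T'" by (simp add: MorJ)
    have "push T' S (\<lambda>x. x) r (push T T' (\<lambda>x. x) r x) = push T S (\<lambda>x. x) r x"
        if "x \<in> carrier (Gr T r)" for x
      by (rule push_push[OF finite_in_subs[OF S T'] _ _ S _ _ r that])
          (use sub subsD[OF T'] in auto)
    then show "compose (carrier (Fob ?D T)) (?l T') (Fmor ?D T T' a) = ?l T"
      using push_ext[OF S _ _ r, of "\<lambda>x. x" T] subsD[OF T]
          by (auto simp: compose_def fun_eq_iff extensional_def)
  qed
  fix B m assume m: "cocone ?J Ab ?D B m"
  have mT: "m T \<in> hom (Gr T r) B" "m T \<in> extensional (carrier (Gr T r))" if "T \<in> subs N S" for T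
    using m that unfolding cocone_def ObJ Ab ab_hom_def by simp_all
  have mc: "m T' (push T T' (\<lambda>x. x) r x) = m T x"
    if "T' \<in> subs N S" "T \<subseteq> T'" "x \<in> carrier (Gr T r)" for T T' x
  proof -
    have "compose (carrier (Gr T r)) (m T') (push T T' (\<lambda>x. x) r) = m T"
      using m subs_subset[OF S that(1,2)] that(1,2) unfolding cocone_def ObJ Ab
      by (simp add: MorJ[of "()"])
    from fun_cong[OF this, of x] show ?thesis using that(3) by (simp add: compose_def)
  qed
  have B: "comm_group B" using m by (simp add: cocone_def Ab)
  interpret B: comm_group B by (fact B)
  have c: "cocn N S r B m" unfolding cocn_def using B mT(1) mc by simp
  define \<Phi> where "\<Phi> \<kappa> = finprod B (\<lambda>T. m T (\<kappa> T)) (subs d S)" for \<kappa>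
  define K where "K x = (SOME \<kappa>. \<kappa> \<in> fam d S r \<and> tot d S r \<kappa> = x)" for x
  define h where "h = (\<lambda>x\<in>carrier (Gr S r). \<Phi> (K x))"
  have K: "K x \<in> fam d S r" "tot d S r (K x) = x" if x: "x \<in> carrier (Gr S r)" for x
    using someI_ex[of "\<lambda>\<kappa>. \<kappa> \<in> fam d S r \<and> tot d S r \<kappa> = x"] surj[OF subset_refl x] unfolding K_def
        by blast+
  have h: "h (tot d S r \<kappa>) = \<Phi> \<kappa>" if \<kappa>: "\<kappa> \<in> fam d S r" for \<kappa>
  proof -
    have t: "tot d S r \<kappa> \<in> carrier (Gr S r)" by (rule tot_closed[OF S r \<kappa>])
    then show ?thesis
      using finprod_cocn_tot[OF S r dN c good K(1)[OF t] \<kappa> K(2)[OF t]] by (simp add: h_def \<Phi>_def)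
  qed
  have hom: "h \<in> hom (Gr S r) B"
  proof (rule homI)
    fix x assume x: "x \<in> carrier (Gr S r)"
    then show "h x \<in> carrier B"
      using finprod_cocn_closed[OF c dN K(1)[OF x]] by (simp add: h_def \<Phi>_def)
    fix y assume y: "y \<in> carrier (Gr S r)"
    note k = K(1)[OF x] K(1)[OF y]
    have "x \<otimes>\<^bsub>Gr S r\<^esub> y = tot d S r (\<lambda>T. K x T \<otimes>\<^bsub>Gr T r\<^esub> K y T)"
      using fam_mult(2)[OF S r k] K(2)[OF x] K(2)[OF y] by simp
    then show "h (x \<otimes>\<^bsub>Gr S r\<^esub> y) = h x \<otimes>\<^bsub>B\<^esub> h y"
      using h[OF fam_mult(1)[OF S r k]] finprod_cocn_mult[OF c dN k] x y by (simp add: \<Phi>_def h_def)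
  qed
  \<comment> \<open>A set \<open>T\<close> of size between \<open>d\<close> and \<open>N\<close> is
    in the diagram but is not a summand of Q. So \<open>x\<close> is decomposed over the small
    subsets of \<open>T\<close> itself, which is why \<open>surj\<close> is assumed for all subsets
    of \<open>S\<close>. The family is extended to \<open>S\<close> by neutral elements, and over
    \<open>T\<close> its cocone value collapses to \<open>m T x\<close>.\<close>
  have hl: "h (push T S (\<lambda>x. x) r x) = m T x" if T: "T \<in> subs N S" and x: "x \<in> carrier (Gr T r)"
      for T x
  proof -
    note TS = subsD[OF T] and finT = finite_in_subs[OF S T]
    have i: "(\<lambda>x. x) ` T \<subseteq> S" "inj_on (\<lambda>x. x) T" using TS by auto
    obtain \<kappa> where \<kappa>: "\<kappa> \<in> fam d T r" "tot d T r \<kappa> = x" using surj[OF TS x] by blast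
    have cT: "cocn N T r B m"
      unfolding cocn_def using B mT(1) mc TS by (auto simp: subs_def)
    have "h (push T S (\<lambda>x. x) r x) = \<Phi> (pfam T (\<lambda>x. x) r \<kappa>)"
      using h[OF pfam_fam[OF S i r \<kappa>(1)]] tot_pfam[OF S i r \<kappa>(1)] \<kappa>(2) by simp
    also have "\<dots> = finprod B (\<lambda>T'. m T' (push T' T' (\<lambda>x. x) r (\<kappa> T'))) (subs d T)"
      unfolding \<Phi>_def using finprod_pfam[OF B S i r \<kappa>(1), of m] mT(1)[OF subs_mono[OF dN]] by simp
    also have "\<dots> = finprod B (\<lambda>T'. m T' (\<kappa> T')) (subs d T)"
    proof (rule B.finprod_cong'[OF refl])
      fix T' assume T': "T' \<in> subs d T"
      show "m T' (push T' T' (\<lambda>x. x) r (\<kappa> T')) = m T' (\<kappa> T')"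
        using push_id[OF finite_in_subs[OF finT T'] r famD[OF \<kappa>(1) T']] by simp
    next
      show "(\<lambda>T'. m T' (\<kappa> T')) \<in> subs d T \<rightarrow> carrier B"
        by (simp add: hom_in_carrier[OF cocnD(2)[OF cT subs_mono[OF dN]] famD[OF \<kappa>(1)]])
    qed
    also have "\<dots> = m T x"
      using finprod_cocn_eq[OF cT finT r dN _ \<kappa>(1)] \<kappa>(2) T by (simp add: subs_def)
    finally show ?thesis .
  qed
  have "mediates ?J Ab ?D ?L ?l B m h"
    unfolding mediates_def ObJ Ab
  proof (intro conjI ballI)
    show "h \<in> ab_hom (Gr S r) B" using hom by (simp add: ab_hom_def h_def)
    show "compose (carrier (Fob ?D T)) h (?l T) = m T" if "T \<in> subs N S" for T
      using hl[OF that] mT(2)[OF that] by (auto simp: compose_def fun_eq_iff extensional_def)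
  qed
  moreover have "h' = h" if h': "mediates ?J Ab ?D ?L ?l B m h'" for h'
  proof -
    have h'1: "h' \<in> hom (Gr S r) B" "h' \<in> extensional (carrier (Gr S r))"
      using h' unfolding mediates_def Ab ab_hom_def by simp_all
    have h'2: "h' (push T S (\<lambda>x. x) r x) = m T x" if "T \<in> subs N S" "x \<in> carrier (Gr T r)" for T x
    proof -
      have "compose (carrier (Gr T r)) h' (push T S (\<lambda>x. x) r) = m T"
        using h' that(1) unfolding mediates_def ObJ Ab by simp
      from fun_cong[OF this, of x] show ?thesis using that(2) by (simp add: compose_def)
    qed
    have "h' x = h x" if x: "x \<in> carrier (Gr S r)" for x
    proof -
      note k = K[OF x]
      have "h' x = finprod B (\<lambda>T. h' (push T S (\<lambda>x. x) r (K x T))) (subs d S)"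
        using hom_finprod[OF Gr_comm[OF S r] B h'1(1), of "\<lambda>T. push T S (\<lambda>x. x) r (K x T)"
            "subs d S"]
          incl_closed[OF S _ r k(1)] k(2) by (simp add: tot_def)
      also have "\<dots> = \<Phi> (K x)"
        unfolding \<Phi>_def
      proof (rule B.finprod_cong'[OF refl])
        show "(\<lambda>T. m T (K x T)) \<in> subs d S \<rightarrow> carrier B"
          by (simp add: hom_in_carrier[OF cocnD(2)[OF c subs_mono[OF dN]] famD[OF k(1)]])
      qed (rule h'2[OF subs_mono[OF dN] famD[OF k(1)]])
      finally show ?thesis using x by (simp add: h_def)
    qed
    then show ?thesis using h'1(2) by (intro extensionalityI[of _ "carrier (Gr S r)"])
        (simp_all add: h_def)
  qed
  ultimately show "\<exists>!h. mediates ?J Ab ?D ?L ?l B m h" by blast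
qed

end

section \<open>Comparison of V(S) with an arbitrary colimit\<close>

theorem theorem5:
  fixes R :: "'u small_preadd_cat" and V :: "'u fi_mod"
  assumes "infinite (UNIV :: 'u set)"
    and "preadditive R"
    and "locally_noetherian TYPE('u) (Mod_cat R)"
    and "V \<in> Ob (FI_Mod R)"
    and "finitely_generated TYPE('u) (FI_Mod R) V"
  shows "\<exists>N::nat. \<forall>S\<in>Ob FI.
      (\<exists>L l. is_colimit (subsets_cat S N) (Mod_cat R) (subsets_diagram V) L l) \<and>
      (\<forall>L l. is_colimit (subsets_cat S N) (Mod_cat R) (subsets_diagram V) L l \<longrightarrow>
         iso_in (Mod_cat R) L (Fob V S)
           (colim_map (subsets_cat S N) (Mod_cat R) (subsets_diagram V) L l
              (Fob V S) (subsets_cocone V S)))"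
proof -
  define Q where "Q = opposite R"
  have ModQ: "Mod_cat R = Mods Q" and FIQ: "FI_Mod R = functor_cat FI (Mods Q)"
    by (simp_all add: Q_def Mod_cat_eq_Mods FI_Mod_def)
  have Q: "preadditive Q" unfolding Q_def by (rule preadditive_opposite) fact
  interpret fi_functor Q V
    by (rule fi_functor.intro[OF Q]) (use assms(4) in \<open>simp add: FIQ\<close>)
  obtain e :: "nat \<Rightarrow> 'u" where e: "inj e" using infinite_countable_subset[OF assms(1)] by blast
  obtain F where F: "finite F"
    "\<And>S r. finite S \<Longrightarrow> r \<in> Ob Q \<Longrightarrow> carrier (Gr S r) \<subseteq> mspan Q (Fob V S) (gens e F S) r"
    using finite_generation[OF assms(1) _ e] assms(5) unfolding FIQ by blast
  have "noeth_sub Q (Fob V (e ` {..<n})) (\<lambda>r. carrier (Gr (e ` {..<n}) r))" for n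
    using noeth_sub_carrier[OF _ F(1) F(2) assms(1)] assms(3) unfolding ModQ by simp
  \<comment> \<open>The degree bound is the largest degree occurring in \<open>F\<close>; inserting
    0 covers an empty \<open>F\<close>.\<close>
  then obtain N where N: "Max (insert 0 (fst ` F)) \<le> N"
    "\<And>S r \<kappa>. finite S \<Longrightarrow> r \<in> Ob Q \<Longrightarrow> \<kappa> \<in> ker (Max (insert 0 (fst ` F))) S r \<Longrightarrow>
      good N (Max (insert 0 (fst ` F))) S r \<kappa>"
    using kernel_good[OF e, of "Max (insert 0 (fst ` F))"] by blast
  define d where "d = Max (insert 0 (fst ` F))"
  have d: "n \<le> d" if "(n, s, x) \<in> F" for n s x
    unfolding d_def using F(1) that by (intro Max_ge) force+
  \<comment> \<open>This gives both claims at once: a colimit exists, and the canonical map from any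
    other one is an isomorphism by uniqueness. As colimits of functors may be checked pointwise, it
    reduces to groups at each object \<open>r\<close>.\<close>
  have col: "is_colimit (subsets_cat S N) (Mod_cat R) (subsets_diagram V) (Fob V S)
      (subsets_cocone V S)"
    if "S \<in> Ob FI" for S
  proof -
    have S: "finite S" using that by (simp add: FI_def)
    have fctr: "is_functor (subsets_cat S N) (Mods Q) (subsets_diagram V)"
      unfolding subsets_diagram_def
      by (rule is_functor_fcomp[OF subsets_to_FI[OF S]]) (use V in \<open>simp add: functor_cat_def\<close>)
    note coc = subsets_cocone[OF S assms(4), of N, unfolded ModQ]
    show ?thesis
      unfolding ModQ Mods_def
    proof (rule is_colimit_full[OF _ _ Ob_Mods_subset])
      show "Fob V S \<in> {M. additive_functor Q Ab M}" using Gr_add[OF S] by simp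
      show "is_colimit (subsets_cat S N) (functor_cat Q Ab) (subsets_diagram V) (Fob V S)
          (subsets_cocone V S)"
      proof (rule is_colimit_functor_cat[OF preadditive.axioms(1)[OF Q] category_Ab
            is_functor_full[OF fctr[unfolded Mods_def] Ob_Mods_subset]
                cocone_full[OF coc[unfolded Mods_def] Ob_Mods_subset]])
        fix r assume r: "r \<in> Ob Q"
        show "is_colimit (subsets_cat S N) Ab \<lparr>Fob = (\<lambda>j. Fob (Fob (subsets_diagram V) j) r),
            Fmor = (\<lambda>i j a. Fmor (subsets_diagram V) i j a r)\<rparr> (Gr S r)
                (\<lambda>j. subsets_cocone V S j r)"
          unfolding subsets_diagram_Fob subsets_diagram_Fmor subsets_cocone_push
        proof (rule is_colimit_subsets_pointwise[OF S r N(1)[folded d_def]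
            N(2)[folded d_def, OF S r]])
          fix T x assume T: "T \<subseteq> S" and x: "x \<in> carrier (Gr T r)"
          have finT: "finite T" using finite_subset[OF T S] .
          show "\<exists>\<kappa>\<in>fam d T r. tot d T r \<kappa> = x"
            by (rule tot_surj[OF finT r d F(2)[OF finT r] x])
        qed
      qed
    qed
  qed
  have ob: "Fob (subsets_diagram V) T \<in> Ob (Mod_cat R)" if "S \<in> Ob FI" "T \<in> Ob (subsets_cat S N)"
      for S T
    using that Gr_add[of T] unfolding ModQ subsets_diagram_Fob Ob_Mods
    by (auto simp: FI_def subsets_cat_def dest: finite_subset)
  show ?thesis
  proof (intro exI[of _ N] ballI conjI allI impI)
    fix S :: "'u set" assume S: "S \<in> Ob FI"
    show "\<exists>L l. is_colimit (subsets_cat S N) (Mod_cat R) (subsets_diagram V) L l" using col[OF S]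
        by blast
    fix L l assume "is_colimit (subsets_cat S N) (Mod_cat R) (subsets_diagram V) L l"
    from colim_map_iso[OF category_Mod_cat[OF assms(2)] ob[OF S] this col[OF S]]
    show "iso_in (Mod_cat R) L (Fob V S) (colim_map (subsets_cat S N) (Mod_cat R)
        (subsets_diagram V) L l
              (Fob V S) (subsets_cocone V S))" .
  qed
qed

end
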